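(* Let $\mathbb{L}\subseteq\mathbb{R}^d$ be a lattice, let $r,s\in\mathbb{N}_0$, $R>0$, and let $K\subseteq\mathbb{R}^d$ be nonempty, compact and topologically regular. Then $$\lim_{a\to0_+}d_{bL}\big(\mathcal{V}_R^{r,s}(K;\cdot),\mathcal{V}_R^{r,s}(K\cap a\mathbb{L};\cdot)\big)=0,\qquad \lim_{a\to0_+}\mathcal{V}_R^{r,s}(K\cap a\mathbb{L})=\mathcal{V}_R^{r,s}(K).$$ If, in addition, $K$ has positive reach and $0<R_0<\dots<R_d<\mathrm{Reach}(K)$ are the radii used to define the estimators $\hat\Phi_k^{r,s}$, then $$\lim_{a\to0_+}\hat\Phi_k^{r,s}(K\cap a\mathbb{L})=\Phi_k^{r,s}(K)\qquad\text{for all }k\in\{0,\dots,d\}.$$ If $K$ is $\delta$-regular for some $\delta>0$, or a topologically regular convex set, then the speed of convergence in the last limit is $O(a)$ when $r=s=0$ and $O(\sqrt a)$ otherwise; that is, as $a\to0_+$, $|\hat\Phi_k^{r,s}(K\cap a\mathbb{L})-\Phi_k^{r,s}(K)|$ is $O(a)$ if $r=s=0$ and $O(\sqrt a)$ otherwise.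
   Context: Basic notation. A lattice $\mathbb{L}\subseteq\mathbb{R}^d$ is a full-rank lattice (the integer span of a basis of $\mathbb{R}^d$); $a\mathbb{L}=\{az:z\in\mathbb{L}\}$. $\mathcal{H}^d$ is $d$-dimensional Hausdorff (Lebesgue) measure. $\kappa_j$ is the volume of the unit ball in $\mathbb{R}^j$ ($\kappa_0=1$), $\omega_j=j\kappa_j$ is the surface area of the unit sphere in $\mathbb{R}^j$. $\Sigma=\mathbb{R}^d\times S^{d-1}$. For a nonempty compact $K\subseteq\mathbb{R}^d$, $d_K(x)$ is the distance from $x$ to $K$, $K^R=\{x:d_K(x)\le R\}$, and $p_K(x)$ is the closest point of $K$ to $x$ when it is unique (this holds for almost every $x$). For a closed set $M$, $\mathrm{Reach}(M)$ is the supremum of all $R\ge0$ such that every $x$ at distance less than $R$ from $M$ has a unique closest point in $M$. A set is topologically regular if it is the closure of its interior; $K$ is $\delta$-regular if it is topologically regular and $\mathrm{Reach}(K)\ge\delta$ and $\mathrm{Reach}(\mathrm{cl}(\mathbb{R}^d\setminus K))\ge\delta$. For $a$ sufficiently small $K\cap a\mathbb{L}$ is nonempty, and only such $a$ matter. Tensors. $\mathbb{T}^p$ is the space of symmetric rank-$p$ tensors over $\mathbb{R}^d$, viewed as symmetric $p$-linear maps $(\mathbb{R}^d)^p\to\mathbb{R}$, with norm $|T|=\sup\{|T(v_1,\dots,v_p)|:|v_1|=\dots=|v_p|=1\}$. For $x,y\in\mathbb{R}^d$, $x^ry^s\in\mathbb{T}^{r+s}$ is the symmetrization of $x^{\otimes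 r}\otimes y^{\otimes s}$ (average over all permutations of factors). Voronoi tensor measures. For nonempty compact $K$ and Borel $A\subseteq\mathbb{R}^d$, $\mathcal{V}_R^{r,s}(K;A)=\int_{K^R}\mathbf{1}_A(p_K(x))\,p_K(x)^r(x-p_K(x))^s\,dx\in\mathbb{T}^{r+s}$, and $\mathcal{V}_R^{r,s}(K)=\mathcal{V}_R^{r,s}(K;\mathbb{R}^d)$. For bounded $\mathbb{T}^p$-valued Borel measures on $\mathbb{R}^d$, $d_{bL}(\mu,\nu)=\sup\{|\int f\,d\mu-\int f\,d\nu|\}$ over bounded Lipschitz $f:\mathbb{R}^d\to\mathbb{R}$ with $|f|_L+|f|_\infty\le1$, where $|f|_L$ is the optimal Lipschitz constant and $|f|_\infty$ the supremum norm. Minkowski tensors. For compact $K$ of positive reach, the generalized curvature (support) measures $\Lambda_k(K;\cdot)$, $k=0,\dots,d-1$, are the signed Borel measures on $\Sigma$ determined by the local Steiner formula $$\mathcal{H}^d\Big(\Big\{x\in K^R\setminus K:\Big(p_K(x),\tfrac{x-p_K(x)}{|x-p_K(x)|}\Big)\in B\Big\}\Big)=\sum_{k=0}^{d-1}R^{d-k}\kappa_{d-k}\Lambda_k(K;B)$$ for all $0<R<\mathrm{Reach}(K)$ and all Borel $B\subseteq\Sigma$. For $k\in\{0,\dots,d-1\}$, $$\Phi_k^{r,s}(K)=\frac1{r!s!}\frac{\omega_{d-k}}{\omega_{d-k+s}}\int_\Sigma x^ru^s\,\Lambda_k(K;d(x,u))\in\mathbb{T}^{r+s},$$ and $\Phi_d^{r,0}(K)=\frac1{r!}\int_Kx^r\,dx$,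 $\Phi_d^{r,s}(K)=0$ for $s\ge1$. Estimators. Fix $0<R_0<\dots<R_d$ (independent of $a$). With the invertible $(d+1)\times(d+1)$ matrix $A_{R_0,\dots,R_d}^{r,s}=r!s!\,(\kappa_{s+j}R_i^{s+j})_{i,j=0,\dots,d}$, for nonempty compact $K_0$, $$\big(\hat\Phi_d^{r,s}(K_0),\hat\Phi_{d-1}^{r,s}(K_0),\dots,\hat\Phi_0^{r,s}(K_0)\big)^\top=\big(A_{R_0,\dots,R_d}^{r,s}\big)^{-1}\big(\mathcal{V}_{R_0}^{r,s}(K_0),\dots,\mathcal{V}_{R_d}^{r,s}(K_0)\big)^\top .$$ *)

theory Defs
  imports "HOL-Analysis.Analysis" "HOL-Library.Landau_Symbols"
    "HOL-Combinatorics.Permutations" "Jordan_Normal_Form.Gauss_Jordan_Elimination"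
begin

section \<open>Symmetric tensors\<close>

text \<open>
  The rank varies with r and s, so tensors are not given a type of their own: a rank-p tensor is
  represented by the function that sends the list [v1, ..., vp] of its arguments to its value and
  sends lists of any other length to 0. Vector space operations are pointwise.
\<close>

type_synonym 'a tensor = "'a list \<Rightarrow> real"

definition tensor_prod :: "'a::euclidean_space list \<Rightarrow> 'a tensor" where
  "tensor_prod ws vs =
     (if length vs = length ws then (\<Prod>i<length ws. inner (ws ! i) (vs ! i)) else 0)"

definition symmetrize :: "nat \<Rightarrow> 'a tensor \<Rightarrow> 'a tensor" where
  "symmetrize p T vs =
     (if length vs = p
      then (\<Sum>\<pi> | \<pi> permutes {..<p}. T (map (\<lambda>i. vs ! \<pi> i) [0..<p])) / fact p else 0)"

definition tensor_power_prod :: "nat \<Rightarrow> nat \<Rightarrow> 'a::euclidean_space \<Rightarrow> 'a \<Rightarrow> 'a tensor" where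
  "tensor_power_prod r s x y = symmetrize (r + s) (tensor_prod (replicate r x @ replicate s y))"

definition tensor_power :: "nat \<Rightarrow> 'a::euclidean_space \<Rightarrow> 'a tensor" where
  "tensor_power r x = symmetrize r (tensor_prod (replicate r x))"

definition tensor_norm :: "nat \<Rightarrow> 'a::euclidean_space tensor \<Rightarrow> real" where
  "tensor_norm p T = (SUP vs\<in>{vs. length vs = p \<and> (\<forall>v\<in>set vs. norm v = 1)}. \<bar>T vs\<bar>)"


section \<open>Signed and tensor-valued measures\<close>

text \<open>As for \<^const>\<open>emeasure\<close>, the value on sets outside the sigma-algebra is 0, so that a signed
  measure is determined, as a function, by its values on measurable sets.\<close>

definition signed_measure :: "'b measure \<Rightarrow> ('b set \<Rightarrow> real) \<Rightarrow> bool" where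
  "signed_measure M \<mu> \<longleftrightarrow>
     \<mu> {} = 0 \<and>
     (\<forall>A::nat \<Rightarrow> 'b set. range A \<subseteq> sets M \<and> disjoint_family A \<longrightarrow>
        (\<lambda>i. \<mu> (A i)) sums \<mu> (\<Union>i. A i)) \<and>
     (\<forall>B. B \<notin> sets M \<longrightarrow> \<mu> B = 0)"

text \<open>Positive part of the Jordan decomposition. Since \<^const>\<open>ennreal\<close> truncates negative numbers
  to 0 and the empty set is among the sets B, truncation does not affect the supremum.\<close>

definition positive_variation :: "'b measure \<Rightarrow> ('b set \<Rightarrow> real) \<Rightarrow> 'b measure" where
  "positive_variation M \<mu> =
     measure_of (space M) (sets M) (\<lambda>A. SUP B\<in>{B \<in> sets M. B \<subseteq> A}. ennreal (\<mu> B))"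

definition signed_integral ::
    "'b measure \<Rightarrow> ('b set \<Rightarrow> real) \<Rightarrow> ('b \<Rightarrow> real) \<Rightarrow> real" where
  "signed_integral M \<mu> f =
     (LINT x|positive_variation M \<mu>. f x) - (LINT x|positive_variation M (\<lambda>A. - \<mu> A). f x)"

type_synonym 'a tensor_measure = "'a set \<Rightarrow> 'a tensor"

definition tensor_integral :: "'a::euclidean_space tensor_measure \<Rightarrow> ('a \<Rightarrow> real) \<Rightarrow> 'a tensor" where
  "tensor_integral \<mu> f vs = signed_integral borel (\<lambda>A. \<mu> A vs) f"

definition bL_unit_ball :: "('a::euclidean_space \<Rightarrow> real) set" where
  "bL_unit_ball =
     {f. (\<exists>C. lipschitz_on C UNIV f) \<and> bounded (range f) \<and>
         Inf {C. lipschitz_on C UNIV f} + (SUP x. \<bar>f x\<bar>) \<le> 1}"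

definition d_bL :: "nat \<Rightarrow> 'a::euclidean_space tensor_measure \<Rightarrow> 'a tensor_measure \<Rightarrow> real" where
  "d_bL p \<mu> \<nu> =
     (SUP f\<in>bL_unit_ball. tensor_norm p (\<lambda>vs. tensor_integral \<mu> f vs - tensor_integral \<nu> f vs))"


section \<open>Lattices, reach and regularity\<close>

definition is_lattice :: "'a::euclidean_space set \<Rightarrow> bool" where
  "is_lattice L \<longleftrightarrow>
     (\<exists>B. independent B \<and> span B = UNIV \<and>
          L = {(\<Sum>b\<in>B. of_int (c b) *\<^sub>R b) | c :: 'a \<Rightarrow> int. True})"

definition reach :: "'a::euclidean_space set \<Rightarrow> ereal" where
  "reach M =
     Sup {ereal R | R. 0 \<le> R \<and>
            (\<forall>x. infdist x M < R \<longrightarrow> (\<exists>!y. y \<in> M \<and> dist x y = infdist x M))}"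

definition topologically_regular :: "'a::euclidean_space set \<Rightarrow> bool" where
  "topologically_regular K \<longleftrightarrow> closure (interior K) = K"

definition delta_regular :: "real \<Rightarrow> 'a::euclidean_space set \<Rightarrow> bool" where
  "delta_regular \<delta> K \<longleftrightarrow>
     topologically_regular K \<and> ereal \<delta> \<le> reach K \<and> ereal \<delta> \<le> reach (closure (- K))"

definition parallel_set :: "'a::euclidean_space set \<Rightarrow> real \<Rightarrow> 'a set" where
  "parallel_set K R = {x. infdist x K \<le> R}"


section \<open>Voronoi tensor measures\<close>

text \<open>\<^const>\<open>closest_point\<close> picks some closest point where it is not unique. The set of such points
  is a null set, and since \<^const>\<open>lebesgue\<close> is complete (unlike \<^const>\<open>lborel\<close>), the integrand is
  measurable and the integral does not depend on the choice.\<close>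

definition voronoi_measure ::
    "real \<Rightarrow> nat \<Rightarrow> nat \<Rightarrow> 'a::euclidean_space set \<Rightarrow> 'a tensor_measure" where
  "voronoi_measure R r s K A vs =
     (LINT x:parallel_set K R|lebesgue.
        indicator A (closest_point K x) *
        tensor_power_prod r s (closest_point K x) (x - closest_point K x) vs)"

definition voronoi_tensor ::
    "real \<Rightarrow> nat \<Rightarrow> nat \<Rightarrow> 'a::euclidean_space set \<Rightarrow> 'a tensor" where
  "voronoi_tensor R r s K = voronoi_measure R r s K UNIV"


section \<open>Minkowski tensors\<close>

definition normal_bundle_space :: "('a::euclidean_space \<times> 'a) measure" where
  "normal_bundle_space = restrict_space borel (UNIV \<times> sphere 0 1)"

definition local_steiner_formula ::
    "'a::euclidean_space set \<Rightarrow> (nat \<Rightarrow> ('a \<times> 'a) set \<Rightarrow> real) \<Rightarrow> bool" where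
  "local_steiner_formula K \<Lambda> \<longleftrightarrow>
     (\<forall>R B. 0 < R \<and> ereal R < reach K \<and> B \<in> sets normal_bundle_space \<longrightarrow>
        measure lebesgue
          {x \<in> parallel_set K R - K. (closest_point K x, sgn (x - closest_point K x)) \<in> B} =
        (\<Sum>k<DIM('a). R ^ (DIM('a) - k) * unit_ball_vol (real (DIM('a) - k)) * \<Lambda> k B))"

text \<open>Only the indices below the dimension matter; the others are set to the zero measure to make
  the family unique.\<close>

definition support_measure ::
    "'a::euclidean_space set \<Rightarrow> nat \<Rightarrow> ('a \<times> 'a) set \<Rightarrow> real" where
  "support_measure K =
     (THE \<Lambda>. (\<forall>k<DIM('a). signed_measure normal_bundle_space (\<Lambda> k)) \<and>
             (\<forall>k\<ge>DIM('a). \<Lambda> k = (\<lambda>B. 0)) \<and>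
             local_steiner_formula K \<Lambda>)"

definition sphere_area :: "nat \<Rightarrow> real" where
  "sphere_area j = real j * unit_ball_vol (real j)"

definition minkowski_tensor ::
    "nat \<Rightarrow> nat \<Rightarrow> nat \<Rightarrow> 'a::euclidean_space set \<Rightarrow> 'a tensor" where
  "minkowski_tensor k r s K vs =
     (if k < DIM('a) then
        1 / (fact r * fact s) * (sphere_area (DIM('a) - k) / sphere_area (DIM('a) - k + s)) *
        signed_integral normal_bundle_space (support_measure K k)
          (\<lambda>(x, u). tensor_power_prod r s x u vs)
      else if k = DIM('a) \<and> s = 0 then
        1 / fact r * (LINT x:K|lebesgue. tensor_power r x vs)
      else 0)"


section \<open>Estimators\<close>

definition steiner_matrix :: "nat \<Rightarrow> nat \<Rightarrow> nat \<Rightarrow> (nat \<Rightarrow> real) \<Rightarrow> real mat" where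
  "steiner_matrix d r s \<rho> =
     Matrix.mat (d + 1) (d + 1)
       (\<lambda>(i, j). fact r * fact s * (unit_ball_vol (real (s + j)) * \<rho> i ^ (s + j)))"

text \<open>The estimators are listed with decreasing k, so the k-th one is row d - k of the product of
  the inverse matrix with the column of Voronoi tensors.\<close>

definition minkowski_estimator ::
    "(nat \<Rightarrow> real) \<Rightarrow> nat \<Rightarrow> nat \<Rightarrow> nat \<Rightarrow> 'a::euclidean_space set \<Rightarrow> 'a tensor" where
  "minkowski_estimator \<rho> k r s K vs =
     (\<Sum>i\<le>DIM('a). the (mat_inverse (steiner_matrix DIM('a) r s \<rho>)) $$ (DIM('a) - k, i) *
                  voronoi_tensor (\<rho> i) r s K vs)"

end

theory Submission
  imports Defs "Jordan_Normal_Form.Determinant"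
begin

text \<open>
  Since K is topologically regular, the sets \<open>K \<inter> aL\<close> converge to K in the Hausdorff metric, with
  speed O(a) if K satisfies a uniform interior ball condition. The metric projection onto a compact
  set is almost everywhere unique and depends continuously on the set there, so dominated
  convergence gives the convergence of the Voronoi tensors, with a bound that is uniform over the
  bounded Lipschitz test functions.

  For a set of positive reach the volume of a local parallel set is a polynomial in the radius. The
  dilation \<open>x \<mapsto> x + t(x - p(x))\<close>, p being the projection, maps local parallel sets to local parallel
  sets, and near the identity the volume of the image under \<open>x \<mapsto> x + tq(x)\<close>, q Lipschitz, is a
  polynomial in t: for differentiable q this is the change of variables formula, and the general
  case follows by mollification, because limits of polynomials of bounded degree are polynomials.
  No differentiability of p (Rademacher's theorem) is needed. The Steiner polynomial yields the
  support measures and, integrated against powers of the distance, expresses the Voronoi tensors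
  through the Minkowski tensors by the Steiner matrix. The estimator applies the inverse matrix, so
  its error is bounded by that of the Voronoi tensors. Below the reach, projections onto
  h-close subsets of K differ by \<open>O(sqrt h)\<close>, whereas volumes differ by O(h).
\<close>

section \<open>Metric projection and reach\<close>

text \<open>Only lattice points inside K count. The Hausdorff distance is therefore governed by how
  far from a point of K a ball inside K can be found whose radius is the covering radius aD of the
  scaled lattice. Topological regularity provides such balls without any rate; convexity, or
  positive reach of the closed complement, provides them at a distance proportional to aD. The
  square root comes from tangent balls: a point of K that is h-nearly closest to x must avoid the
  empty ball at the true foot point, which confines it only to order sqrt h. Volumes of parallel
  sets depend on distances alone; these change by at most h, and the Steiner polynomial is Lipschitz
  in the radius. Integrals against signed measures are defined through the Jordan decomposition and
  are not visibly linear in the measure. The signed measures are written as linear combinations of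
  image measures of Lebesgue measure, all dominated by one of them, and densities restore linearity.
  Interpolation at fixed nodes serves the same end: Steiner coefficients become fixed linear
  combinations of positive measures.\<close>

definition unp :: "'a::euclidean_space set \<Rightarrow> 'a set" where
  "unp M = {x. \<exists>!y. y \<in> M \<and> dist x y = infdist x M}"

lemma closest_point_infdist:
  fixes M :: "'a::euclidean_space set"
  assumes "closed M" "M \<noteq> {}"
  shows "closest_point M x \<in> M" "dist x (closest_point M x) = infdist x M"
proof -
  show *: "closest_point M x \<in> M" using closest_point_in_set assms by blast
  obtain y where y: "y \<in> M" "infdist x M = dist x y"
    using infdist_attains_inf[OF assms] by blast
  have "dist x (closest_point M x) \<le> dist x y"
    using closest_point_le assms y by blast
  moreover have "infdist x M \<le> dist x (closest_point M x)" by (rule infdist_le[OF *])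
  ultimately show "dist x (closest_point M x) = infdist x M" using y by simp
qed

lemma closest_point_unp:
  fixes M :: "'a::euclidean_space set"
  assumes "closed M" "x \<in> unp M" "y \<in> M" "dist x y = infdist x M"
  shows "closest_point M x = y"
proof -
  have "M \<noteq> {}" using assms(3) by blast
  then show ?thesis using assms closest_point_infdist[of M x] unfolding unp_def by blast
qed

text \<open>A minimizing sequence is bounded and each of its limit points is again a nearest point,
  so uniqueness leaves only one. The \<open>y n\<close> are arbitrary points of M; the lemma thus
  serves both for continuity of the projection in x and for its stability when M is replaced by a
  subset.\<close>

lemma tendsto_closest_point:
  fixes M :: "'a::euclidean_space set" and y :: "nat \<Rightarrow> 'a"
  assumes "closed M" "x \<in> unp M" "\<And>n. y n \<in> M" "(\<lambda>n. dist x (y n)) \<longlonglongrightarrow> infdist x M"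
  shows "y \<longlonglongrightarrow> closest_point M x"
proof (rule ccontr)
  assume "\<not> ?thesis"
  then obtain e where e: "e > 0" "\<not> (\<forall>\<^sub>F n in sequentially. dist (y n) (closest_point M x) < e)"
    unfolding tendsto_iff by blast
  then have "\<exists>\<^sub>F n in sequentially. e \<le> dist (y n) (closest_point M x)"
    by (simp add: not_eventually not_less)
  then have "infinite {n. e \<le> dist (y n) (closest_point M x)}"
    by (metis frequently_cofinite cofinite_eq_sequentially)
  then obtain \<phi> :: "nat \<Rightarrow> nat" where \<phi>: "strict_mono \<phi>" "\<And>n. e \<le> dist (y (\<phi> n)) (closest_point M x)"
    using infinite_enumerate[of "{n. e \<le> dist (y n) (closest_point M x)}"] by auto
  have bd: "bounded (range y)"
  proof -
    obtain B where B: "\<And>n. norm (dist x (y n)) \<le> B"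
      using convergent_imp_Bseq[OF convergentI[OF assms(4)]] unfolding Bseq_def by auto
    then have "y n \<in> cball x B" for n by simp
    then show ?thesis by (meson bounded_cball bounded_subset image_subsetI)
  qed
  then have "bounded (range (y \<circ> \<phi>))" by (rule bounded_subset) auto
  then obtain l \<psi> where l: "strict_mono \<psi>" "((y \<circ> \<phi>) \<circ> \<psi>) \<longlonglongrightarrow> l"
    using bounded_imp_convergent_subsequence by blast
  have "l \<in> M"
    by (rule Lim_in_closed_set[OF assms(1) _ _ l(2)]) (use assms(3) in auto)
  moreover have "(\<lambda>n. dist x (((y \<circ> \<phi>) \<circ> \<psi>) n)) \<longlonglongrightarrow> dist x l"
    by (intro tendsto_intros l(2))
  moreover have "(\<lambda>n. dist x (((y \<circ> \<phi>) \<circ> \<psi>) n)) \<longlonglongrightarrow> infdist x M"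
    using LIMSEQ_subseq_LIMSEQ[OF assms(4) strict_mono_o[OF \<phi>(1) l(1)]] by (simp add: o_def)
  ultimately have "closest_point M x = l"
    using LIMSEQ_unique closest_point_unp[OF assms(1,2)] by blast
  moreover have "e \<le> dist l (closest_point M x)"
  proof (rule tendsto_lowerbound)
    show "(\<lambda>n. dist (((y \<circ> \<phi>) \<circ> \<psi>) n) (closest_point M x)) \<longlonglongrightarrow> dist l (closest_point M x)"
      by (intro tendsto_intros l(2))
  qed (use \<phi> in auto)
  ultimately show False using e by simp
qed

lemma continuous_on_closest_point_unp:
  fixes M :: "'a::euclidean_space set"
  assumes "closed M" "M \<noteq> {}"
  shows "continuous_on (unp M) (closest_point M)"
  unfolding continuous_on_sequentially
proof (intro allI ballI impI, elim conjE)
  fix X x assume x: "x \<in> unp M" and X: "\<forall>n. X n \<in> unp M" "X \<longlonglongrightarrow> x"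
  have "(\<lambda>n. closest_point M (X n)) \<longlonglongrightarrow> closest_point M x"
  proof (rule tendsto_closest_point[OF assms(1) x])
    show "closest_point M (X n) \<in> M" for n using closest_point_infdist assms by blast
    show "(\<lambda>n. dist x (closest_point M (X n))) \<longlonglongrightarrow> infdist x M"
    proof (rule tendsto_sandwich)
      show "\<forall>\<^sub>F n in sequentially. infdist x M \<le> dist x (closest_point M (X n))"
        by (intro always_eventually allI infdist_le closest_point_infdist(1) assms)
      show "\<forall>\<^sub>F n in sequentially. dist x (closest_point M (X n)) \<le> dist x (X n) + infdist (X n) M"
        by (intro always_eventually allI)
          (metis assms closest_point_infdist(2) dist_triangle)
      have "(\<lambda>n. dist x (X n) + infdist (X n) M) \<longlonglongrightarrow> dist x x + infdist x M"
        by (intro tendsto_intros X)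
      then show "(\<lambda>n. dist x (X n) + infdist (X n) M) \<longlonglongrightarrow> infdist x M" by simp
    qed auto
  qed
  then show "(closest_point M \<circ> X) \<longlonglongrightarrow> closest_point M x" by (simp add: o_def)
qed

lemma unp_reach: "ereal (infdist x M) < reach M \<Longrightarrow> x \<in> unp M"
  unfolding reach_def unp_def less_Sup_iff by auto

text \<open>Federer's extension property, with Brouwer's theorem in place of the gradient flow of the distance
  function: a fixed point of f lies behind z on the ray from p through z.\<close>

lemma infdist_ray_extend:
  fixes M :: "'a::euclidean_space set"
  assumes M: "closed M" "M \<noteq> {}" and t: "0 < infdist z M" and e: "0 < e" "2 * e \<le> infdist z M"
    and unp: "cball z e \<subseteq> unp M"
  defines "p \<equiv> closest_point M z" and "t \<equiv> infdist z M"
  shows "infdist (p + ((t + e) / t) *\<^sub>R (z - p)) M = t + e"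
proof -
  define f where "f x = z + (e / infdist x M) *\<^sub>R (x - closest_point M x)" for x
  have lip: "\<bar>infdist x M - infdist y M\<bar> \<le> dist x y" for x y
    using infdist_triangle[of x M y] infdist_triangle[of y M x] by (simp add: dist_commute)
  have pos: "e \<le> infdist x M" if "x \<in> cball z e" for x
    using lip[of z x] that e by simp
  obtain x where x: "x \<in> cball z e" "f x = x"
  proof (rule brouwer_ball[OF e(1)])
    show "continuous_on (cball z e) f"
      unfolding f_def
      by (intro continuous_intros continuous_on_subset[OF continuous_on_closest_point_unp[OF M] unp])
        (use pos e in force)
    show "f \<in> cball z e \<rightarrow> cball z e"
    proof
      fix x assume x: "x \<in> cball z e"
      have "norm (x - closest_point M x) = infdist x M"
        using closest_point_infdist(2)[OF M, of x] by (simp add: dist_norm)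
      then show "f x \<in> cball z e"
        using pos[OF x] e by (simp add: f_def dist_norm)
    qed
  qed
  define d where "d = infdist x M"
  define q where "q = closest_point M x"
  have qM: "q \<in> M" and nq: "norm (x - q) = d"
    using closest_point_infdist[OF M, of x] by (auto simp: q_def d_def dist_norm)
  have de: "d \<ge> e" "d > 0" using pos[OF x(1)] e by (auto simp: d_def)
  have zx: "z = x - (e / d) *\<^sub>R (x - q)"
    using x(2) by (simp add: f_def d_def q_def algebra_simps)
  have "dist z x = e" using de e nq by (subst zx) (simp add: dist_norm)
  \<comment> \<open>Two bounds that meet: the distance function is 1-Lipschitz, so d <= t + e, while
    q competes at z and gives t <= d - e. Equality makes q a nearest point of z, hence q =
    p.\<close>
  then have le: "d \<le> t + e" using lip[of x z] by (simp add: d_def t_def dist_commute)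
  have zq: "z - q = (1 - e / d) *\<^sub>R (x - q)" by (subst zx) (simp add: algebra_simps)
  have "dist z q = d - e"
    unfolding dist_norm zq norm_scaleR nq using de e by (simp add: field_simps)
  moreover have "t \<le> dist z q" unfolding t_def by (rule infdist_le[OF qM])
  ultimately have te: "t = d - e" "dist z q = t" using le by auto
  have "z \<in> unp M" using unp e by auto
  then have pq: "p = q" unfolding p_def
    by (rule closest_point_unp[OF M(1) _ qM]) (use te t_def in simp)
  have "((t + e) / t) *\<^sub>R (z - p) = ((d / (d - e)) * (1 - e / d)) *\<^sub>R (x - q)"
    unfolding pq zq te(1) by simp
  also have "(d / (d - e)) * (1 - e / d) = 1"
    using de te(1) t t_def by (simp add: field_simps)
  finally have "p + ((t + e) / t) *\<^sub>R (z - p) = x" using pq by simp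
  then show ?thesis using te d_def by simp
qed

text \<open>The distance function is 1-Lipschitz: walking back by s - t cannot lower it below t, and
  p itself shows that it is at most t.\<close>

lemma infdist_ray_shrink:
  fixes M :: "'a::euclidean_space set"
  assumes "p \<in> M" "norm u = 1" "infdist (p + s *\<^sub>R u) M = s" "0 \<le> t" "t \<le> s"
  shows "infdist (p + t *\<^sub>R u) M = t"
proof -
  have "infdist (p + t *\<^sub>R u) M \<le> dist (p + t *\<^sub>R u) p" by (rule infdist_le) fact
  then have 1: "infdist (p + t *\<^sub>R u) M \<le> t" using assms by (simp add: dist_norm)
  have "infdist (p + s *\<^sub>R u) M \<le> infdist (p + t *\<^sub>R u) M + dist (p + s *\<^sub>R u) (p + t *\<^sub>R u)"
    by (rule infdist_triangle)
  also have "dist (p + s *\<^sub>R u) (p + t *\<^sub>R u) = s - t"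
    using assms by (simp add: dist_norm flip: scaleR_diff_left)
  finally show ?thesis using 1 assms by simp
qed

text \<open>Continuation along the ray: the radii at which p is still a nearest point form a closed
  set, and \<open>infdist_ray_extend\<close> pushes its supremum further as long as a neighbourhood
  stays below the reach.\<close>

lemma infdist_ray_reach:
  fixes M :: "'a::euclidean_space set"
  assumes M: "closed M" "M \<noteq> {}" and x: "0 < infdist x M" "ereal (infdist x M) < reach M"
    and t: "0 \<le> t" "ereal t < reach M"
  defines "p \<equiv> closest_point M x" and "u \<equiv> sgn (x - closest_point M x)"
  shows "infdist (p + t *\<^sub>R u) M = t" and "closest_point M (p + t *\<^sub>R u) = p"
proof -
  define d where "d = infdist x M"
  have pM: "p \<in> M" and nq: "norm (x - p) = d"
    using closest_point_infdist[OF M, of x] by (auto simp: p_def d_def dist_norm)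
  have nu: "norm u = 1" using x nq by (auto simp: u_def norm_sgn p_def d_def)
  have xpu: "x = p + d *\<^sub>R u" using nq x by (simp add: u_def sgn_div_norm d_def flip: p_def)
  \<comment> \<open>The target may lie before x on the ray; continuation runs to the larger radius,
    and \<open>infdist_ray_shrink\<close> comes back to t.\<close>
  define T where "T = max d t"
  have T: "d \<le> T" "ereal T < reach M" using x t by (auto simp: T_def max_def d_def)
  define A where "A = {s. d \<le> s \<and> s \<le> T \<and> infdist (p + s *\<^sub>R u) M = s}"
  have "A = {d..T} \<inter> {s. infdist (p + s *\<^sub>R u) M = s}" by (auto simp: A_def)
  moreover have "closed {s. infdist (p + s *\<^sub>R u) M = s}"
    by (rule closed_Collect_eq) (auto intro!: continuous_intros)
  ultimately have "closed A" by (simp add: closed_Int)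
  have "infdist (p + d *\<^sub>R u) M = d" using xpu d_def by metis
  then have dA: "d \<in> A" using T by (simp add: A_def)
  have bdd: "bdd_above A" by (rule bdd_aboveI[of _ T]) (simp add: A_def)
  define S where "S = Sup A"
  have SA: "S \<in> A" unfolding S_def using closed_contains_Sup[OF _ bdd \<open>closed A\<close>] dA by blast
  have "S = T"
  proof (rule ccontr)
    assume "S \<noteq> T"
    then have ST: "S < T" "d \<le> S" "infdist (p + S *\<^sub>R u) M = S" using SA by (auto simp: A_def)
    define z where "z = p + S *\<^sub>R u"
    have iz: "infdist z M = S" using ST z_def by simp
    have S0: "S > 0" using ST x d_def by simp
    \<comment> \<open>Half of T - S keeps the ball of radius e about z below the reach; S / 2 meets
      the condition 2 * e <= S of the extension lemma.\<close>
    define e where "e = min (S / 2) ((T - S) / 2)"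
    have e: "0 < e" "2 * e \<le> S" "S + e \<le> T" "e < T - S" using ST S0 by (auto simp: e_def min_def field_simps)
    have sub: "cball z e \<subseteq> unp M"
    proof
      fix y assume "y \<in> cball z e"
      then have "infdist y M \<le> S + e" using infdist_triangle[of y M z] iz by (simp add: dist_commute)
      then have "ereal (infdist y M) < reach M" using e T by (meson ereal_less_eq(3) le_less_trans order_trans)
      then show "y \<in> unp M" by (rule unp_reach)
    qed
    have pz: "closest_point M z = p"
      by (rule closest_point_unp[OF M(1)])
        (use sub e pM iz S0 nu in \<open>auto simp: z_def dist_norm\<close>)
    have "infdist (p + ((S + e) / S) *\<^sub>R (z - p)) M = S + e"
      using infdist_ray_extend[OF M _ e(1) _ sub] iz S0 e pz by simp
    moreover have "((S + e) / S) *\<^sub>R (z - p) = (S + e) *\<^sub>R u"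
      using S0 by (simp add: z_def)
    ultimately have "S + e \<in> A" using e ST by (simp add: A_def)
    then have "S + e \<le> S" unfolding S_def using bdd by (rule cSup_upper)
    then show False using e by simp
  qed
  then have iT: "infdist (p + T *\<^sub>R u) M = T" using SA by (simp add: A_def)
  show it: "infdist (p + t *\<^sub>R u) M = t"
    by (rule infdist_ray_shrink[OF pM nu iT]) (use t T_def in auto)
  show "closest_point M (p + t *\<^sub>R u) = p"
    by (rule closest_point_unp[OF M(1)])
      (use it t pM nu in \<open>auto simp: dist_norm intro!: unp_reach\<close>)
qed

text \<open>The ball of radius r about p + r u, with u the unit normal at p towards x, touches M at
  p and has no point of M in its interior. Expanding |p + r u - y| >= r gives the inequality; the
  factor \<open>infdist x M\<close> rescales u to x - p.\<close>

lemma reach_support: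
  fixes M :: "'a::euclidean_space set"
  assumes M: "closed M" "M \<noteq> {}" and x: "ereal (infdist x M) < reach M"
    and r: "0 < r" "ereal r < reach M" and y: "y \<in> M"
  defines "p \<equiv> closest_point M x"
  shows "(x - p) \<bullet> (y - p) \<le> infdist x M * (norm (y - p))\<^sup>2 / (2 * r)"
proof (cases "infdist x M = 0")
  case True
  then have "x = p" using closest_point_infdist(2)[OF M, of x] by (simp add: p_def)
  then show ?thesis using True by simp
next
  case False
  then have d: "0 < infdist x M" using infdist_nonneg[of x M] by linarith
  define u where "u = sgn (x - p)"
  have nq: "norm (x - p) = infdist x M"
    using closest_point_infdist(2)[OF M, of x] by (simp add: p_def dist_norm)
  have nu: "norm u = 1" using d nq by (auto simp: u_def norm_sgn)
  have xpu: "x - p = infdist x M *\<^sub>R u" using nq d by (simp add: u_def sgn_div_norm)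
  have "infdist (p + r *\<^sub>R u) M = r"
    unfolding p_def u_def by (rule infdist_ray_reach(1)[OF M d x]) (use r in auto)
  then have "r \<le> norm (p + r *\<^sub>R u - y)" using infdist_le[OF y, of "p + r *\<^sub>R u"] by (simp add: dist_norm)
  then have "r\<^sup>2 \<le> (norm (r *\<^sub>R u - (y - p)))\<^sup>2"
    using r by (intro power_mono) (auto simp: algebra_simps)
  also have "\<dots> = r\<^sup>2 - 2 * r * (u \<bullet> (y - p)) + (norm (y - p))\<^sup>2"
    using nu unfolding power2_norm_eq_inner
    by (simp add: inner_diff_left inner_diff_right inner_commute algebra_simps power2_eq_square norm_eq_1)
  finally have "u \<bullet> (y - p) \<le> (norm (y - p))\<^sup>2 / (2 * r)" using r by (simp add: field_simps)
  then have "infdist x M * (u \<bullet> (y - p)) \<le> infdist x M * ((norm (y - p))\<^sup>2 / (2 * r))"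
    using d by (intro mult_left_mono) auto
  then show ?thesis unfolding xpu by simp
qed

text \<open>The support inequalities at both foot points are added. Their quadratic terms leave the
  fraction 1 - R / r of the squared distance, and Cauchy-Schwarz removes one power. The resulting
  Lipschitz constant is r / (r - R).\<close>

lemma closest_point_lipschitz_reach:
  fixes M :: "'a::euclidean_space set"
  assumes M: "closed M" "M \<noteq> {}" and x: "infdist x M \<le> R" "infdist x' M \<le> R"
    and r: "R < r" "ereal r < reach M"
  shows "(1 - R / r) * dist (closest_point M x) (closest_point M x') \<le> dist x x'"
proof -
  let ?p = "closest_point M x" and ?q = "closest_point M x'"
  have R: "0 \<le> R" using x infdist_nonneg[of x M] by linarith
  have lt: "ereal (infdist x M) < reach M" "ereal (infdist x' M) < reach M"
    using x r by (meson ereal_less_eq(3) le_less_trans less_imp_le order_trans)+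
  have r0: "0 < r" using R r by simp
  have m: "infdist y M * (norm w)\<^sup>2 / (2 * r) \<le> R * (norm w)\<^sup>2 / (2 * r)" if "infdist y M \<le> R" for y w :: 'a
    using that r0 by (intro divide_right_mono mult_right_mono) auto
  have 1: "(x - ?p) \<bullet> (?q - ?p) \<le> R * (norm (?q - ?p))\<^sup>2 / (2 * r)"
    using reach_support[OF M lt(1) r0 r(2) closest_point_infdist(1)[OF M, of x']] m[OF x(1), of "?q - ?p"] by linarith
  have 2: "(x' - ?q) \<bullet> (?p - ?q) \<le> R * (norm (?q - ?p))\<^sup>2 / (2 * r)"
    using reach_support[OF M lt(2) r0 r(2) closest_point_infdist(1)[OF M, of x]] m[OF x(2), of "?q - ?p"]
    by (simp add: norm_minus_commute)
  have "(x - x') \<bullet> (?q - ?p) + (norm (?q - ?p))\<^sup>2 = (x - ?p) \<bullet> (?q - ?p) + (x' - ?q) \<bullet> (?p - ?q)"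
    by (simp add: power2_norm_eq_inner inner_diff_left inner_diff_right inner_commute algebra_simps)
  also have "\<dots> \<le> R * (norm (?q - ?p))\<^sup>2 / r" using 1 2 by (simp add: field_simps)
  finally have "(1 - R / r) * (norm (?q - ?p))\<^sup>2 \<le> (x' - x) \<bullet> (?q - ?p)"
    by (simp add: inner_diff_left algebra_simps)
  also have "\<dots> \<le> norm (x' - x) * norm (?q - ?p)" by (rule norm_cauchy_schwarz)
  finally have "((1 - R / r) * norm (?q - ?p)) * norm (?q - ?p) \<le> norm (x' - x) * norm (?q - ?p)"
    by (simp add: power2_eq_square mult.assoc)
  then have "(1 - R / r) * norm (?q - ?p) \<le> norm (x' - x) \<or> norm (?q - ?p) = 0"
    by (metis mult_right_le_imp_le norm_ge_zero order_le_less)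
  then show ?thesis by (auto simp: dist_norm norm_minus_commute)
qed

text \<open>Source of the square root in the rate: the support inequality leaves a multiple of |y -
  p|^2 when |x - y|^2 <= (d + h)^2 is expanded, so an excess h in distance allows a displacement of
  order sqrt h from the foot point.\<close>

lemma near_closest_point_reach:
  fixes M :: "'a::euclidean_space set"
  assumes M: "closed M" "M \<noteq> {}" and x: "infdist x M \<le> R"
    and r: "R < r" "ereal r < reach M" and y: "y \<in> M" "dist x y \<le> infdist x M + h" and h: "0 \<le> h"
  shows "(1 - R / r) * (dist y (closest_point M x))\<^sup>2 \<le> 2 * R * h + h\<^sup>2"
proof -
  let ?p = "closest_point M x" and ?d = "infdist x M"
  have d: "0 \<le> ?d" by (rule infdist_nonneg)
  have r0: "0 < r" using x d r by simp
  have lt: "ereal ?d < reach M" 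
    using x r by (meson ereal_less_eq(3) le_less_trans less_imp_le order_trans)
  have "(x - ?p) \<bullet> (y - ?p) \<le> ?d * (norm (y - ?p))\<^sup>2 / (2 * r)"
    by (rule reach_support[OF M lt r0 r(2) y(1)])
  also have "\<dots> \<le> R * (norm (y - ?p))\<^sup>2 / (2 * r)"
    using x r0 by (intro divide_right_mono mult_right_mono) auto
  finally have 1: "2 * ((x - ?p) \<bullet> (y - ?p)) \<le> R / r * (norm (y - ?p))\<^sup>2" using r0 by (simp add: field_simps)
  have "norm (x - ?p) = ?d" using closest_point_infdist(2)[OF M, of x] by (simp add: dist_norm)
  then have "(norm (x - ?p))\<^sup>2 = ?d\<^sup>2" by simp
  then have "?d\<^sup>2 - 2 * ((x - ?p) \<bullet> (y - ?p)) + (norm (y - ?p))\<^sup>2 = (dist x y)\<^sup>2"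
    unfolding dist_norm power2_norm_eq_inner
    by (simp add: inner_diff_left inner_diff_right inner_commute algebra_simps)
  also have "\<dots> \<le> (?d + h)\<^sup>2" using y by (intro power_mono) auto
  finally have "(1 - R / r) * (norm (y - ?p))\<^sup>2 \<le> 2 * ?d * h + h\<^sup>2"
    using 1 by (simp add: power2_sum left_diff_distrib)
  also have "\<dots> \<le> 2 * R * h + h\<^sup>2" using x h by (simp add: mult_right_mono)
  finally show ?thesis by (simp add: dist_norm)
qed

section \<open>Signed integrals\<close>

text \<open>The set where g is nonnegative is a Hahn set, so the supremum defining the positive
  variation is attained and equals the integral of max 0 g. \<open>ennreal\<close> takes this
  positive part.\<close>

lemma positive_variation_density:
  fixes g :: "'b \<Rightarrow> real"
  assumes sets: "sets N = sets M" and g: "integrable N g"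
    and \<mu>: "\<And>A. A \<in> sets M \<Longrightarrow> \<mu> A = (\<integral>x. indicator A x * g x \<partial>N)"
  shows "positive_variation M \<mu> = density N (\<lambda>x. ennreal (g x))"
proof -
  have sp: "space N = space M" using sets by (rule sets_eq_imp_space_eq)
  have gm[measurable]: "g \<in> borel_measurable N" using g by simp
  have "(SUP B\<in>{B \<in> sets M. B \<subseteq> A}. ennreal (\<mu> B)) = emeasure (density N (\<lambda>x. ennreal (g x))) A"
    if A: "A \<in> sets M" for A
  proof -
    have AN[measurable]: "A \<in> sets N" using A sets by simp
    have int: "integrable N (\<lambda>x. indicator B x * h x)" if "B \<in> sets N" "integrable N h" for B and h :: "'b \<Rightarrow> real"
      using integrable_mult_indicator[OF that] by simp
    have intm: "integrable N (\<lambda>x. max 0 (g x))" using g by simp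
    have "emeasure (density N (\<lambda>x. ennreal (g x))) A = (\<integral>\<^sup>+x. ennreal (g x) * indicator A x \<partial>N)"
      by (rule emeasure_density) simp_all
    also have "\<dots> = (\<integral>\<^sup>+x. ennreal (indicator A x * max 0 (g x)) \<partial>N)"
      by (intro nn_integral_cong) (auto simp: indicator_def max_def ennreal_neg)
    also have "\<dots> = ennreal (\<integral>x. indicator A x * max 0 (g x) \<partial>N)"
      by (rule nn_integral_eq_integral[OF int[OF AN intm]]) (simp add: indicator_def)
    finally have E: "emeasure (density N (\<lambda>x. ennreal (g x))) A = \<dots>" .
    show ?thesis unfolding E
    proof (rule antisym)
      show "(SUP B\<in>{B \<in> sets M. B \<subseteq> A}. ennreal (\<mu> B)) \<le> ennreal (\<integral>x. indicator A x * max 0 (g x) \<partial>N)"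
      proof (rule SUP_least)
        fix B assume "B \<in> {B \<in> sets M. B \<subseteq> A}"
        then have B: "B \<in> sets M" "B \<in> sets N" "B \<subseteq> A" using sets by auto
        show "ennreal (\<mu> B) \<le> ennreal (\<integral>x. indicator A x * max 0 (g x) \<partial>N)"
          unfolding \<mu>[OF B(1)]
          by (intro ennreal_leI integral_mono int B(2) AN g intm)
            (use B(3) in \<open>auto simp: indicator_def\<close>)
      qed
      define B where "B = {x \<in> space N. x \<in> A \<and> 0 \<le> g x}"
      have "B \<in> sets N" unfolding B_def by measurable
      then have B: "B \<in> sets M" "B \<subseteq> A" using sets by (auto simp: B_def)
      have "(\<integral>x. indicator A x * max 0 (g x) \<partial>N) = \<mu> B"
        unfolding \<mu>[OF B(1)]
        by (intro Bochner_Integration.integral_cong) (auto simp: B_def indicator_def)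
      then show "ennreal (\<integral>x. indicator A x * max 0 (g x) \<partial>N) \<le> (SUP B\<in>{B \<in> sets M. B \<subseteq> A}. ennreal (\<mu> B))"
        using B by (intro SUP_upper2[of B]) auto
    qed
  qed
  then have "positive_variation M \<mu> = measure_of (space M) (sets M) (emeasure (density N (\<lambda>x. ennreal (g x))))"
    unfolding positive_variation_def
    by (intro measure_of_eq) (auto simp: sets.space_closed sets.sigma_sets_eq)
  also have "\<dots> = density N (\<lambda>x. ennreal (g x))"
    using measure_of_of_measure[of "density N (\<lambda>x. ennreal (g x))"] sets sp by simp
  finally show ?thesis .
qed

lemma signed_integral_density:
  fixes g :: "'b \<Rightarrow> real"
  assumes sets: "sets N = sets M" and g: "integrable N g"
    and \<mu>: "\<And>A. A \<in> sets M \<Longrightarrow> \<mu> A = (\<integral>x. indicator A x * g x \<partial>N)"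
    and f: "f \<in> borel_measurable N" "integrable N (\<lambda>x. g x * f x)"
  shows "signed_integral M \<mu> f = (\<integral>x. g x * f x \<partial>N)"
proof -
  have gm[measurable]: "g \<in> borel_measurable N" using g by simp
  note f(1)[measurable]
  have *: "(\<integral>x. f x \<partial>density N (\<lambda>x. ennreal (h x))) = (\<integral>x. max 0 (h x) * f x \<partial>N)"
    if [measurable]: "h \<in> borel_measurable N" for h :: "'b \<Rightarrow> real"
  proof -
    have "(\<integral>x. f x \<partial>density N (\<lambda>x. ennreal (max 0 (h x)))) = (\<integral>x. max 0 (h x) *\<^sub>R f x \<partial>N)"
      by (rule integral_density) (auto simp: f)
    moreover have "(\<lambda>x. ennreal (max 0 (h x))) = (\<lambda>x. ennreal (h x))" by (auto simp: max_def ennreal_neg)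
    ultimately show ?thesis by simp
  qed
  have int: "integrable N (\<lambda>x. max 0 (h x) * f x)"
    if [measurable]: "h \<in> borel_measurable N" and "\<And>x. \<bar>h x\<bar> = \<bar>g x\<bar>" for h
  proof (rule Bochner_Integration.integrable_bound[OF f(2)])
    have "max 0 (h x) * \<bar>f x\<bar> \<le> \<bar>g x\<bar> * \<bar>f x\<bar>" for x
      using that(2)[of x] by (intro mult_right_mono) auto
    then show "AE x in N. norm (max 0 (h x) * f x) \<le> norm (g x * f x)" by (auto simp: abs_mult)
  qed measurable
  have n: "positive_variation M (\<lambda>A. - \<mu> A) = density N (\<lambda>x. ennreal (- g x))"
    by (rule positive_variation_density[OF sets]) (use g \<mu> in auto)
  have p: "positive_variation M \<mu> = density N (\<lambda>x. ennreal (g x))"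
    by (rule positive_variation_density[OF sets g \<mu>])
  have "signed_integral M \<mu> f = (\<integral>x. max 0 (g x) * f x \<partial>N) - (\<integral>x. max 0 (- g x) * f x \<partial>N)"
    unfolding signed_integral_def n p
    by (subst (1 2) *) auto
  also have "\<dots> = (\<integral>x. max 0 (g x) * f x - max 0 (- g x) * f x \<partial>N)"
    by (rule Bochner_Integration.integral_diff[symmetric]) (auto intro!: int)
  also have "\<dots> = (\<integral>x. g x * f x \<partial>N)"
    by (intro Bochner_Integration.integral_cong) (auto simp: max_def)
  finally show ?thesis .
qed

text \<open>The Jordan decomposition is not additive in the measure, so linearity is obtained from
  densities: all \<open>Ni i\<close> have Radon-Nikodym derivatives with respect to N, and \<mu>
  then has the single density \<open>g\<close>. In particular, one signed measure written in two
  ways yields an identity between integrals.\<close>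

lemma signed_integral_lincomb:
  fixes c :: "'i \<Rightarrow> real"
  assumes I: "finite I" and N: "finite_measure N" "sets N = sets M"
    and Ni: "\<And>i. i \<in> I \<Longrightarrow> finite_measure (Ni i)" "\<And>i. i \<in> I \<Longrightarrow> sets (Ni i) = sets M"
      "\<And>i. i \<in> I \<Longrightarrow> absolutely_continuous N (Ni i)"
    and \<mu>: "\<And>A. A \<in> sets M \<Longrightarrow> \<mu> A = (\<Sum>i\<in>I. c i * measure (Ni i) A)"
    and fm: "f \<in> borel_measurable M" and f: "\<And>i. i \<in> I \<Longrightarrow> integrable (Ni i) f"
  shows "signed_integral M \<mu> f = (\<Sum>i\<in>I. c i * (\<integral>x. f x \<partial>Ni i))"
proof -
  interpret N: finite_measure N by fact
  have "\<exists>D. D \<in> borel_measurable N \<and> (\<forall>x. 0 \<le> D x) \<and> density N (\<lambda>x. ennreal (D x)) = Ni i"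
    if i: "i \<in> I" for i
  proof -
    have s: "sets (Ni i) = sets N" using Ni(2) i N by simp
    obtain D where D: "D \<in> borel_measurable N" "AE x in N. RN_deriv N (Ni i) x = ennreal (D x)" "\<And>x. 0 \<le> D x"
      using N.real_RN_deriv[OF Ni(1)[OF i] Ni(3)[OF i] s] by metis
    have "density N (\<lambda>x. ennreal (D x)) = density N (RN_deriv N (Ni i))"
      by (rule density_cong) (use D in auto)
    also have "\<dots> = Ni i" using N.density_RN_deriv[OF Ni(3)[OF i] s] .
    finally show ?thesis using D by blast
  qed
  then obtain D where D: "\<And>i. i \<in> I \<Longrightarrow> D i \<in> borel_measurable N" "\<And>i x. i \<in> I \<Longrightarrow> 0 \<le> D i x"
    "\<And>i. i \<in> I \<Longrightarrow> density N (\<lambda>x. ennreal (D i x)) = Ni i" by metis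
  have sN: "f \<in> borel_measurable N" using fm measurable_cong_sets[OF N(2) refl] by blast
  have iff: "integrable (Ni i) h \<longleftrightarrow> integrable N (\<lambda>x. D i x * h x)"
    and eq: "(\<integral>x. h x \<partial>Ni i) = (\<integral>x. D i x * h x \<partial>N)"
    if "i \<in> I" "h \<in> borel_measurable N" for i and h :: "_ \<Rightarrow> real"
    using that D by (auto simp flip: D(3) simp: integrable_density integral_density)
  define g where "g x = (\<Sum>i\<in>I. c i * D i x)" for x
  have iD: "integrable N (D i)" if "i \<in> I" for i
  proof -
    interpret finite_measure "Ni i" using Ni that by simp
    show ?thesis using iff[OF that, of "\<lambda>_. 1"] by simp
  qed
  have "signed_integral M \<mu> f = (\<integral>x. g x * f x \<partial>N)"
  proof (rule signed_integral_density[OF N(2)])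
    show "integrable N g" unfolding g_def using iD by simp
    show "f \<in> borel_measurable N" by fact
    show "integrable N (\<lambda>x. g x * f x)"
      unfolding g_def sum_distrib_right mult.assoc
      using iff sN f by (intro Bochner_Integration.integrable_sum integrable_mult_right) auto
    fix A assume A: "A \<in> sets M"
    have AN[measurable]: "A \<in> sets N" using A N by simp
    have int: "integrable N (\<lambda>x. indicator A x * D i x)" if "i \<in> I" for i
      using integrable_mult_indicator[OF AN iD[OF that]] by simp
    have "measure (Ni i) A = (\<integral>x. indicator A x * D i x \<partial>N)" if i: "i \<in> I" for i
    proof -
      interpret finite_measure "Ni i" using Ni that by simp
      have "measure (Ni i) A = (\<integral>x. indicator A x \<partial>Ni i)"
        using A Ni(2)[OF i] sets.sets_into_space[of A "Ni i"] by (simp add: Int_absorb2)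
      also have "\<dots> = (\<integral>x. D i x * indicator A x \<partial>N)" by (rule eq[OF i]) measurable
      finally show ?thesis by (simp add: mult.commute)
    qed
    then have "\<mu> A = (\<Sum>i\<in>I. c i * (\<integral>x. indicator A x * D i x \<partial>N))" using \<mu>[OF A] by simp
    also have "\<dots> = (\<Sum>i\<in>I. (\<integral>x. c i * (indicator A x * D i x) \<partial>N))" by simp
    also have "\<dots> = (\<integral>x. (\<Sum>i\<in>I. c i * (indicator A x * D i x)) \<partial>N)"
      by (rule Bochner_Integration.integral_sum[symmetric]) (simp add: int)
    finally show "\<mu> A = (\<integral>x. indicator A x * g x \<partial>N)"
      by (simp add: g_def sum_distrib_left mult.left_commute)
  qed
  also have "\<dots> = (\<integral>x. (\<Sum>i\<in>I. c i * (D i x * f x)) \<partial>N)"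
    by (simp add: g_def sum_distrib_right mult.assoc)
  also have "\<dots> = (\<Sum>i\<in>I. (\<integral>x. c i * (D i x * f x) \<partial>N))"
    using iff sN f by (intro Bochner_Integration.integral_sum integrable_mult_right) auto
  also have "\<dots> = (\<Sum>i\<in>I. c i * (\<integral>x. f x \<partial>Ni i))"
    using eq sN by simp
  finally show ?thesis .
qed

section \<open>Almost everywhere uniqueness of the projection\<close>

text \<open>Translates of a bounded piece of E by different multiples of v are disjoint and have
  equal measure. Infinitely many of them, with shifts v / (k + 1), fit into one ball, so the measure
  is 0.\<close>

lemma negligible_disjoint_translates:
  fixes E :: "'a::euclidean_space set"
  assumes E: "E \<in> sets lebesgue" and disj: "\<And>x t. x \<in> E \<Longrightarrow> 0 < t \<Longrightarrow> x + t *\<^sub>R v \<notin> E"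
  shows "negligible E"
proof -
  have "negligible (E \<inter> cball 0 (real n))" for n
  proof -
    define F where "F = E \<inter> cball 0 (real n)"
    have F: "F \<in> lmeasurable"
      unfolding F_def by (rule fmeasurable_Int_fmeasurable[OF lmeasurable_cball E, simplified Int_commute])
    define \<tau> where "\<tau> k = (\<lambda>x. (1 / real (Suc k)) *\<^sub>R v + x) ` F" for k :: nat
    have \<tau>: "\<tau> k \<in> lmeasurable" "measure lebesgue (\<tau> k) = measure lebesgue F" for k
      unfolding \<tau>_def using F by (auto simp: measurable_translation measure_translation)
    have sub: "\<tau> k \<subseteq> cball 0 (norm v + real n)" for k
    proof -
      have "norm ((1 / real (Suc k)) *\<^sub>R v) \<le> norm v"
        by (simp add: divide_le_eq mult_le_cancel_left1)
      then show ?thesis unfolding \<tau>_def F_def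
        by (force intro: norm_triangle_le)
    qed
    have lt: "disjnt (\<tau> j) (\<tau> k)" if "j < k" for j k
    proof -
      have "1 / real (Suc k) < 1 / real (Suc j)" using that by (simp add: frac_less2)
      moreover have False if "x \<in> F" "y \<in> F" and eq: "(1 / real (Suc j)) *\<^sub>R v + x = (1 / real (Suc k)) *\<^sub>R v + y"
        and "1 / real (Suc k) < 1 / real (Suc j)" for x y
      proof -
        have "y = x + (1 / real (Suc j) - 1 / real (Suc k)) *\<^sub>R v"
          using eq by (simp add: algebra_simps)
        then show False using disj[of x "1 / real (Suc j) - 1 / real (Suc k)"] that by (auto simp: F_def)
      qed
      ultimately show ?thesis unfolding disjnt_iff \<tau>_def by blast
    qed
    have disjnt: "pairwise (\<lambda>j k. disjnt (\<tau> j) (\<tau> k)) {..<N}" for N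
      unfolding pairwise_def using lt disjnt_sym by (metis nat_neq_iff)
    have "real N * measure lebesgue F \<le> measure lebesgue (cball (0::'a) (norm v + real n))" for N
    proof -
      have "real N * measure lebesgue F = (\<Sum>k<N. measure lebesgue (\<tau> k))" by (simp add: \<tau>)
      also have "\<dots> = measure lebesgue (\<Union>k<N. \<tau> k)"
        by (rule measure_UNION'[symmetric]) (use \<tau> disjnt in auto)
      also have "\<dots> \<le> measure lebesgue (cball (0::'a) (norm v + real n))"
        by (rule measure_mono_fmeasurable) (use sub \<tau> in \<open>auto intro!: sets.finite_UN\<close>)
      finally show ?thesis .
    qed
    then have "measure lebesgue F \<le> 0"
      by (meson ex_less_of_nat_mult not_le)
    then have "measure lebesgue F = 0" by (simp add: measure_le_0_iff)
    then show ?thesis using F by (simp add: F_def negligible_iff_measure0)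
  qed
  then have "negligible (\<Union>n. E \<inter> cball 0 (real n))" by (intro negligible_countable_Union) auto
  moreover have "(\<Union>n. E \<inter> cball 0 (real n)) = E" using real_arch_simple by auto
  ultimately show ?thesis by simp
qed

text \<open>The condition says that the distances to M \<inter> C and to M agree, and both are
  continuous in x. The empty intersection is separate because \<open>infdist\<close> to the empty
  set is 0 by convention.\<close>

lemma closed_nearest_in:
  fixes M :: "'a::euclidean_space set"
  assumes "closed M" "closed C"
  shows "closed {x. \<exists>y\<in>M \<inter> C. dist x y = infdist x M}"
proof (cases "M \<inter> C = {}")
  case False
  have "{x. \<exists>y\<in>M \<inter> C. dist x y = infdist x M} = {x. infdist x (M \<inter> C) = infdist x M}"
  proof (intro equalityI subsetI)
    fix x assume "x \<in> {x. \<exists>y\<in>M \<inter> C. dist x y = infdist x M}"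
    then obtain y where y: "y \<in> M" "y \<in> C" "dist x y = infdist x M" by blast
    have "infdist x (M \<inter> C) \<le> dist x y" using y by (intro infdist_le) auto
    moreover have "infdist x M \<le> infdist x (M \<inter> C)" using y by (intro infdist_mono) auto
    ultimately show "x \<in> {x. infdist x (M \<inter> C) = infdist x M}" using y by simp
  next
    fix x assume "x \<in> {x. infdist x (M \<inter> C) = infdist x M}"
    moreover obtain y where "y \<in> M \<inter> C" "infdist x (M \<inter> C) = dist x y"
      using infdist_attains_inf[of "M \<inter> C" x] assms False by (auto simp: closed_Int)
    ultimately show "x \<in> {x. \<exists>y\<in>M \<inter> C. dist x y = infdist x M}" by auto
  qed
  moreover have "closed {x. infdist x (M \<inter> C) = infdist x M}"
    by (rule closed_Collect_eq) (auto intro!: continuous_intros)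
  ultimately show ?thesis by simp
qed auto

text \<open>Along every line in the direction of a basis vector b the b-coordinate of the nearest points
  is monotone, hence such a line meets the set below, for fixed q < q', at most once.\<close>

lemma negligible_not_unp:
  fixes M :: "'a::euclidean_space set"
  assumes M: "closed M" "M \<noteq> {}"
  shows "negligible (- unp M)"
proof -
  define E where "E b q q' = {x. \<exists>y\<in>M \<inter> {y. y \<bullet> b \<le> q}. dist x y = infdist x M} \<inter>
     {x. \<exists>y\<in>M \<inter> {y. q' \<le> y \<bullet> b}. dist x y = infdist x M}" for b q q'
  have neg: "negligible (E b q q')" if b: "b \<in> Basis" and q: "q < q'" for b q q'
  proof (rule negligible_disjoint_translates)
    have "closed (E b q q')" unfolding E_def
      by (intro closed_Int closed_nearest_in M closed_Collect_le continuous_intros)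
    then show "E b q q' \<in> sets lebesgue" by simp
    fix x t assume x: "x \<in> E b q q'" and t: "0 < (t::real)"
    show "x + t *\<^sub>R b \<notin> E b q q'"
    proof
      assume "x + t *\<^sub>R b \<in> E b q q'"
      then obtain w where w: "w \<in> M" "w \<bullet> b \<le> q" "dist (x + t *\<^sub>R b) w = infdist (x + t *\<^sub>R b) M"
        unfolding E_def by blast
      obtain y where y: "y \<in> M" "q' \<le> y \<bullet> b" "dist x y = infdist x M"
        using x unfolding E_def by blast
      define z where "z = x + t *\<^sub>R b"
      have "dist x y \<le> dist x w" using infdist_le[OF w(1), of x] y by simp
      then have 1: "(norm (x - y))\<^sup>2 \<le> (norm (x - w))\<^sup>2" by (simp add: dist_norm)
      have "dist z w \<le> dist z y" using infdist_le[OF y(1), of z] w z_def by simp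
      then have 2: "(norm (z - w))\<^sup>2 \<le> (norm (z - y))\<^sup>2" by (simp add: dist_norm)
      \<comment> \<open>Monotonicity of nearest points: adding the minimality of y at x against w
        and that of w at z against y leaves only this inner product. With z - x = t b, the
        b-coordinate of y cannot exceed that of w.\<close>
      have "(z - x) \<bullet> (y - w) \<le> 0"
        using 1 2 unfolding power2_norm_eq_inner
        by (simp add: inner_diff_left inner_diff_right inner_commute algebra_simps)
      then have "t * (y \<bullet> b - w \<bullet> b) \<le> 0" by (simp add: z_def inner_diff_right inner_commute)
      moreover have "0 < y \<bullet> b - w \<bullet> b" using w y q by simp
      ultimately show False using t by (simp add: mult_le_0_iff)
    qed
  qed
  \<comment> \<open>Two distinct nearest points differ in some coordinate, and two rationals fit
    between the two values; so countably many of the null sets \<open>E b q q'\<close> cover the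
    complement of \<open>unp M\<close>.\<close>
  define I where "I = {(b, q, q'). b \<in> (Basis :: 'a set) \<and> q \<in> \<rat> \<and> q' \<in> \<rat> \<and> q < (q'::real)}"
  have "I \<subseteq> Basis \<times> \<rat> \<times> \<rat>" by (auto simp: I_def)
  moreover have "countable (Basis \<times> \<rat> \<times> \<rat> :: ('a \<times> real \<times> real) set)"
    by (intro countable_SIGMA countable_rat countable_finite) auto
  ultimately have "countable I" by (rule countable_subset)
  then have "countable ((\<lambda>(b, q, q'). E b q q') ` I)" by simp
  then have "negligible (\<Union>((\<lambda>(b, q, q'). E b q q') ` I))"
    by (rule negligible_countable_Union) (auto simp: I_def intro!: neg)
  moreover have "- unp M \<subseteq> \<Union>((\<lambda>(b, q, q'). E b q q') ` I)"
  proof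
    fix x assume x: "x \<in> - unp M"
    obtain y where y: "y \<in> M" "dist x y = infdist x M"
      using closest_point_infdist[OF M] by blast
    then obtain y' where y': "y' \<in> M" "dist x y' = infdist x M" "y \<noteq> y'"
      using x unfolding unp_def by blast
    obtain b where b: "b \<in> Basis" "y \<bullet> b \<noteq> y' \<bullet> b" using y'(3) euclidean_eqI by blast
    obtain w w' where w: "w \<in> M" "dist x w = infdist x M" "w' \<in> M" "dist x w' = infdist x M"
      "w \<bullet> b < w' \<bullet> b"
      using y y' b(2) by (metis linorder_neqE_linordered_idom)
    obtain q where q: "q \<in> \<rat>" "w \<bullet> b < q" "q < w' \<bullet> b" using Rats_dense_in_real[OF w(5)] by blast
    obtain q' where q': "q' \<in> \<rat>" "q < q'" "q' < w' \<bullet> b" using Rats_dense_in_real[OF q(3)] by blast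
    have "w \<in> M \<inter> {y. y \<bullet> b \<le> q}" "w' \<in> M \<inter> {y. q' \<le> y \<bullet> b}" using w q q' by auto
    then have "x \<in> E b q q'" unfolding E_def using w(2,4) by blast
    moreover have "(b, q, q') \<in> I" using b q q' by (simp add: I_def)
    ultimately show "x \<in> \<Union>((\<lambda>(b, q, q'). E b q q') ` I)" by force
  qed
  ultimately show ?thesis by (rule negligible_subset)
qed

lemma unp_measurable:
  fixes M :: "'a::euclidean_space set"
  assumes "closed M" "M \<noteq> {}"
  shows "unp M \<in> sets lebesgue"
  using negligible_imp_sets[OF negligible_not_unp[OF assms]] sets.compl_sets[of "- unp M" lebesgue]
  by (simp add: Compl_eq_Diff_UNIV double_diff)

lemma AE_unp:
  fixes M :: "'a::euclidean_space set"
  assumes "closed M" "M \<noteq> {}"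
  shows "AE x in lebesgue. x \<in> unp M"
proof (rule AE_I')
  show "- unp M \<in> null_sets lebesgue"
    using negligible_not_unp[OF assms] by (simp add: negligible_iff_null_sets)
qed auto

text \<open>On \<open>unp M\<close> the preimage of a closed set C agrees with the closed set of
  points that have a nearest point in C. The rest lies in a null set and is measurable by
  completeness, however \<open>closest_point\<close> chooses there.\<close>

lemma borel_measurable_closest_point:
  fixes M :: "'a::euclidean_space set"
  assumes M: "closed M" "M \<noteq> {}"
  shows "closest_point M \<in> borel_measurable lebesgue"
proof (rule borel_measurableI)
  have closed: "closest_point M -` C \<in> sets lebesgue" if C: "closed C" for C
  proof -
    define B where "B = {x. \<exists>y\<in>M \<inter> C. dist x y = infdist x M}"
    have "closest_point M -` C = (B \<inter> unp M) \<union> (closest_point M -` C - unp M)"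
      using closest_point_infdist[OF M] closest_point_unp[OF M(1)] by (auto simp: B_def)
    moreover have "closest_point M -` C - unp M \<in> sets lebesgue"
      by (rule negligible_imp_sets, rule negligible_subset[OF negligible_not_unp[OF M]]) auto
    moreover have "B \<in> sets lebesgue"
      unfolding B_def using closed_nearest_in[OF M(1) C] by simp
    ultimately show ?thesis using unp_measurable[OF M] by (metis sets.Int sets.Un)
  qed
  fix S :: "'a set" assume "open S"
  then have "closest_point M -` (- S) \<in> sets lebesgue" by (intro closed) auto
  then have "UNIV - closest_point M -` (- S) \<in> sets lebesgue" using sets.compl_sets[of _ lebesgue] by simp
  moreover have "closest_point M -` S \<inter> space lebesgue = UNIV - closest_point M -` (- S)" by auto
  ultimately show "closest_point M -` S \<inter> space lebesgue \<in> sets lebesgue" by metis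
qed

text \<open>The level set is cut into pieces whose points have a nearest point in a small ball about
  some y. Such a piece meets every ray from y at most once, since moving towards y brings a point
  strictly closer to K; for this the radius R / 4 has to stay below R. Closed sets with this
  property are null.\<close>

lemma negligible_infdist_level:
  fixes K :: "'a::euclidean_space set"
  assumes K: "compact K" "K \<noteq> {}" and R: "0 < R"
  shows "negligible {x. infdist x K = R}"
proof -
  define E where "E y = {x. infdist x K = R} \<inter> {x. \<exists>p\<in>K \<inter> cball y (R / 4). dist x p = infdist x K}" for y
  have neg: "negligible (E y)" for y
  proof (rule starlike_negligible[of _ y])
    show "closed (E y)" unfolding E_def
      by (intro closed_Int closed_nearest_in compact_imp_closed K closed_Collect_eq continuous_intros) auto
    have key: False if c: "0 \<le> c" "c < 1" and a: "y + x \<in> E y" "y + c *\<^sub>R x \<in> E y" for c x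
    proof -
      obtain p where p: "p \<in> K" "dist y p \<le> R / 4" "dist (y + x) p = R" using a(1) by (auto simp: E_def)
      have "infdist (y + c *\<^sub>R x) K \<le> dist (y + c *\<^sub>R x) p" by (rule infdist_le) (rule p)
      also have "\<dots> = norm (c *\<^sub>R (y + x - p) + (1 - c) *\<^sub>R (y - p))"
        by (simp add: dist_norm algebra_simps)
      also have "\<dots> \<le> c * norm (y + x - p) + (1 - c) * norm (y - p)"
        by (rule norm_triangle_le) (use c in simp)
      also have "\<dots> \<le> c * R + (1 - c) * (R / 4)"
        using p c by (intro add_mono mult_left_mono) (auto simp: dist_norm)
      also have "\<dots> < c * R + (1 - c) * R" using R c by simp
      also have "\<dots> = R" by (simp add: algebra_simps)
      finally show False using a(2) by (simp add: E_def)
    qed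
    fix c x assume c: "0 \<le> c" and a: "y + c *\<^sub>R x \<in> E y" "y + x \<in> E y"
    show "c = 1"
    proof (rule ccontr)
      assume "c \<noteq> 1"
      then consider "c < 1" | "c > 1" by linarith
      then show False
      proof cases
        case 1 then show False using key c a by blast
      next
        case 2
        \<comment> \<open>The case c > 1 is the first one with the two points exchanged.\<close>
        then show False using key[of "1 / c" "c *\<^sub>R x"] a by simp
      qed
    qed
  qed
  obtain T where T: "finite T" "K \<subseteq> (\<Union>y\<in>T. ball y (R / 4))"
    using compactE_image[OF K(1), of K "\<lambda>y. ball y (R / 4)"] R by (metis UN_I centre_in_ball open_ball subsetI divide_pos_pos zero_less_numeral)
  have "{x. infdist x K = R} \<subseteq> (\<Union>y\<in>T. E y)"
  proof
    fix x assume x: "x \<in> {x. infdist x K = R}"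
    have p: "closest_point K x \<in> K" "dist x (closest_point K x) = infdist x K"
      using closest_point_infdist[OF compact_imp_closed[OF K(1)] K(2)] by auto
    have "closest_point K x \<in> (\<Union>y\<in>T. ball y (R / 4))" using T(2) p(1) by (rule subsetD)
    then obtain y where y: "y \<in> T" "closest_point K x \<in> ball y (R / 4)" by blast
    have "closest_point K x \<in> K \<inter> cball y (R / 4)" using p y by auto
    then have "x \<in> E y" unfolding E_def using x p(2) by blast
    then show "x \<in> (\<Union>y\<in>T. E y)" using y by blast
  qed
  moreover have "negligible (\<Union>y\<in>T. E y)" using T neg by (intro negligible_countable_Union) (auto simp: countable_finite)
  ultimately show ?thesis by (rule negligible_subset[rotated])
qed

section \<open>Bounds for tensors\<close>

definition unit_args :: "nat \<Rightarrow> 'a::euclidean_space list \<Rightarrow> bool" where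
  "unit_args p vs \<longleftrightarrow> length vs = p \<and> (\<forall>v\<in>set vs. norm v = 1)"

text \<open>The pointwise bound enters the lower estimate too: a supremum of reals carries
  information only for a set that is nonempty and bounded above. Nonemptiness is witnessed by p
  copies of a basis vector.\<close>

lemma tensor_norm_bounds:
  fixes T :: "'a::euclidean_space tensor"
  assumes "\<And>vs. unit_args p vs \<Longrightarrow> \<bar>T vs\<bar> \<le> b"
  shows "0 \<le> tensor_norm p T" "tensor_norm p T \<le> b"
proof -
  obtain v :: 'a where v: "v \<in> Basis" using nonempty_Basis by blast
  have u: "unit_args p (replicate p v)" using v by (auto simp: unit_args_def)
  have bd: "bdd_above ((\<lambda>vs. \<bar>T vs\<bar>) ` {vs. length vs = p \<and> (\<forall>v\<in>set vs. norm v = 1)})"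
    by (rule bdd_aboveI[of _ b]) (use assms in \<open>auto simp: unit_args_def\<close>)
  have "0 \<le> \<bar>T (replicate p v)\<bar>" by simp
  also have "\<dots> \<le> tensor_norm p T"
    unfolding tensor_norm_def by (rule cSUP_upper[OF _ bd]) (use u in \<open>simp add: unit_args_def\<close>)
  finally show "0 \<le> tensor_norm p T" .
  show "tensor_norm p T \<le> b"
    unfolding tensor_norm_def
    by (rule cSUP_least) (use u assms in \<open>auto simp: unit_args_def intro: exI[of _ "replicate p v"]\<close>)
qed

lemma tensor_power_prod_eq:
  "tensor_power_prod r s x y vs =
     (if length vs = r + s
      then (\<Sum>\<pi> | \<pi> permutes {..<r + s}. \<Prod>i<r + s. (if i < r then x else y) \<bullet> (vs ! \<pi> i)) / fact (r + s)
      else 0)"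
proof -
  have "(\<Sum>\<pi> | \<pi> permutes {..<r + s}. tensor_prod (replicate r x @ replicate s y) (map (\<lambda>i. vs ! \<pi> i) [0..<r + s]))
      = (\<Sum>\<pi> | \<pi> permutes {..<r + s}. \<Prod>i<r + s. (if i < r then x else y) \<bullet> (vs ! \<pi> i))"
    unfolding tensor_prod_def
    by (intro sum.cong refl) (simp, intro prod.cong, auto simp: nth_append)
  then show ?thesis unfolding tensor_power_prod_def symmetrize_def by simp
qed

lemma unit_args_nth:
  assumes "unit_args p vs" "\<pi> permutes {..<p}" "i < p"
  shows "norm (vs ! \<pi> i) = 1"
  using assms permutes_in_image[OF assms(2), of i] by (auto simp: unit_args_def)

lemma average_permutes_le:
  fixes g :: "(nat \<Rightarrow> nat) \<Rightarrow> real"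
  assumes "\<And>\<pi>. \<pi> permutes {..<n} \<Longrightarrow> \<bar>g \<pi>\<bar> \<le> b"
  shows "\<bar>(\<Sum>\<pi> | \<pi> permutes {..<n}. g \<pi>) / fact n\<bar> \<le> b"
proof -
  have "\<bar>\<Sum>\<pi> | \<pi> permutes {..<n}. g \<pi>\<bar> \<le> (\<Sum>\<pi> | \<pi> permutes {..<n}. b)"
    by (rule order_trans[OF sum_abs sum_mono]) (use assms in auto)
  also have "\<dots> = fact n * b" using card_permutations[of "{..<n}" n] by simp
  finally show ?thesis by (simp add: divide_le_eq mult.commute)
qed

lemma tensor_power_prod_bound:
  assumes vs: "unit_args (r + s) vs" and D: "norm x \<le> D" "norm y \<le> D"
  shows "\<bar>tensor_power_prod r s x y vs\<bar> \<le> D ^ (r + s)"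
proof -
  have l: "length vs = r + s" using vs by (simp add: unit_args_def)
  have "\<bar>\<Prod>i<r + s. (if i < r then x else y) \<bullet> (vs ! \<pi> i)\<bar> \<le> D ^ (r + s)" if "\<pi> permutes {..<r + s}" for \<pi>
  proof -
    have "\<bar>\<Prod>i<r + s. (if i < r then x else y) \<bullet> (vs ! \<pi> i)\<bar> = (\<Prod>i<r + s. \<bar>(if i < r then x else y) \<bullet> (vs ! \<pi> i)\<bar>)"
      by (rule abs_prod)
    also have "\<dots> \<le> (\<Prod>i<r + s. D)"
    proof (rule prod_mono)
      fix i assume "i \<in> {..<r + s}"
      then have "norm (vs ! \<pi> i) = 1" using unit_args_nth[OF vs that] by simp
      then have "\<bar>(if i < r then x else y) \<bullet> (vs ! \<pi> i)\<bar> \<le> norm (if i < r then x else y)"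
        using Cauchy_Schwarz_ineq2[of "if i < r then x else y" "vs ! \<pi> i"] by simp
      then show "0 \<le> \<bar>(if i < r then x else y) \<bullet> (vs ! \<pi> i)\<bar> \<and> \<bar>(if i < r then x else y) \<bullet> (vs ! \<pi> i)\<bar> \<le> D"
        using D by (auto split: if_splits)
    qed
    finally show ?thesis by simp
  qed
  then show ?thesis unfolding tensor_power_prod_eq using l average_permutes_le by simp
qed

text \<open>Products are compared factor by factor. The telescoping estimate asks for factors of
  modulus at most 1, so every inner product is divided by D. Restoring D costs D ^ (r + s), and 1 <=
  D absorbs the remaining 1 / D.\<close>

lemma tensor_power_prod_diff:
  assumes vs: "unit_args (r + s) vs" and D: "1 \<le> D"
    and n: "norm x \<le> D" "norm y \<le> D" "norm x' \<le> D" "norm y' \<le> D"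
  shows "\<bar>tensor_power_prod r s x y vs - tensor_power_prod r s x' y' vs\<bar>
    \<le> real (r + s) * D ^ (r + s) * (norm (x - x') + norm (y - y'))"
proof -
  have l: "length vs = r + s" using vs by (simp add: unit_args_def)
  let ?w = "\<lambda>i. if i < r then x else y" and ?w' = "\<lambda>i. if i < r then x' else y'"
  have "\<bar>(\<Prod>i<r + s. ?w i \<bullet> (vs ! \<pi> i)) - (\<Prod>i<r + s. ?w' i \<bullet> (vs ! \<pi> i))\<bar>
      \<le> real (r + s) * D ^ (r + s) * (norm (x - x') + norm (y - y'))" if \<pi>: "\<pi> permutes {..<r + s}" for \<pi>
  proof -
    have cs: "\<bar>u \<bullet> (vs ! \<pi> i)\<bar> \<le> norm u" if "i < r + s" for u i
      using Cauchy_Schwarz_ineq2[of u "vs ! \<pi> i"] unit_args_nth[OF vs \<pi> that] by simp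
    have sc: "(\<Prod>i<r + s. u i \<bullet> (vs ! \<pi> i)) = D ^ (r + s) * (\<Prod>i<r + s. (u i \<bullet> (vs ! \<pi> i)) / D)" for u
      using D by (simp add: prod_dividef)
    have "\<bar>(\<Prod>i<r + s. (?w i \<bullet> (vs ! \<pi> i)) / D) - (\<Prod>i<r + s. (?w' i \<bullet> (vs ! \<pi> i)) / D)\<bar>
        \<le> (\<Sum>i<r + s. \<bar>(?w i \<bullet> (vs ! \<pi> i)) / D - (?w' i \<bullet> (vs ! \<pi> i)) / D\<bar>)"
    proof (rule norm_prod_diff[where 'a = real, unfolded real_norm_def])
      fix i assume i: "i \<in> {..<r + s}"
      have "\<bar>u \<bullet> (vs ! \<pi> i) / D\<bar> \<le> 1" if "norm u \<le> D" for u
        using cs[of i u] i D that by (simp add: abs_divide divide_le_eq)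
      then show "\<bar>?w i \<bullet> (vs ! \<pi> i) / D\<bar> \<le> 1" "\<bar>?w' i \<bullet> (vs ! \<pi> i) / D\<bar> \<le> 1" using n by auto
    qed
    also have "\<dots> \<le> (\<Sum>i<r + s. norm (x - x') + norm (y - y'))"
    proof (rule sum_mono)
      fix i assume i: "i \<in> {..<r + s}"
      have "\<bar>(?w i \<bullet> (vs ! \<pi> i)) / D - (?w' i \<bullet> (vs ! \<pi> i)) / D\<bar> = \<bar>(?w i - ?w' i) \<bullet> (vs ! \<pi> i)\<bar> / D"
        using D by (simp add: inner_diff_left flip: diff_divide_distrib)
      also have "\<dots> \<le> norm (?w i - ?w' i) / D"
        using D cs i by (intro divide_right_mono) auto
      also have "\<dots> \<le> norm (?w i - ?w' i)"
        using D by (simp add: divide_le_eq mult_le_cancel_left1)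
      also have "\<dots> \<le> norm (x - x') + norm (y - y')" by auto
      finally show "\<bar>(?w i \<bullet> (vs ! \<pi> i)) / D - (?w' i \<bullet> (vs ! \<pi> i)) / D\<bar> \<le> norm (x - x') + norm (y - y')" .
    qed
    finally have "\<bar>(\<Prod>i<r + s. (?w i \<bullet> (vs ! \<pi> i)) / D) - (\<Prod>i<r + s. (?w' i \<bullet> (vs ! \<pi> i)) / D)\<bar>
        \<le> real (r + s) * (norm (x - x') + norm (y - y'))" by simp
    then have "D ^ (r + s) * \<bar>(\<Prod>i<r + s. (?w i \<bullet> (vs ! \<pi> i)) / D) - (\<Prod>i<r + s. (?w' i \<bullet> (vs ! \<pi> i)) / D)\<bar>
        \<le> D ^ (r + s) * (real (r + s) * (norm (x - x') + norm (y - y')))"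
      using D by (intro mult_left_mono) auto
    moreover have "(\<Prod>i<r + s. ?w i \<bullet> (vs ! \<pi> i)) - (\<Prod>i<r + s. ?w' i \<bullet> (vs ! \<pi> i)) =
       D ^ (r + s) * ((\<Prod>i<r + s. (?w i \<bullet> (vs ! \<pi> i)) / D) - (\<Prod>i<r + s. (?w' i \<bullet> (vs ! \<pi> i)) / D))"
      by (subst (1 2) sc) (simp only: right_diff_distrib)
    ultimately show ?thesis
      using D by (simp only: abs_mult) (simp add: mult_ac)
  qed
  then have "\<bar>(\<Sum>\<pi> | \<pi> permutes {..<r + s}. (\<Prod>i<r + s. ?w i \<bullet> (vs ! \<pi> i)) - (\<Prod>i<r + s. ?w' i \<bullet> (vs ! \<pi> i))) / fact (r + s)\<bar>
     \<le> real (r + s) * D ^ (r + s) * (norm (x - x') + norm (y - y'))"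
    by (rule average_permutes_le)
  then show ?thesis unfolding tensor_power_prod_eq using l
    by (simp add: sum_subtractf diff_divide_distrib)
qed

text \<open>With x - p written as distance times unit normal, homogeneity splits off the distance to
  the power s.\<close>

lemma tensor_power_prod_scale:
  "tensor_power_prod r s x (c *\<^sub>R y) vs = c ^ s * tensor_power_prod r s x y vs"
proof -
  have "(\<Prod>i<r + s. (if i < r then x else c *\<^sub>R y) \<bullet> (vs ! \<pi> i)) =
      c ^ s * (\<Prod>i<r + s. (if i < r then x else y) \<bullet> (vs ! \<pi> i))" for \<pi>
  proof -
    have "(\<Prod>i<r + s. (if i < r then x else c *\<^sub>R y) \<bullet> (vs ! \<pi> i)) =
        (\<Prod>i<r + s. (if i < r then 1 else c) * ((if i < r then x else y) \<bullet> (vs ! \<pi> i)))"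
      by (intro prod.cong) auto
    also have "\<dots> = (\<Prod>i<r + s. if i < r then 1 else c) * (\<Prod>i<r + s. (if i < r then x else y) \<bullet> (vs ! \<pi> i))"
      by (rule prod.distrib)
    also have "(\<Prod>i<r + s. if i < r then 1 else c) = c ^ s"
    proof -
      have "{..<r + s} \<inter> - {i. i < r} = {r..<r + s}" by auto
      then show ?thesis by (simp add: prod.If_cases)
    qed
    finally show ?thesis .
  qed
  then show ?thesis unfolding tensor_power_prod_eq by (simp add: sum_distrib_left)
qed

lemma tensor_power_prod_0_right: "tensor_power_prod r 0 x y = tensor_power r x"
  by (simp add: tensor_power_prod_def tensor_power_def)

lemma continuous_on_tensor_power_prod:
  fixes f g :: "'b::topological_space \<Rightarrow> 'a::euclidean_space"
  assumes "continuous_on S f" "continuous_on S g"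
  shows "continuous_on S (\<lambda>z. tensor_power_prod r s (f z) (g z) vs)"
proof -
  have *: "continuous_on S (\<lambda>z. (if i < r then f z else g z) \<bullet> v)" for i :: nat and v :: 'a
    by (cases "i < r") (auto intro!: continuous_intros assms)
  then show ?thesis unfolding tensor_power_prod_eq
    by (cases "length vs = r + s")
      (auto intro!: continuous_on_divide continuous_on_sum continuous_on_prod *)
qed

lemma borel_measurable_tensor_power_prod[measurable]:
  assumes "f \<in> borel_measurable M" "g \<in> borel_measurable M"
  shows "(\<lambda>z. tensor_power_prod r s (f z) (g z) vs) \<in> borel_measurable M"
proof -
  have "(\<lambda>z. (if i < r then f z else g z) \<bullet> v) \<in> borel_measurable M" for i :: nat and v
    by (cases "i < r") (auto intro!: borel_measurable_inner assms)
  then show ?thesis unfolding tensor_power_prod_eq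
    by (cases "length vs = r + s") (auto intro!: borel_measurable_sum borel_measurable_prod borel_measurable_divide)
qed

section \<open>Stability of Voronoi tensor measures\<close>

lemma closed_parallel_set: "closed (parallel_set K R)"
  unfolding parallel_set_def by (intro closed_Collect_le continuous_intros)

lemma parallel_set_sets_lebesgue[measurable]: "parallel_set K R \<in> sets lebesgue"
  using closed_parallel_set[of K R] by simp

lemma borel_measurable_lebesgue_id: "(\<lambda>x. x) \<in> borel_measurable lebesgue"
  by (rule measurable_completion) simp

lemma bounded_subset_cball0E:
  assumes "bounded (S :: 'a::euclidean_space set)"
  obtains D where "S \<subseteq> cball 0 D"
  using assms unfolding bounded_iff by (auto simp: subset_eq)

lemma parallel_set_subset_cball:
  fixes K :: "'a::euclidean_space set"
  assumes "closed K" "K \<noteq> {}" "K \<subseteq> cball 0 D"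
  shows "parallel_set K R \<subseteq> cball 0 (D + R)"
proof
  fix x assume "x \<in> parallel_set K R"
  then have "dist x (closest_point K x) \<le> R" using closest_point_infdist[OF assms(1,2)] by (simp add: parallel_set_def)
  moreover have "norm (closest_point K x) \<le> D" using closest_point_infdist(1)[OF assms(1,2)] assms(3) by force
  ultimately show "x \<in> cball 0 (D + R)"
    using norm_triangle_ineq[of "closest_point K x" "x - closest_point K x"] by (simp add: dist_norm)
qed

lemma parallel_set_lmeasurable:
  fixes K :: "'a::euclidean_space set"
  assumes "compact K" "K \<noteq> {}"
  shows "parallel_set K R \<in> lmeasurable"
proof -
  obtain D where "K \<subseteq> cball 0 D" using bounded_subset_cball0E[OF compact_imp_bounded[OF assms(1)]] by blast
  then have "bounded (parallel_set K R)"
    using parallel_set_subset_cball[OF compact_imp_closed[OF assms(1)] assms(2)] bounded_cball bounded_subset by metis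
  then show ?thesis using closed_parallel_set by (metis compact_eq_bounded_closed lmeasurable_compact)
qed

lemma set_integrable_bounded:
  fixes f :: "'a::euclidean_space \<Rightarrow> real"
  assumes S: "S \<in> lmeasurable" and f: "f \<in> borel_measurable lebesgue" "\<And>x. x \<in> S \<Longrightarrow> \<bar>f x\<bar> \<le> c"
  shows "integrable lebesgue (\<lambda>x. indicator S x * f x)"
proof (rule Bochner_Integration.integrable_bound)
  show "integrable lebesgue (\<lambda>x. indicator S x * c)"
    using S by (intro integrable_mult_left) (auto simp: fmeasurable_def less_top)
  show "(\<lambda>x. indicator S x * f x) \<in> borel_measurable lebesgue"
    using S f by (intro borel_measurable_times borel_measurable_indicator) auto
  show "AE x in lebesgue. norm (indicator S x * f x) \<le> norm (indicator S x * c)"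
    using f(2) by (intro AE_I2) (force simp: indicator_def)
qed

text \<open>The building block of the signed measures: with p a projection map and g a density on
  the ambient space, values, integrals and absolute continuity are read off on the Lebesgue
  side.\<close>

definition push :: "('a::euclidean_space \<Rightarrow> real) \<Rightarrow> 'b measure \<Rightarrow> ('a \<Rightarrow> 'b) \<Rightarrow> 'b measure" where
  "push g M p = distr (density lebesgue (\<lambda>x. ennreal (g x))) M p"

context
  fixes g :: "'a::euclidean_space \<Rightarrow> real" and M :: "'b measure" and p :: "'a \<Rightarrow> 'b"
  assumes p[measurable]: "p \<in> measurable lebesgue M"
    and g: "integrable lebesgue g" "\<And>x. 0 \<le> g x"
begin

lemma sets_push: "sets (push g M p) = sets M"
  by (simp add: push_def)

lemma push_measurable: "p \<in> measurable (density lebesgue (\<lambda>x. ennreal (g x))) M"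
  by simp

lemma finite_measure_push: "finite_measure (push g M p)"
proof -
  have [measurable]: "g \<in> borel_measurable lebesgue" using g by simp
  have "emeasure (density lebesgue (\<lambda>x. ennreal (g x))) (space lebesgue) = (\<integral>\<^sup>+x. ennreal (g x) \<partial>lebesgue)"
    by (subst emeasure_density) (auto intro!: nn_integral_cong)
  also have "\<dots> = ennreal (\<integral>x. g x \<partial>lebesgue)" using g by (intro nn_integral_eq_integral) auto
  finally have "finite_measure (density lebesgue (\<lambda>x. ennreal (g x)))" by (intro finite_measureI) auto
  then show ?thesis unfolding push_def by (intro finite_measure.finite_measure_distr push_measurable)
qed

lemma integrable_push:
  fixes f :: "'b \<Rightarrow> real"
  assumes [measurable]: "f \<in> borel_measurable M"
  shows "integrable (push g M p) f \<longleftrightarrow> integrable lebesgue (\<lambda>x. g x * f (p x))"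
proof -
  have [measurable]: "g \<in> borel_measurable lebesgue" using g by simp
  show ?thesis unfolding push_def
    by (subst integrable_distr_eq) (auto simp: g integrable_density)
qed

lemma integral_push:
  fixes f :: "'b \<Rightarrow> real"
  assumes [measurable]: "f \<in> borel_measurable M"
  shows "(\<integral>x. f x \<partial>push g M p) = (\<integral>x. g x * f (p x) \<partial>lebesgue)"
proof -
  have [measurable]: "g \<in> borel_measurable lebesgue" using g by simp
  show ?thesis unfolding push_def
    by (subst integral_distr) (auto simp: g integral_density)
qed

lemma measure_push:
  assumes [measurable]: "A \<in> sets M"
  shows "measure (push g M p) A = (\<integral>x. g x * indicator A (p x) \<partial>lebesgue)"
proof -
  have "A \<inter> space (push g M p) = A"
    using sets.sets_into_space[OF assms] by (auto simp: push_def)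
  then have "measure (push g M p) A = (\<integral>x. indicator A x \<partial>push g M p)" by simp
  also have "\<dots> = (\<integral>x. g x * indicator A (p x) \<partial>lebesgue)" by (rule integral_push) simp
  finally show ?thesis .
qed

lemma absolutely_continuous_push:
  assumes h: "integrable lebesgue h" "\<And>x. g x = 0 \<Longrightarrow> h x = 0"
  shows "absolutely_continuous (push g M p) (push h M p)"
proof -
  have [measurable]: "g \<in> borel_measurable lebesgue" "h \<in> borel_measurable lebesgue" using g h by auto
  have "g x \<le> 0 \<Longrightarrow> h x \<le> 0" for x using g(2)[of x] h(2)[of x] by simp
  then show ?thesis
    unfolding absolutely_continuous_def push_def
    by (auto simp: null_sets_distr_iff null_sets_density_iff ennreal_eq_0_iff elim!: eventually_mono)
qed

end

text \<open>For fixed arguments vs the Voronoi measure is the difference of the images of the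
  positive and the negative part of its integrand. Both are dominated by the image of Lebesgue
  measure on the parallel set, so \<open>signed_integral_lincomb\<close> applies.\<close>

lemma tensor_integral_voronoi:
  fixes K :: "'a::euclidean_space set" and \<phi> :: "'a \<Rightarrow> real"
  assumes K: "compact K" "K \<noteq> {}" and \<phi>[measurable]: "\<phi> \<in> borel_measurable borel" and \<phi>b: "\<And>x. \<bar>\<phi> x\<bar> \<le> c"
    and vs: "unit_args (r + s) vs"
  shows "tensor_integral (voronoi_measure R r s K) \<phi> vs =
    (LINT x:parallel_set K R|lebesgue. \<phi> (closest_point K x) *
        tensor_power_prod r s (closest_point K x) (x - closest_point K x) vs)"
proof -
  let ?p = "closest_point K" and ?S = "parallel_set K R"
  note cl = compact_imp_closed[OF K(1)]
  have pm[measurable]: "?p \<in> borel_measurable lebesgue" by (rule borel_measurable_closest_point[OF cl K(2)])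
  define h where "h x = tensor_power_prod r s (?p x) (x - ?p x) vs" for x
  have hm[measurable]: "h \<in> borel_measurable lebesgue" unfolding h_def
    by (intro borel_measurable_tensor_power_prod borel_measurable_diff pm borel_measurable_lebesgue_id)
  have S: "?S \<in> lmeasurable" by (rule parallel_set_lmeasurable[OF K])
  obtain D where D: "K \<subseteq> cball 0 D" using bounded_subset_cball0E[OF compact_imp_bounded[OF K(1)]] by blast
  have hb: "\<bar>h x\<bar> \<le> (max D R) ^ (r + s)" if "x \<in> ?S" for x
    unfolding h_def
    by (rule tensor_power_prod_bound[OF vs])
      (use that closest_point_infdist[OF cl K(2), of x] D in \<open>force simp: parallel_set_def dist_norm max_def\<close>)+
  have int: "integrable lebesgue (\<lambda>x. indicator ?S x * f x)"
    if "f \<in> borel_measurable lebesgue" "\<And>x. \<bar>f x\<bar> \<le> c * \<bar>h x\<bar>" "c \<ge> 0" for f c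
  proof (rule set_integrable_bounded[OF S that(1)])
    show "\<bar>f x\<bar> \<le> c * (max D R) ^ (r + s)" if "x \<in> ?S" for x
      using hb[OF that] \<open>c \<ge> 0\<close> \<open>\<And>x. \<bar>f x\<bar> \<le> c * \<bar>h x\<bar>\<close>[of x] by (meson mult_left_mono order_trans)
  qed
  \<comment> \<open>\<open>g 0\<close> and \<open>g 1\<close> are the positive and the negative part
    of \<open>h\<close> on the parallel set; the signs (-1) ^ i recombine them.\<close>
  define g where "g i x = indicator ?S x * max 0 ((-1) ^ i * h x)" for i :: nat and x
  have mx: "\<bar>max 0 ((-1) ^ i * h x)\<bar> \<le> \<bar>h x\<bar>" for i :: nat and x
    using abs_ge_self[of "(-1) ^ i * h x"] by (simp add: abs_mult power_abs max_def)
  have gi: "integrable lebesgue (g i)" "\<And>x. 0 \<le> g i x" for i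
  proof -
    have "integrable lebesgue (\<lambda>x. indicator ?S x * max 0 ((-1) ^ i * h x))"
    proof (rule int)
      show "\<bar>max 0 ((-1) ^ i * h x)\<bar> \<le> 1 * \<bar>h x\<bar>" for x using mx[of i x] by linarith
    qed measurable
    then show "integrable lebesgue (g i)" "\<And>x. 0 \<le> g i x" by (auto simp: g_def[abs_def])
  qed
  have gS: "integrable lebesgue (indicator ?S :: 'a \<Rightarrow> real)" "\<And>x. 0 \<le> (indicator ?S x :: real)"
    using S by (auto simp: fmeasurable_def less_top)
  have c0: "0 \<le> c" using \<phi>b[of undefined] by linarith
  have if1: "integrable lebesgue (\<lambda>x. g i x * f (?p x))"
    if [measurable]: "f \<in> borel_measurable borel" and "\<And>x. \<bar>f x\<bar> \<le> b" "0 \<le> b" for i b and f :: "'a \<Rightarrow> real"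
  proof -
    have "\<bar>max 0 ((-1) ^ i * h x) * f (?p x)\<bar> \<le> b * \<bar>h x\<bar>" for x
    proof -
      have "\<bar>max 0 ((-1) ^ i * h x)\<bar> * \<bar>f (?p x)\<bar> \<le> \<bar>h x\<bar> * b"
        using that mx by (intro mult_mono) auto
      then show ?thesis by (simp add: abs_mult mult.commute)
    qed
    then have "integrable lebesgue (\<lambda>x. indicator ?S x * (max 0 ((-1) ^ i * h x) * f (?p x)))"
      by (intro int[of _ b]) (use that(3) in auto)
    then show ?thesis by (simp add: g_def mult.assoc)
  qed
  have split: "(\<integral>x. indicator ?S x * (f (?p x) * h x) \<partial>lebesgue) =
      (\<Sum>i\<in>{0, 1}. (-1) ^ i * (\<integral>x. g i x * f (?p x) \<partial>lebesgue))"
    if [measurable]: "f \<in> borel_measurable borel" and "\<And>x. \<bar>f x\<bar> \<le> b" "0 \<le> b" for b and f :: "'a \<Rightarrow> real"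
  proof -
    have "(\<integral>x. indicator ?S x * (f (?p x) * h x) \<partial>lebesgue) = (\<integral>x. g 0 x * f (?p x) - g 1 x * f (?p x) \<partial>lebesgue)"
      by (intro Bochner_Integration.integral_cong) (auto simp: g_def max_def indicator_def)
    then show ?thesis
      by (subst (asm) Bochner_Integration.integral_diff[OF if1[OF that] if1[OF that]]) simp
  qed
  have "tensor_integral (voronoi_measure R r s K) \<phi> vs =
      (\<Sum>i\<in>{0, 1::nat}. (-1) ^ i * (\<integral>x. \<phi> x \<partial>push (g i) borel ?p))"
    unfolding tensor_integral_def
  proof (rule signed_integral_lincomb[where N = "push (indicator ?S) borel ?p"])
    show "finite_measure (push (indicator ?S) borel ?p)" "sets (push (indicator ?S) borel ?p) = sets borel"
      by (rule finite_measure_push[OF pm gS], rule sets_push[OF pm gS])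
    fix i :: nat
    show "finite_measure (push (g i) borel ?p)" "sets (push (g i) borel ?p) = sets borel"
      by (rule finite_measure_push[OF pm gi], rule sets_push[OF pm gi])
    show "absolutely_continuous (push (indicator ?S) borel ?p) (push (g i) borel ?p)"
      by (rule absolutely_continuous_push[OF pm gS gi(1)]) (simp add: g_def)
    show "integrable (push (g i) borel ?p) \<phi>"
      unfolding integrable_push[OF pm gi \<phi>] by (rule if1[OF \<phi> \<phi>b c0])
  next
    fix A :: "'a set" assume A: "A \<in> sets borel"
    have "voronoi_measure R r s K A vs = (\<integral>x. indicator ?S x * (indicator A (?p x) * h x) \<partial>lebesgue)"
      by (simp add: voronoi_measure_def set_lebesgue_integral_def h_def)
    also have "\<dots> = (\<Sum>i\<in>{0, 1}. (-1) ^ i * (\<integral>x. g i x * indicator A (?p x) \<partial>lebesgue))"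
      by (rule split[of _ 1]) (use A in \<open>auto simp: indicator_def\<close>)
    also have "\<dots> = (\<Sum>i\<in>{0, 1}. (-1) ^ i * measure (push (g i) borel ?p) A)"
      using measure_push[OF pm gi A] by simp
    finally show "voronoi_measure R r s K A vs = (\<Sum>i\<in>{0, 1}. (-1) ^ i * measure (push (g i) borel ?p) A)" .
  qed auto
  also have "\<dots> = (\<Sum>i\<in>{0, 1::nat}. (-1) ^ i * (\<integral>x. g i x * \<phi> (?p x) \<partial>lebesgue))"
    using integral_push[OF pm gi \<phi>] by simp
  also have "\<dots> = (\<integral>x. indicator ?S x * (\<phi> (?p x) * h x) \<partial>lebesgue)"
    by (rule split[symmetric, OF \<phi> \<phi>b c0])
  finally show ?thesis by (simp add: set_lebesgue_integral_def h_def)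
qed

text \<open>Both error sources in one number: the displacement of the projection, integrated, and
  the volume of the layer that is lost. The difference is one-sided because K' will be a subset of
  K, whence its parallel sets are smaller too.\<close>

definition proj_err :: "'a::euclidean_space set \<Rightarrow> 'a set \<Rightarrow> real \<Rightarrow> real" where
  "proj_err K K' R = (LINT x:parallel_set K R|lebesgue. dist (closest_point K x) (closest_point K' x)) +
     measure lebesgue (parallel_set K R - parallel_set K' R)"

lemma parallel_set_mono: "K' \<subseteq> K \<Longrightarrow> K' \<noteq> {} \<Longrightarrow> parallel_set K' R \<subseteq> parallel_set K R"
  unfolding parallel_set_def using infdist_mono[of K' K] by (auto intro: order_trans)

text \<open>Where both parallel sets contain x, the integrands differ by at most a multiple of the
  displacement of the projection; on the lost layer the size of one integrand is enough. The
  constant depends on D, r and s but not on \<phi>, which makes the estimate uniform over the test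
  functions.\<close>

lemma voronoi_compare:
  fixes K K' :: "'a::euclidean_space set" and \<phi> :: "'a \<Rightarrow> real"
  assumes K: "compact K" "compact K'" "K' \<noteq> {}" "K' \<subseteq> K" and D: "K \<subseteq> cball 0 D" "1 \<le> D" "R \<le> D" and vs: "unit_args (r + s) vs"
    and \<phi>: "\<And>x. \<bar>\<phi> x\<bar> \<le> 1" "\<And>x y. \<bar>\<phi> x - \<phi> y\<bar> \<le> dist x y"
  shows "\<bar>(LINT x:parallel_set K R|lebesgue. \<phi> (closest_point K x) * tensor_power_prod r s (closest_point K x) (x - closest_point K x) vs)
    - (LINT x:parallel_set K' R|lebesgue. \<phi> (closest_point K' x) * tensor_power_prod r s (closest_point K' x) (x - closest_point K' x) vs)\<bar>
    \<le> ((2 * real (r + s) + 1) * D ^ (r + s)) * proj_err K K' R"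
proof -
  let ?p = "closest_point K" and ?S = "parallel_set K R"
  let ?p' = "closest_point K'" and ?S' = "parallel_set K' R"
  have ne: "K \<noteq> {}" using K by blast
  note cl = compact_imp_closed[OF K(1)] compact_imp_closed[OF K(2)]
  note cp = closest_point_infdist[OF cl(1) ne] closest_point_infdist[OF cl(2) K(3)]
  have pm[measurable]: "?p \<in> borel_measurable lebesgue" "?p' \<in> borel_measurable lebesgue"
    using borel_measurable_closest_point cl ne K by auto
  have "continuous_on UNIV \<phi>"
    unfolding continuous_on_iff dist_real_def using \<phi>(2) by (metis le_less_trans)
  then have [measurable]: "\<phi> \<in> borel_measurable borel" by (rule borel_measurable_continuous_onI)
  define F where "F x = \<phi> (?p x) * tensor_power_prod r s (?p x) (x - ?p x) vs" for x
  define F' where "F' x = \<phi> (?p' x) * tensor_power_prod r s (?p' x) (x - ?p' x) vs" for x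
  have [measurable]: "F \<in> borel_measurable lebesgue" "F' \<in> borel_measurable lebesgue"
    unfolding F_def F'_def
    by (intro borel_measurable_times borel_measurable_tensor_power_prod borel_measurable_diff pm
        borel_measurable_lebesgue_id measurable_compose[OF pm(1)] measurable_compose[OF pm(2)]; measurable)+
  define n where "n = r + s"
  have S: "?S \<in> lmeasurable" "?S' \<in> lmeasurable" using parallel_set_lmeasurable K ne by auto
  have sub: "?S' \<subseteq> ?S" using parallel_set_mono K by blast
  have nb: "norm (?p x) \<le> D" "norm (?p' x) \<le> D" for x
    using cp(1)[of x] cp(3)[of x] D K by force+
  have nb1: "norm (x - ?p x) \<le> D" if "x \<in> ?S" for x
    using cp(2)[of x] D that by (simp add: parallel_set_def dist_norm)
  have nb2: "norm (x - ?p' x) \<le> D" if "x \<in> ?S'" for x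
    using cp(4)[of x] D that by (simp add: parallel_set_def dist_norm)
  have T1: "\<bar>tensor_power_prod r s (?p x) (x - ?p x) vs\<bar> \<le> D ^ n" if "x \<in> ?S" for x
    unfolding n_def by (rule tensor_power_prod_bound[OF vs nb(1) nb1[OF that]])
  have T2: "\<bar>tensor_power_prod r s (?p' x) (x - ?p' x) vs\<bar> \<le> D ^ n" if "x \<in> ?S'" for x
    unfolding n_def by (rule tensor_power_prod_bound[OF vs nb(2) nb2[OF that]])
  have m1: "\<bar>\<phi> y * t\<bar> \<le> b" if "\<bar>t\<bar> \<le> b" for y t b
    using mult_mono[OF \<phi>(1)[of y] that] by (simp add: abs_mult)
  have F1: "\<bar>F x\<bar> \<le> D ^ n" if "x \<in> ?S" for x unfolding F_def by (rule m1[OF T1[OF that]])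
  have F2: "\<bar>F' x\<bar> \<le> D ^ n" if "x \<in> ?S'" for x unfolding F'_def by (rule m1[OF T2[OF that]])
  have C1: "D ^ n \<le> (2 * real n + 1) * D ^ n" using D by (simp add: mult_le_cancel_right1)
  have point: "\<bar>indicator ?S x * F x - indicator ?S' x * F' x\<bar> \<le>
     ((2 * real n + 1) * D ^ n) * (indicator ?S x * dist (?p x) (?p' x) + indicator (?S - ?S') x)" for x
  proof -
    consider "x \<in> ?S'" | "x \<in> ?S - ?S'" | "x \<notin> ?S" using sub by blast
    then show ?thesis
    proof cases
      case 1
      then have x: "x \<in> ?S" "x \<in> ?S'" using sub by auto
      let ?d = "dist (?p x) (?p' x)"
      let ?T = "tensor_power_prod r s (?p x) (x - ?p x) vs" and ?T' = "tensor_power_prod r s (?p' x) (x - ?p' x) vs"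
      have "\<bar>?T - ?T'\<bar> \<le> real n * D ^ n * (norm (?p x - ?p' x) + norm ((x - ?p x) - (x - ?p' x)))"
        unfolding n_def by (rule tensor_power_prod_diff[OF vs D(2) nb(1) nb1[OF x(1)] nb(2) nb2[OF x(2)]])
      \<comment> \<open>Both slots of the tensor product move by the same vector up to sign, as x
        cancels in (x - p) - (x - p'); hence the factor 2.\<close>
      also have "\<dots> = 2 * real n * D ^ n * ?d" by (simp add: dist_norm norm_minus_commute)
      finally have d1: "\<bar>?T - ?T'\<bar> \<le> 2 * real n * D ^ n * ?d" .
      have "F x - F' x = \<phi> (?p x) * (?T - ?T') + (\<phi> (?p x) - \<phi> (?p' x)) * ?T'"
        by (simp add: F_def F'_def algebra_simps)
      also have "\<bar>\<dots>\<bar> \<le> 2 * real n * D ^ n * ?d + ?d * D ^ n"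
        by (intro order_trans[OF abs_triangle_ineq] add_mono m1 d1)
          (auto simp: abs_mult intro!: mult_mono \<phi> T2 x)
      finally show ?thesis using x by (simp add: algebra_simps)
    next
      case 2
      then have "\<bar>F x\<bar> \<le> (2 * real n + 1) * D ^ n" using F1[of x] C1 by simp
      moreover have "0 \<le> ((2 * real n + 1) * D ^ n) * dist (?p x) (?p' x)" using D by simp
      ultimately have "\<bar>F x\<bar> \<le> ((2 * real n + 1) * D ^ n) * dist (?p x) (?p' x) + (2 * real n + 1) * D ^ n"
        by linarith
      then show ?thesis using 2 by (simp add: distrib_left)
    next
      case 3
      then have "x \<notin> ?S'" using sub by blast
      then show ?thesis using 3 by simp
    qed
  qed
  have i1: "integrable lebesgue (\<lambda>x. indicator ?S x * F x)" "integrable lebesgue (\<lambda>x. indicator ?S' x * F' x)"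
    using S F1 F2 by (auto intro!: set_integrable_bounded)
  have i2: "integrable lebesgue (\<lambda>x. indicator ?S x * dist (?p x) (?p' x))"
  proof (rule set_integrable_bounded[OF S(1)])
    show "\<bar>dist (?p x) (?p' x)\<bar> \<le> 2 * D" for x
      using nb[of x] norm_triangle_ineq4[of "?p x" "?p' x"] by (simp add: dist_norm)
  qed measurable
  have i3: "integrable lebesgue (indicator (?S - ?S') :: 'a \<Rightarrow> real)"
    using fmeasurable.Diff[OF S] by (auto simp: fmeasurable_def less_top)
  have "\<bar>(\<integral>x. indicator ?S x * F x \<partial>lebesgue) - (\<integral>x. indicator ?S' x * F' x \<partial>lebesgue)\<bar>
     = \<bar>\<integral>x. indicator ?S x * F x - indicator ?S' x * F' x \<partial>lebesgue\<bar>"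
    using i1 by simp
  also have "\<dots> \<le> (\<integral>x. \<bar>indicator ?S x * F x - indicator ?S' x * F' x\<bar> \<partial>lebesgue)"
    by (rule integral_abs_bound)
  also have "\<dots> \<le> (\<integral>x. ((2 * real n + 1) * D ^ n) * (indicator ?S x * dist (?p x) (?p' x) + indicator (?S - ?S') x) \<partial>lebesgue)"
    by (rule integral_mono) (use i1 i2 i3 point in auto)
  also have "\<dots> = ((2 * real n + 1) * D ^ n) * proj_err K K' R"
    using i2 i3 by (simp add: proj_err_def set_lebesgue_integral_def)
  finally show ?thesis by (simp add: set_lebesgue_integral_def F_def F'_def n_def)
qed

text \<open>The optimal Lipschitz constant is an infimum. It is itself a Lipschitz constant, because
  for a fixed pair of points the inequality passes to the infimum after division by their
  distance.\<close>

lemma bL_unit_ball_bounds: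
  assumes "f \<in> bL_unit_ball"
  shows "\<bar>f x\<bar> \<le> 1" "\<bar>f x - f y\<bar> \<le> dist x y"
proof -
  let ?C = "{C. lipschitz_on C UNIV f}"
  obtain C where C: "lipschitz_on C UNIV f" using assms unfolding bL_unit_ball_def by blast
  have bdd: "bdd_above (range (\<lambda>x. \<bar>f x\<bar>))"
  proof -
    obtain b where "\<And>x. norm (f x) \<le> b" using assms unfolding bL_unit_ball_def bounded_iff by blast
    then show ?thesis by (intro bdd_aboveI[of _ b]) auto
  qed
  have sum: "Inf ?C + (SUP x. \<bar>f x\<bar>) \<le> 1" using assms unfolding bL_unit_ball_def by blast
  have up: "\<bar>f x\<bar> \<le> (SUP x. \<bar>f x\<bar>)" for x by (rule cSUP_upper[OF _ bdd]) simp
  have I0: "0 \<le> Inf ?C" using C by (intro cInf_greatest) (auto simp: lipschitz_on_def)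
  show "\<bar>f x\<bar> \<le> 1" using up[of x] I0 sum by linarith
  have "Inf ?C \<le> 1" using up[of x] sum by linarith
  have "\<bar>f x - f y\<bar> \<le> Inf ?C * dist x y"
  proof (cases "x = y")
    case False
    then have d: "0 < dist x y" by simp
    have "\<bar>f x - f y\<bar> / dist x y \<le> Inf ?C"
    proof (rule cInf_greatest)
      fix C' assume "C' \<in> ?C"
      then have "dist (f x) (f y) \<le> C' * dist x y" using lipschitz_onD by blast
      then show "\<bar>f x - f y\<bar> / dist x y \<le> C'" using d by (simp add: divide_le_eq dist_real_def)
    qed (use C in blast)
    then show ?thesis using d by (simp add: divide_le_eq)
  qed simp
  also have "\<dots> \<le> 1 * dist x y" using \<open>Inf ?C \<le> 1\<close> by (intro mult_right_mono) auto
  finally show "\<bar>f x - f y\<bar> \<le> dist x y" by simp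
qed

text \<open>\<open>voronoi_compare\<close> gives the same bound for every test function and every
  list of unit arguments, so it survives both suprema. The zero function makes the outer supremum
  range over a nonempty set; the constant test function 1 gives the statement on the total
  tensors.\<close>

lemma voronoi_bounds:
  fixes K K' :: "'a::euclidean_space set" and r s :: nat
  assumes K: "compact K" "compact K'" "K' \<noteq> {}" "K' \<subseteq> K" and D: "K \<subseteq> cball 0 D" "1 \<le> D" "R \<le> D"
  defines "C \<equiv> (2 * real (r + s) + 1) * D ^ (r + s)"
  shows "0 \<le> d_bL (r + s) (voronoi_measure R r s K) (voronoi_measure R r s K')"
    and "d_bL (r + s) (voronoi_measure R r s K) (voronoi_measure R r s K') \<le> C * proj_err K K' R"
    and "\<And>vs. unit_args (r + s) vs \<Longrightarrow> \<bar>voronoi_tensor R r s K' vs - voronoi_tensor R r s K vs\<bar> \<le> C * proj_err K K' R"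
proof -
  have ne: "K \<noteq> {}" using K by blast
  have *: "\<bar>tensor_integral (voronoi_measure R r s K) f vs - tensor_integral (voronoi_measure R r s K') f vs\<bar> \<le> C * proj_err K K' R"
    if f: "f \<in> bL_unit_ball" and vs: "unit_args (r + s) vs" for f :: "'a \<Rightarrow> real" and vs
  proof -
    note b = bL_unit_ball_bounds[OF f]
    have "continuous_on UNIV f"
      unfolding continuous_on_iff dist_real_def using b(2) by (metis le_less_trans)
    then have fm: "f \<in> borel_measurable borel" by (rule borel_measurable_continuous_onI)
    show ?thesis
      unfolding tensor_integral_voronoi[OF K(1) ne fm b(1) vs] tensor_integral_voronoi[OF K(2,3) fm b(1) vs] C_def
      by (rule voronoi_compare[OF K D vs b])
  qed
  define q where "q f = tensor_norm (r + s) (\<lambda>vs. tensor_integral (voronoi_measure R r s K) f vs - tensor_integral (voronoi_measure R r s K') f vs)" for f :: "'a \<Rightarrow> real"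
  have q: "0 \<le> q f" "q f \<le> C * proj_err K K' R" if "f \<in> bL_unit_ball" for f
    unfolding q_def by (rule tensor_norm_bounds[OF *[OF that]], assumption)+
  have z: "(\<lambda>_. 0) \<in> (bL_unit_ball :: ('a \<Rightarrow> real) set)"
  proof -
    have "lipschitz_on 0 UNIV (\<lambda>_::'a. 0::real)" by (simp add: lipschitz_on_def)
    then have "Inf {C. lipschitz_on C UNIV (\<lambda>_::'a. 0::real)} \<le> 0"
      by (intro cInf_lower) (auto simp: lipschitz_on_def intro!: bdd_belowI[of _ 0])
    then show ?thesis unfolding bL_unit_ball_def using \<open>lipschitz_on 0 UNIV (\<lambda>_::'a. 0::real)\<close> by auto
  qed
  have eq: "d_bL (r + s) (voronoi_measure R r s K) (voronoi_measure R r s K') = (SUP f\<in>bL_unit_ball. q f)"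
    by (simp add: d_bL_def q_def)
  have "0 \<le> q (\<lambda>_. 0)" using q z by blast
  also have "\<dots> \<le> (SUP f\<in>bL_unit_ball. q f)"
    by (rule cSUP_upper[OF z]) (use q in \<open>auto intro!: bdd_aboveI\<close>)
  finally show "0 \<le> d_bL (r + s) (voronoi_measure R r s K) (voronoi_measure R r s K')" using eq by simp
  show "d_bL (r + s) (voronoi_measure R r s K) (voronoi_measure R r s K') \<le> C * proj_err K K' R"
    unfolding eq by (rule cSUP_least) (use z q in auto)
  fix vs :: "'a list" assume vs: "unit_args (r + s) vs"
  show "\<bar>voronoi_tensor R r s K' vs - voronoi_tensor R r s K vs\<bar> \<le> C * proj_err K K' R"
    using voronoi_compare[OF K D vs, of "\<lambda>_. 1"]
    by (simp add: voronoi_tensor_def voronoi_measure_def C_def abs_minus_commute)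
qed

text \<open>In rank 0 the projection drops out and only the volume is left; this is why the case r =
  s = 0 has the better rate.\<close>

lemma voronoi_tensor_00:
  fixes K :: "'a::euclidean_space set"
  assumes "compact K" "K \<noteq> {}"
  shows "voronoi_tensor R 0 0 K [] = measure lebesgue (parallel_set K R)"
proof -
  have "voronoi_tensor R 0 0 K [] = (LINT x:parallel_set K R|lebesgue. 1)"
    by (simp add: voronoi_tensor_def voronoi_measure_def tensor_power_prod_eq)
  then show ?thesis by (simp add: set_lebesgue_integral_def)
qed

lemma infdist_le_add_Hausdorff:
  fixes K :: "'a::euclidean_space set"
  assumes "closed K" "K \<noteq> {}" "\<And>x. x \<in> K \<Longrightarrow> infdist x K' \<le> h"
  shows "infdist x K' \<le> infdist x K + h"
proof -
  have "infdist x K' \<le> infdist (closest_point K x) K' + dist x (closest_point K x)" by (rule infdist_triangle)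
  then show ?thesis
    using assms(3)[OF closest_point_infdist(1)[OF assms(1,2), of x]] closest_point_infdist(2)[OF assms(1,2), of x] by linarith
qed

text \<open>The projections converge at every point with a unique nearest point in K. The indicator
  of the lost layer tends to 0 off the level set at distance R, which is null since R > 0.\<close>

lemma proj_err_tendsto:
  fixes K :: "'a::euclidean_space set"
  assumes K: "compact K" "K \<noteq> {}" and R: "0 < R"
    and K': "\<And>n. compact (K' n)" "\<And>n. K' n \<noteq> {}" "\<And>n. K' n \<subseteq> K"
    and h: "\<And>n x. x \<in> K \<Longrightarrow> infdist x (K' n) \<le> h n" "h \<longlonglongrightarrow> 0"
  shows "(\<lambda>n. proj_err K (K' n) R) \<longlonglongrightarrow> 0"
proof -
  note cl = compact_imp_closed[OF K(1)] compact_imp_closed[OF K'(1)]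
  note cp = closest_point_infdist[OF cl(1) K(2)] closest_point_infdist[OF cl(2) K'(2)]
  have near: "infdist x (K' n) \<le> infdist x K + h n" for x n
    by (rule infdist_le_add_Hausdorff[OF cl(1) K(2) h(1)])
  have mono: "infdist x K \<le> infdist x (K' n)" for x n by (rule infdist_mono[OF K'(3,2)])
  have lim: "(\<lambda>n. infdist x (K' n)) \<longlonglongrightarrow> infdist x K" for x
  proof (rule tendsto_sandwich[of "\<lambda>_. infdist x K" _ _ "\<lambda>n. infdist x K + h n"])
    show "(\<lambda>n. infdist x K + h n) \<longlonglongrightarrow> infdist x K" using tendsto_add[OF tendsto_const h(2)] by simp
  qed (use near mono in auto)
  obtain D where D: "K \<subseteq> cball 0 D" using bounded_subset_cball0E[OF compact_imp_bounded[OF K(1)]] by blast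
  have S: "parallel_set A R \<in> lmeasurable" if "compact A" "A \<noteq> {}" for A :: "'a set"
    using parallel_set_lmeasurable that by blast
  let ?S = "parallel_set K R"
  have [measurable]: "closest_point K \<in> borel_measurable lebesgue" "closest_point (K' n) \<in> borel_measurable lebesgue" for n
    by (rule borel_measurable_closest_point[OF cl(1) K(2)], rule borel_measurable_closest_point[OF cl(2) K'(2)])
  have 1: "(\<lambda>n. LINT x:?S|lebesgue. dist (closest_point K x) (closest_point (K' n) x)) \<longlonglongrightarrow> 0"
  proof -
    have "(\<lambda>n. \<integral>x. indicator ?S x *\<^sub>R dist (closest_point K x) (closest_point (K' n) x) \<partial>lebesgue)
       \<longlonglongrightarrow> (\<integral>x. 0 \<partial>(lebesgue :: 'a measure))"
    proof (rule integral_dominated_convergence[where w = "\<lambda>x. indicator ?S x * (2 * D)"])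
      show "integrable lebesgue (\<lambda>x. indicator ?S x * (2 * D))"
        using S[OF K] by (intro integrable_mult_left) (auto simp: fmeasurable_def less_top)
      show "AE x in lebesgue. (\<lambda>n. indicator ?S x *\<^sub>R dist (closest_point K x) (closest_point (K' n) x)) \<longlonglongrightarrow> 0"
        using AE_unp[OF cl(1) K(2)]
      proof eventually_elim
        case (elim x)
        have "(\<lambda>n. closest_point (K' n) x) \<longlonglongrightarrow> closest_point K x"
          by (rule tendsto_closest_point[OF cl(1) elim]) (use subsetD[OF K'(3) cp(3)] lim in \<open>auto simp: cp\<close>)
        then have "(\<lambda>n. dist (closest_point K x) (closest_point (K' n) x)) \<longlonglongrightarrow> dist (closest_point K x) (closest_point K x)"
          by (intro tendsto_intros)
        from tendsto_scaleR[OF tendsto_const this] show ?case by simp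
      qed
      show "AE x in lebesgue. norm (indicator ?S x *\<^sub>R dist (closest_point K x) (closest_point (K' n) x)) \<le> indicator ?S x * (2 * D)" for n
      proof (rule AE_I2)
        fix x
        have "closest_point K x \<in> cball 0 D" "closest_point (K' n) x \<in> cball 0 D"
          using cp(1)[of x] cp(3)[of n x] D K'(3)[of n] by auto
        then have "dist (closest_point K x) (closest_point (K' n) x) \<le> 2 * D"
          using norm_triangle_ineq4[of "closest_point K x" "closest_point (K' n) x"] by (simp add: dist_norm)
        then show "norm (indicator ?S x *\<^sub>R dist (closest_point K x) (closest_point (K' n) x)) \<le> indicator ?S x * (2 * D)"
          by (auto simp: indicator_def)
      qed
    qed measurable
    then show ?thesis by (simp add: set_lebesgue_integral_def)
  qed
  have 2: "(\<lambda>n. measure lebesgue (?S - parallel_set (K' n) R)) \<longlonglongrightarrow> 0"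
  proof -
    have "(\<lambda>n. \<integral>x. indicator (?S - parallel_set (K' n) R) x \<partial>lebesgue) \<longlonglongrightarrow> (\<integral>x. (0::real) \<partial>(lebesgue :: 'a measure))"
    proof (rule integral_dominated_convergence[where w = "indicator ?S"])
      show "integrable lebesgue (indicator ?S :: 'a \<Rightarrow> real)"
        using S[OF K] by (auto simp: fmeasurable_def less_top)
      have "AE x in lebesgue. infdist x K \<noteq> R"
        by (rule AE_I'[of "{x. infdist x K = R}"])
          (use negligible_infdist_level[OF K R] in \<open>auto simp: negligible_iff_null_sets\<close>)
      then show "AE x in lebesgue. (\<lambda>n. indicator (?S - parallel_set (K' n) R) x :: real) \<longlonglongrightarrow> 0"
      proof eventually_elim
        case (elim x)
        show ?case
        proof (cases "infdist x K < R")
          case True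
          have "eventually (\<lambda>n. infdist x (K' n) < R) sequentially"
            using order_tendstoD(2)[OF lim True] .
          then have "eventually (\<lambda>n. indicator (?S - parallel_set (K' n) R) x = (0::real)) sequentially"
            by eventually_elim (simp add: parallel_set_def)
          then show ?thesis by (rule tendsto_eventually)
        next
          case False
          then have "x \<notin> ?S" using elim by (simp add: parallel_set_def)
          then show ?thesis by simp
        qed
      qed
      show "AE x in lebesgue. norm (indicator (?S - parallel_set (K' n) R) x :: real) \<le> indicator ?S x" for n
        by (auto simp: indicator_def)
    qed measurable
    then show ?thesis by simp
  qed
  show ?thesis unfolding proj_err_def using tendsto_add[OF 1 2] by simp
qed

lemma proj_err_tendsto_at_right:
  fixes K :: "'a::euclidean_space set"
  assumes K: "compact K" "K \<noteq> {}" and R: "0 < R"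
    and ev: "\<forall>\<^sub>F a in at_right 0. compact (K' a) \<and> K' a \<noteq> {} \<and> K' a \<subseteq> K \<and> (\<forall>x\<in>K. infdist x (K' a) \<le> h a)"
    and h: "(h \<longlongrightarrow> 0) (at_right 0)"
  shows "((\<lambda>a::real. proj_err K (K' a) R) \<longlongrightarrow> 0) (at_right 0)"
proof -
  define P where "P a \<longleftrightarrow> compact (K' a) \<and> K' a \<noteq> {} \<and> K' a \<subseteq> K \<and> (\<forall>x\<in>K. infdist x (K' a) \<le> h a)" for a
  \<comment> \<open>The sequential characterization of the limit needs the hypotheses along a whole
    sequence, whereas they hold only eventually; where they fail, K itself is substituted.\<close>
  define L where "L a = (if P a then K' a else K)" for a
  define g where "g a = (if P a then h a else 0)" for a
  have evP: "\<forall>\<^sub>F a in at_right 0. P a" using ev unfolding P_def .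
  have g: "(g \<longlongrightarrow> 0) (at_right 0)"
    by (rule Lim_transform_eventually[OF h]) (use evP in \<open>auto elim!: eventually_mono simp: g_def\<close>)
  have "((\<lambda>a. proj_err K (L a) R) \<longlongrightarrow> 0) (at_right 0)"
    unfolding tendsto_at_iff_sequentially
  proof (intro allI impI)
    fix X :: "nat \<Rightarrow> real" assume X: "\<forall>i. X i \<in> {0<..} - {0}" "X \<longlonglongrightarrow> 0"
    have "(\<lambda>n. proj_err K (L (X n)) R) \<longlonglongrightarrow> 0"
    proof (rule proj_err_tendsto[OF K R])
      show "compact (L (X n))" "L (X n) \<noteq> {}" "L (X n) \<subseteq> K" for n
        using K by (auto simp: L_def P_def)
      show "infdist x (L (X n)) \<le> g (X n)" if "x \<in> K" for x n
        using that by (auto simp: L_def g_def P_def)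
      show "(\<lambda>n. g (X n)) \<longlonglongrightarrow> 0"
        using g X unfolding tendsto_at_iff_sequentially by (auto simp: o_def)
    qed
    then show "((\<lambda>a. proj_err K (L a) R) \<circ> X) \<longlonglongrightarrow> 0" by (simp add: o_def)
  qed
  then show ?thesis
    by (rule Lim_transform_eventually) (use evP in \<open>auto elim!: eventually_mono simp: L_def\<close>)
qed

section \<open>Volumes under Lipschitz perturbations of the identity\<close>

definition polynomial_on :: "nat \<Rightarrow> real set \<Rightarrow> (real \<Rightarrow> real) \<Rightarrow> bool" where
  "polynomial_on n I g \<longleftrightarrow> (\<exists>P. degree P \<le> n \<and> (\<forall>t\<in>I. g t = poly P t))"

definition lagrange_basis :: "real set \<Rightarrow> real \<Rightarrow> real poly" where
  "lagrange_basis X t = (\<Prod>s\<in>X - {t}. Polynomial.smult (1 / (t - s)) [: - s, 1 :])"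

lemma poly_lagrange_basis:
  assumes "finite X" "t \<in> X" "s \<in> X"
  shows "poly (lagrange_basis X t) s = (if s = t then 1 else 0)"
proof (cases "s = t")
  case True
  have "poly (lagrange_basis X t) t = (\<Prod>s\<in>X - {t}. 1)"
    unfolding lagrange_basis_def poly_prod
    by (intro prod.cong) (auto simp flip: diff_divide_distrib)
  then show ?thesis using True by simp
next
  case False
  then have "\<exists>u\<in>X - {t}. poly (Polynomial.smult (1 / (t - u)) [: - u, 1 :]) s = 0"
    using assms by (intro bexI[of _ s]) auto
  then show ?thesis using False assms unfolding lagrange_basis_def poly_prod by (auto simp: prod_zero_iff)
qed

lemma degree_lagrange_basis:
  assumes "finite X" "t \<in> X"
  shows "degree (lagrange_basis X t) < card X"
proof -
  have "degree (lagrange_basis X t) \<le> sum (degree \<circ> (\<lambda>s. Polynomial.smult (1 / (t - s)) [: - s, 1 :])) (X - {t})"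
    unfolding lagrange_basis_def by (rule degree_prod_sum_le) (use assms in simp)
  also have "\<dots> \<le> (\<Sum>s\<in>X - {t}. 1)" by (intro sum_mono) auto
  also have "\<dots> < card X" using assms card_Diff1_less[of X t] by simp
  finally show ?thesis .
qed

lemma lagrange_interpolation:
  assumes X: "finite X" "degree P < card X"
  shows "poly P x = (\<Sum>t\<in>X. poly (lagrange_basis X t) x * poly P t)"
proof -
  let ?Q = "\<Sum>t\<in>X. Polynomial.smult (poly P t) (lagrange_basis X t)"
  have "P = ?Q"
  proof (rule poly_eqI_degree[of X])
    fix s assume s: "s \<in> X"
    have "poly ?Q s = (\<Sum>t\<in>X. if t = s then poly P t else 0)"
      unfolding poly_sum by (intro sum.cong) (auto simp: poly_lagrange_basis X s)
    then show "poly P s = poly ?Q s" using s X by simp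
  next
    have "degree ?Q \<le> card X - 1"
    proof (rule degree_sum_le[OF X(1)])
      fix t assume "t \<in> X"
      then have "degree (lagrange_basis X t) \<le> card X - 1" using degree_lagrange_basis[OF X(1)] by fastforce
      then show "degree (Polynomial.smult (poly P t) (lagrange_basis X t)) \<le> card X - 1"
        using degree_smult_le le_trans by blast
    qed
    then show "degree ?Q < card X" using X(2) by simp
  qed (use X in simp)
  then have "poly P x = poly ?Q x" by simp
  also have "\<dots> = (\<Sum>t\<in>X. poly (lagrange_basis X t) x * poly P t)" by (simp add: poly_sum mult.commute)
  finally show ?thesis .
qed

text \<open>In this form polynomiality is visibly preserved by limits, sums and integrals.\<close>

lemma polynomial_on_iff_lagrange:
  assumes X: "finite X" "card X = Suc n" "X \<subseteq> I"
  shows "polynomial_on n I g \<longleftrightarrow> (\<forall>x\<in>I. g x = (\<Sum>t\<in>X. poly (lagrange_basis X t) x * g t))"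
proof
  assume "polynomial_on n I g"
  then obtain P where P: "degree P \<le> n" "\<And>t. t \<in> I \<Longrightarrow> g t = poly P t" unfolding polynomial_on_def by blast
  show "\<forall>x\<in>I. g x = (\<Sum>t\<in>X. poly (lagrange_basis X t) x * g t)"
  proof
    fix x assume "x \<in> I"
    then have "g x = (\<Sum>t\<in>X. poly (lagrange_basis X t) x * poly P t)"
      using lagrange_interpolation[of X P x] P X by simp
    also have "\<dots> = (\<Sum>t\<in>X. poly (lagrange_basis X t) x * g t)"
      using P(2) X(3) by (intro sum.cong) auto
    finally show "g x = (\<Sum>t\<in>X. poly (lagrange_basis X t) x * g t)" .
  qed
next
  assume *: "\<forall>x\<in>I. g x = (\<Sum>t\<in>X. poly (lagrange_basis X t) x * g t)"
  show "polynomial_on n I g" unfolding polynomial_on_def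
  proof (intro exI conjI ballI)
    show "degree (\<Sum>t\<in>X. Polynomial.smult (g t) (lagrange_basis X t)) \<le> n"
    proof (rule degree_sum_le[OF X(1)])
      fix t assume "t \<in> X"
      then have "degree (lagrange_basis X t) \<le> n" using degree_lagrange_basis[of X t] X by simp
      then show "degree (Polynomial.smult (g t) (lagrange_basis X t)) \<le> n" using degree_smult_le le_trans by blast
    qed
    show "g x = poly (\<Sum>t\<in>X. Polynomial.smult (g t) (lagrange_basis X t)) x" if "x \<in> I" for x
      using * that by (simp add: poly_sum mult.commute)
  qed
qed

lemma infinite_obtain_nodes:
  assumes "infinite (I :: real set)"
  obtains X where "finite X" "card X = Suc n" "X \<subseteq> I"
  using infinite_arbitrarily_large[OF assms] by blast

text \<open>The change of variables theorem of the library is stated for Cartesian powers of the reals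
  only. A Euclidean space is transported to such a power, indexed by its own basis.\<close>

typedef (overloaded) 'a coord = "Basis :: 'a::euclidean_space set"
  using nonempty_Basis by blast

text \<open>The change of variables theorem asks for a finite and well-ordered index type; the order
  is pulled back from an enumeration of the basis.\<close>

instantiation coord :: (euclidean_space) linorder
begin
definition less_eq_coord :: "'a coord \<Rightarrow> 'a coord \<Rightarrow> bool" where
  "less_eq_coord i j \<longleftrightarrow> to_nat_on Basis (Rep_coord i) \<le> to_nat_on Basis (Rep_coord j)"
definition less_coord :: "'a coord \<Rightarrow> 'a coord \<Rightarrow> bool" where
  "less_coord i j \<longleftrightarrow> to_nat_on Basis (Rep_coord i) < to_nat_on Basis (Rep_coord j)"
instance
proof
  fix i j :: "'a coord"
  assume "i \<le> j" "j \<le> i"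
  then show "i = j"
    using inj_on_to_nat_on[of "Basis :: 'a set"] Rep_coord[of i] Rep_coord[of j]
    by (simp add: less_eq_coord_def countable_finite inj_on_eq_iff Rep_coord_inject)
qed (auto simp: less_eq_coord_def less_coord_def)
end

instance coord :: (euclidean_space) finite
proof
  have "(UNIV :: 'a coord set) = Abs_coord ` Basis"
    using type_definition.Abs_image[OF type_definition_coord] by blast
  then show "finite (UNIV :: 'a coord set)" by (metis finite_imageI finite_Basis)
qed

instance coord :: (euclidean_space) wellorder
proof
  fix P :: "'a coord \<Rightarrow> bool" and a
  assume *: "\<And>x. (\<And>y. y < x \<Longrightarrow> P y) \<Longrightarrow> P x"
  show "P a"
  proof (induction a rule: measure_induct_rule[of "\<lambda>i. to_nat_on Basis (Rep_coord i)"])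
    case (less x)
    show ?case by (rule *) (use less in \<open>simp add: less_coord_def\<close>)
  qed
qed

lemma bij_betw_Rep_coord: "bij_betw Rep_coord UNIV (Basis :: 'a::euclidean_space set)"
  using type_definition.Rep_range[OF type_definition_coord] Rep_coord_inject
  by (auto simp: bij_betw_def inj_on_def)

lemma card_coord: "CARD('a::euclidean_space coord) = DIM('a)"
  using bij_betw_same_card[OF bij_betw_Rep_coord] .

definition to_coord :: "'a::euclidean_space \<Rightarrow> real ^ 'a coord" where
  "to_coord x = (\<chi> i. x \<bullet> Rep_coord i)"

definition of_coord :: "real ^ 'a coord \<Rightarrow> 'a::euclidean_space" where
  "of_coord y = (\<Sum>i\<in>UNIV. vec_nth y i *\<^sub>R Rep_coord i)"

lemma of_coord_inner: "b \<in> Basis \<Longrightarrow> of_coord y \<bullet> b = vec_nth y (Abs_coord b)"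
proof -
  assume b: "b \<in> Basis"
  have "of_coord y \<bullet> b = (\<Sum>i\<in>UNIV. vec_nth y i * (Rep_coord i \<bullet> b))"
    by (simp add: of_coord_def inner_sum_left)
  also have "\<dots> = (\<Sum>i\<in>UNIV. if i = Abs_coord b then vec_nth y i else 0)"
  proof (intro sum.cong refl)
    fix i :: "'a coord"
    have "i = Abs_coord b \<longleftrightarrow> Rep_coord i = b" using b Abs_coord_inverse Rep_coord_inverse by metis
    then show "vec_nth y i * (Rep_coord i \<bullet> b) = (if i = Abs_coord b then vec_nth y i else 0)"
      using b Rep_coord[of i] by (auto simp: inner_Basis)
  qed
  finally show ?thesis by simp
qed

lemma of_to_coord [simp]: "of_coord (to_coord x) = x"
  by (rule euclidean_eqI) (simp add: of_coord_inner to_coord_def Abs_coord_inverse)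

lemma to_of_coord [simp]: "to_coord (of_coord y) = y"
  by (simp add: Finite_Cartesian_Product.vec_eq_iff to_coord_def of_coord_inner Rep_coord Rep_coord_inverse)

lemma linear_to_coord: "linear to_coord"
  by (rule linearI) (auto simp: to_coord_def Finite_Cartesian_Product.vec_eq_iff inner_add_left)

lemma linear_of_coord: "linear of_coord"
  by (rule linearI) (auto simp: of_coord_def scaleR_add_left sum.distrib scaleR_sum_right)

lemma bounded_linear_coord: "bounded_linear to_coord" "bounded_linear of_coord"
  using linear_to_coord linear_of_coord linear_conv_bounded_linear by auto

lemma inner_of_coord: "of_coord x \<bullet> of_coord y = x \<bullet> y"
proof -
  have "of_coord x \<bullet> of_coord y = (\<Sum>i\<in>UNIV. vec_nth x i * (Rep_coord i \<bullet> of_coord y))"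
    by (simp add: of_coord_def[of x] inner_sum_left)
  also have "\<dots> = (\<Sum>i\<in>UNIV. vec_nth x i * vec_nth y i)"
    by (intro sum.cong refl) (subst inner_commute, simp add: of_coord_inner Rep_coord Rep_coord_inverse)
  finally show ?thesis by (simp add: inner_vec_def)
qed

lemma norm_of_coord [simp]: "norm (of_coord x) = norm x"
  by (simp add: norm_eq_sqrt_inner inner_of_coord)

lemma norm_to_coord [simp]: "norm (to_coord x) = norm x"
  by (metis norm_of_coord of_to_coord)

text \<open>A Borel measure that gives every box the product of its side lengths is Lebesgue
  measure, and \<open>of_coord\<close> merely relabels coordinates, so boxes pull back to boxes with
  the same sides.\<close>

lemma distr_of_coord: "distr lborel borel of_coord = (lborel :: 'a::euclidean_space measure)"
proof (rule lborel_eqI[symmetric])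
  have [measurable]: "of_coord \<in> borel_measurable (borel :: (real ^ 'a coord) measure)"
    by (intro borel_measurable_continuous_onI linear_continuous_on bounded_linear_coord)
  fix l u :: 'a assume lu: "\<And>b. b \<in> Basis \<Longrightarrow> l \<bullet> b \<le> u \<bullet> b"
  have "of_coord -` box l u = box (to_coord l) (to_coord u)"
  proof (intro equalityI subsetI)
    fix y assume y: "y \<in> of_coord -` box l u"
    show "y \<in> box (to_coord l) (to_coord u)"
      unfolding mem_box_cart
    proof
      fix i
      show "vec_nth (to_coord l) i < vec_nth y i \<and> vec_nth y i < vec_nth (to_coord u) i"
        using y Rep_coord[of i] unfolding mem_box vimage_eq
        by (metis (no_types, lifting) of_coord_inner Rep_coord_inverse to_coord_def vec_lambda_beta)
    qed
  next
    fix y assume y: "y \<in> box (to_coord l) (to_coord u)"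
    show "y \<in> of_coord -` box l u"
      unfolding mem_box vimage_eq
    proof
      fix b :: 'a assume b: "b \<in> Basis"
      show "l \<bullet> b < of_coord y \<bullet> b \<and> of_coord y \<bullet> b < u \<bullet> b"
        using y b unfolding mem_box_cart of_coord_inner[OF b]
        by (auto simp: to_coord_def Abs_coord_inverse dest!: spec[of _ "Abs_coord b"])
    qed
  qed
  then have "emeasure (distr lborel borel of_coord) (box l u) = emeasure lborel (box (to_coord l) (to_coord u))"
    by (simp add: emeasure_distr)
  also have "\<dots> = (\<Prod>b\<in>Basis. (to_coord u - to_coord l) \<bullet> b)"
    by (rule emeasure_lborel_box) (auto simp: Basis_vec_def inner_axis to_coord_def intro!: lu Rep_coord)
  also have "(\<Prod>b\<in>Basis. (to_coord u - to_coord l) \<bullet> b) = (\<Prod>i\<in>UNIV. vec_nth (to_coord u - to_coord l) i)"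
  proof -
    have B: "Basis = range (\<lambda>i. axis i (1::real) :: real ^ 'a coord)" by (auto simp: Basis_vec_def)
    have inj: "inj (\<lambda>i. axis i (1::real) :: real ^ 'a coord)" by (auto simp: inj_on_def axis_eq_axis)
    show ?thesis unfolding B by (subst prod.reindex[OF inj]) (simp add: inner_axis o_def)
  qed
  also have "\<dots> = (\<Prod>i\<in>UNIV. (u - l) \<bullet> Rep_coord i)"
    by (simp add: to_coord_def inner_diff_left)
  also have "\<dots> = (\<Prod>b\<in>Basis. (u - l) \<bullet> b)"
    by (rule prod.reindex_bij_betw[OF bij_betw_Rep_coord])
  finally show "emeasure (distr lborel borel of_coord) (box l u) = (\<Prod>b\<in>Basis. (u - l) \<bullet> b)" .
qed simp

lemma measure_to_coord_image:
  fixes S :: "'a::euclidean_space set"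
  assumes "S \<in> sets borel"
  shows "measure lebesgue (to_coord ` S) = measure lebesgue S"
proof -
  have [measurable]: "of_coord \<in> borel_measurable (borel :: (real ^ 'a coord) measure)"
    by (intro borel_measurable_continuous_onI linear_continuous_on bounded_linear_coord)
  have eq: "to_coord ` S = of_coord -` S"
    by (auto simp: image_iff intro!: bexI[of _ "of_coord _"])
  have "measure lborel S = measure (distr lborel borel of_coord) S" by (simp add: distr_of_coord)
  also have "\<dots> = measure lborel (of_coord -` S)" using assms by (simp add: measure_distr)
  finally have "measure lborel S = measure lborel (to_coord ` S)" by (simp add: eq)
  moreover have "to_coord ` S \<in> sets borel"
    unfolding eq using measurable_sets[of of_coord borel borel S] assms by simp
  ultimately show ?thesis using assms by simp
qed

section \<open>Volumes under differentiable perturbations of the identity\<close>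

lemma has_derivative_lipschitz_bound:
  fixes g :: "'a::real_normed_vector \<Rightarrow> 'b::real_normed_vector"
  assumes g: "(g has_derivative g') (at x)" and lip: "\<And>x y. norm (g x - g y) \<le> M * norm (x - y)"
  shows "norm (g' v) \<le> M * norm v"
proof -
  have "((\<lambda>t. x + t *\<^sub>R v) has_derivative (\<lambda>t. t *\<^sub>R v)) (at 0)"
    by (auto intro!: derivative_eq_intros)
  moreover have "(g has_derivative g') (at (x + 0 *\<^sub>R v))" using g by simp
  ultimately have "((\<lambda>t. g (x + t *\<^sub>R v)) has_derivative (\<lambda>t. g' (t *\<^sub>R v))) (at 0)"
    by (rule has_derivative_compose[of _ _ 0 UNIV])
  then have "((\<lambda>t. g (x + t *\<^sub>R v)) has_vector_derivative g' v) (at 0)"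
    unfolding has_vector_derivative_def using linear_scale[OF has_derivative_linear[OF g]] by simp
  then have lim: "((\<lambda>t. norm (g (x + t *\<^sub>R v) - g x - t *\<^sub>R g' v) / \<bar>t\<bar> + M * norm v) \<longlongrightarrow> 0 + M * norm v) (at 0)"
    unfolding has_vector_derivative_def has_derivative_at by (intro tendsto_add tendsto_const) simp
  have "norm (g' v) \<le> 0 + M * norm v"
  proof (rule tendsto_lowerbound[OF lim])
    show "\<forall>\<^sub>F t in at 0. norm (g' v) \<le> norm (g (x + t *\<^sub>R v) - g x - t *\<^sub>R g' v) / \<bar>t\<bar> + M * norm v"
      unfolding eventually_at_filter
    proof (intro always_eventually allI impI)
      fix t :: real assume t: "t \<noteq> 0"
      have "norm (t *\<^sub>R g' v) \<le> norm (g (x + t *\<^sub>R v) - g x - t *\<^sub>R g' v) + norm (g (x + t *\<^sub>R v) - g x)"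
        using norm_triangle_ineq4[of "g (x + t *\<^sub>R v) - g x" "g (x + t *\<^sub>R v) - g x - t *\<^sub>R g' v"] by simp
      also have "norm (g (x + t *\<^sub>R v) - g x) \<le> M * (\<bar>t\<bar> * norm v)"
        using lip[of "x + t *\<^sub>R v" x] by simp
      finally show "norm (g' v) \<le> norm (g (x + t *\<^sub>R v) - g x - t *\<^sub>R g' v) / \<bar>t\<bar> + M * norm v"
        using t by (simp add: field_simps)
    qed
  qed simp
  then show ?thesis by simp
qed

text \<open>Each term of the Leibniz expansion is a product of one affine function of t per
  row.\<close>

lemma det_perturbed_identity_polynomial:
  fixes A :: "real ^ 'n::finite ^ 'n"
  obtains P where "degree P \<le> CARD('n)" "\<And>t. Determinants.det (Finite_Cartesian_Product.mat 1 + t *\<^sub>R A) = poly P t"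
proof
  let ?I = "Finite_Cartesian_Product.mat 1 :: real ^ 'n ^ 'n"
  let ?f = "\<lambda>p i. [: vec_nth (vec_nth ?I i) (p i), vec_nth (vec_nth A i) (p i) :]"
  let ?P = "\<Sum>p\<in>{p. p permutes (UNIV :: 'n set)}. Polynomial.smult (of_int (sign p)) (\<Prod>i\<in>UNIV. ?f p i)"
  show "degree ?P \<le> CARD('n)"
  proof (rule degree_sum_le)
    show "finite {p. p permutes (UNIV :: 'n set)}" by (simp add: finite_permutations)
    fix p :: "'n \<Rightarrow> 'n"
    have "degree (\<Prod>i\<in>UNIV. ?f p i) \<le> sum (degree \<circ> ?f p) UNIV" by (rule degree_prod_sum_le) simp
    also have "\<dots> \<le> (\<Sum>i\<in>(UNIV :: 'n set). 1)" by (intro sum_mono) auto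
    finally have "degree (\<Prod>i\<in>UNIV. ?f p i) \<le> CARD('n)" by simp
    then show "degree (Polynomial.smult (of_int (sign p)) (\<Prod>i\<in>UNIV. ?f p i)) \<le> CARD('n)"
      using degree_smult_le le_trans by blast
  qed
  fix t
  show "Determinants.det (?I + t *\<^sub>R A) = poly ?P t"
    by (simp add: Determinants.det_def poly_sum poly_prod)
qed

text \<open>Continuity from t = 0, where the determinant is 1: a zero in between is excluded, since
  |u| M < 1 makes the matrix injective. The sign removes the absolute value from the change of
  variables formula, so that the integrand is a polynomial in t.\<close>

lemma det_perturbed_identity_pos:
  fixes A :: "real ^ 'n::finite ^ 'n"
  assumes A: "\<And>v. norm (A *v v) \<le> M * norm v" and t: "\<bar>t\<bar> * M < 1" "0 \<le> M"
  shows "0 < Determinants.det (Finite_Cartesian_Product.mat 1 + t *\<^sub>R A)"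
proof (rule ccontr)
  let ?D = "\<lambda>t. Determinants.det (Finite_Cartesian_Product.mat 1 + t *\<^sub>R A)"
  assume neg: "\<not> ?thesis"
  obtain P where P: "\<And>t. ?D t = poly P t" using det_perturbed_identity_polynomial[of A] by blast
  have cont: "continuous_on X ?D" for X unfolding P by (intro continuous_intros)
  have nz: "?D u \<noteq> 0" if u: "\<bar>u\<bar> \<le> \<bar>t\<bar>" for u
  proof -
    have mv: "(Finite_Cartesian_Product.mat 1 + u *\<^sub>R A) *v v = v + u *\<^sub>R (A *v v)" for v
      by (simp add: matrix_vector_mult_add_rdistrib scaleR_matrix_vector_assoc)
    have uM: "\<bar>u\<bar> * M < 1" using u t by (meson le_less_trans mult_right_mono)
    have "v = w" if eq: "(Finite_Cartesian_Product.mat 1 + u *\<^sub>R A) *v v = (Finite_Cartesian_Product.mat 1 + u *\<^sub>R A) *v w" for v w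
    proof -
      have "v - w = - (u *\<^sub>R (A *v (v - w)))"
        using eq unfolding mv by (simp add: matrix_vector_mult_diff_distrib algebra_simps)
      then have "norm (v - w) = \<bar>u\<bar> * norm (A *v (v - w))"
        by (metis norm_minus_cancel norm_scaleR)
      also have "\<dots> \<le> \<bar>u\<bar> * (M * norm (v - w))" by (intro mult_left_mono A) auto
      finally have "(1 - \<bar>u\<bar> * M) * norm (v - w) \<le> 0" by (simp add: algebra_simps)
      then show "v = w" using uM by (simp add: mult_le_0_iff)
    qed
    then have "inj ((*v) (Finite_Cartesian_Product.mat 1 + u *\<^sub>R A))" by (intro injI) blast
    then show ?thesis using det_nz_iff_inj[of "(*v) (Finite_Cartesian_Product.mat 1 + u *\<^sub>R A)"] by simp
  qed
  have D0: "?D 0 = 1" by simp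
  have Dt: "?D t \<le> 0" using neg by simp
  have "\<exists>u. \<bar>u\<bar> \<le> \<bar>t\<bar> \<and> ?D u = 0"
  proof (cases "0 \<le> t")
    case True
    then obtain u where "0 \<le> u" "u \<le> t" "?D u = 0" using IVT2'[of ?D t 0 0, OF Dt _ _ cont] D0 by auto
    then show ?thesis by (intro exI[of _ u]) simp
  next
    case False
    then show ?thesis using IVT'[of ?D t 0 0, OF Dt _ _ cont] D0 by auto
  qed
  then show False using nz by blast
qed

lemma infinite_perturbation_range:
  assumes "0 \<le> (M::real)"
  shows "infinite {t::real. \<bar>t\<bar> * M < 1}"
proof -
  \<comment> \<open>The denominator M + 1 also covers M = 0.\<close>
  have "{-1 / (M + 1)<..<1 / (M + 1)} \<subseteq> {t. \<bar>t\<bar> * M < 1}"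
  proof
    fix t assume "t \<in> {-1 / (M + 1)<..<1 / (M + 1)}"
    then have "\<bar>t\<bar> < 1 / (M + 1)" by auto
    then have "\<bar>t\<bar> * (M + 1) < 1" using assms by (simp add: less_divide_eq)
    then show "t \<in> {t. \<bar>t\<bar> * M < 1}" by (simp add: distrib_left)
  qed
  moreover have "infinite {-1 / (M + 1)<..<1 / (M + 1)}" using assms by (intro infinite_Ioo) (simp add: divide_less_eq)
  ultimately show ?thesis using finite_subset by blast
qed

text \<open>At each point the Jacobian determinant of x + t g(x) is a polynomial in t. Its
  interpolation identity is integrated over S; it involves only determinants at the nodes, whose
  integrals are already known to be volumes of images.\<close>

lemma measure_perturbed_image_differentiable:
  fixes g :: "'a::euclidean_space \<Rightarrow> 'a" and S :: "'a set"
  assumes g: "\<And>x. (g has_derivative g' x) (at x)" and lip: "\<And>x y. norm (g x - g y) \<le> M * norm (x - y)"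
    and S: "compact S" and M: "0 \<le> M"
  shows "polynomial_on DIM('a) {t. \<bar>t\<bar> * M < 1} (\<lambda>t. measure lebesgue ((\<lambda>x. x + t *\<^sub>R g x) ` S))"
proof -
  define I where "I = {t::real. \<bar>t\<bar> * M < 1}"
  define S' where "S' = to_coord ` S"
  define A where "A y = matrix (\<lambda>v. to_coord (g' (of_coord y) (of_coord v)))" for y
  have lin: "linear (\<lambda>v. to_coord (g' (of_coord y) (of_coord v)))" for y
    using linear_compose[OF linear_compose[OF linear_of_coord has_derivative_linear[OF g]] linear_to_coord]
    by (simp add: o_def)
  have Av: "A y *v v = to_coord (g' (of_coord y) (of_coord v))" for y v
    unfolding A_def by (rule matrix_works[OF lin[unfolded linear_matrix_vector_mul_eq[symmetric]]])
  define F where "F t y = to_coord (of_coord y + t *\<^sub>R g (of_coord y))" for t y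
  have F: "(F t has_derivative (\<lambda>v. (Finite_Cartesian_Product.mat 1 + t *\<^sub>R A y) *v v)) (at y within S')" for t y
  proof -
    have "(of_coord has_derivative of_coord) (at y within S')"
      by (rule bounded_linear_imp_has_derivative[OF bounded_linear_coord(2)])
    from has_derivative_compose[OF this g]
    have "((\<lambda>y. of_coord y + t *\<^sub>R g (of_coord y)) has_derivative (\<lambda>v. of_coord v + t *\<^sub>R g' (of_coord y) (of_coord v))) (at y within S')"
      using \<open>(of_coord has_derivative of_coord) (at y within S')\<close> by (auto intro!: derivative_eq_intros)
    from bounded_linear.has_derivative[OF bounded_linear_coord(1) this]
    have "(F t has_derivative (\<lambda>v. to_coord (of_coord v + t *\<^sub>R g' (of_coord y) (of_coord v)))) (at y within S')"
      unfolding F_def .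
    also have "(\<lambda>v. to_coord (of_coord v + t *\<^sub>R g' (of_coord y) (of_coord v))) = (\<lambda>v. (Finite_Cartesian_Product.mat 1 + t *\<^sub>R A y) *v v)"
      by (simp add: fun_eq_iff matrix_vector_mult_add_rdistrib Av linear_add[OF linear_to_coord] linear_scale[OF linear_to_coord]
          flip: scaleR_matrix_vector_assoc)
    finally show ?thesis .
  qed
  have inj: "inj_on (\<lambda>x. x + t *\<^sub>R g x) S" if "t \<in> I" for t
  proof (rule inj_onI)
    fix x y assume "x + t *\<^sub>R g x = y + t *\<^sub>R g y"
    then have "x - y = - (t *\<^sub>R (g x - g y))" by (simp add: algebra_simps)
    then have "norm (x - y) = \<bar>t\<bar> * norm (g x - g y)" by (metis norm_minus_cancel norm_scaleR)
    also have "\<dots> \<le> \<bar>t\<bar> * (M * norm (x - y))" by (intro mult_left_mono lip) auto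
    finally have "(1 - \<bar>t\<bar> * M) * norm (x - y) \<le> 0" by (simp add: algebra_simps)
    then show "x = y" using that by (simp add: I_def mult_le_0_iff)
  qed
  have cg: "continuous_on S g" using g has_derivative_continuous_on has_derivative_at_withinI by metis
  have hi: "((\<lambda>y. Determinants.det (Finite_Cartesian_Product.mat 1 + t *\<^sub>R A y)) has_integral
       measure lebesgue ((\<lambda>x. x + t *\<^sub>R g x) ` S)) S'" if t: "t \<in> I" for t
  proof -
    have im: "F t ` S' = to_coord ` (\<lambda>x. x + t *\<^sub>R g x) ` S"
      by (auto simp: F_def S'_def image_image)
    have c1: "compact ((\<lambda>x. x + t *\<^sub>R g x) ` S)"
      by (intro compact_continuous_image continuous_intros cg S)
    have c2: "compact (F t ` S')"
      unfolding im by (intro compact_continuous_image linear_continuous_on bounded_linear_coord c1)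
    have c3: "compact S'"
      unfolding S'_def by (intro compact_continuous_image linear_continuous_on bounded_linear_coord S)
    have injF: "inj_on (F t) S'"
      using inj[OF t] unfolding S'_def F_def inj_on_def by (auto dest!: arg_cong[of _ _ of_coord])
    have pos: "\<bar>Determinants.det (Finite_Cartesian_Product.mat 1 + t *\<^sub>R A y)\<bar> = Determinants.det (Finite_Cartesian_Product.mat 1 + t *\<^sub>R A y)" for y
    proof (rule abs_of_pos, rule det_perturbed_identity_pos[where M = M])
      show "norm (A y *v v) \<le> M * norm v" for v
        unfolding Av using has_derivative_lipschitz_bound[OF g lip, of "of_coord y" "of_coord v"] by simp
    qed (use t M in \<open>auto simp: I_def\<close>)
    have "F t ` S' \<in> lmeasurable \<and> measure lebesgue (F t ` S') = measure lebesgue (F t ` S')"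
      using lmeasurable_compact[OF c2] by simp
    then have "((\<lambda>y. \<bar>Determinants.det (matrix (\<lambda>v. (Finite_Cartesian_Product.mat 1 + t *\<^sub>R A y) *v v))\<bar>) has_integral
       measure lebesgue (F t ` S')) S'"
      by (subst (asm) has_measure_differentiable_image[OF _ F injF]) (use c3 in \<open>auto intro: lmeasurable_compact fmeasurableD\<close>)
    moreover have "measure lebesgue (F t ` S') = measure lebesgue ((\<lambda>x. x + t *\<^sub>R g x) ` S)"
      unfolding im by (rule measure_to_coord_image) (use c1 in \<open>auto intro: borel_compact\<close>)
    ultimately show ?thesis by (simp add: pos)
  qed
  have "infinite I" unfolding I_def by (rule infinite_perturbation_range[OF M])
  then obtain X where X: "finite X" "card X = Suc DIM('a)" "X \<subseteq> I" by (rule infinite_obtain_nodes)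
  show ?thesis
    unfolding I_def[symmetric] polynomial_on_iff_lagrange[OF X]
  proof
    fix t assume t: "t \<in> I"
    have "((\<lambda>y. \<Sum>u\<in>X. poly (lagrange_basis X u) t * Determinants.det (Finite_Cartesian_Product.mat 1 + u *\<^sub>R A y)) has_integral
       (\<Sum>u\<in>X. poly (lagrange_basis X u) t * measure lebesgue ((\<lambda>x. x + u *\<^sub>R g x) ` S))) S'"
      by (intro has_integral_sum has_integral_mult_right X hi) (use X in auto)
    moreover have "(\<Sum>u\<in>X. poly (lagrange_basis X u) t * Determinants.det (Finite_Cartesian_Product.mat 1 + u *\<^sub>R A y)) =
        Determinants.det (Finite_Cartesian_Product.mat 1 + t *\<^sub>R A y)" for y
    proof -
      obtain P where P: "degree P \<le> CARD('a coord)" "\<And>t. Determinants.det (Finite_Cartesian_Product.mat 1 + t *\<^sub>R A y) = poly P t"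
        using det_perturbed_identity_polynomial[of "A y"] by blast
      show ?thesis unfolding P(2) using lagrange_interpolation[of X P t] P(1) X by (simp add: card_coord)
    qed
    ultimately show "measure lebesgue ((\<lambda>x. x + t *\<^sub>R g x) ` S) =
       (\<Sum>u\<in>X. poly (lagrange_basis X u) t * measure lebesgue ((\<lambda>x. x + u *\<^sub>R g x) ` S))"
      using has_integral_unique[OF hi[OF t]] by simp
  qed
qed

section \<open>Mollification of Lipschitz maps\<close>

lemma DERIV_max0_square: "((\<lambda>s::real. (max 0 s)\<^sup>2) has_real_derivative 2 * max 0 s) (at s)"
proof -
  consider "s > 0" | "s < 0" | "s = 0" by linarith
  then show ?thesis
  proof cases
    case 1
    have "((\<lambda>s::real. s\<^sup>2) has_real_derivative 2 * max 0 s) (at s)"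
      using 1 by (auto intro!: derivative_eq_intros)
    then show ?thesis
      by (rule has_field_derivative_transform_within_open[where S = "{0<..}"]) (use 1 in auto)
  next
    case 2
    have "((\<lambda>s::real. 0) has_real_derivative 2 * max 0 s) (at s)"
      using 2 by (auto intro!: derivative_eq_intros)
    then show ?thesis
      by (rule has_field_derivative_transform_within_open[where S = "{..<0}"]) (use 2 in auto)
  next
    case 3
    have "((\<lambda>h. ((max 0 (0 + h))\<^sup>2 - (max 0 0)\<^sup>2) / h) \<longlongrightarrow> (0::real)) (at 0)"
    proof (rule Lim_null_comparison[of _ "\<lambda>h. \<bar>h\<bar>"])
      show "\<forall>\<^sub>F h in at 0. norm (((max 0 (0 + h))\<^sup>2 - (max 0 0)\<^sup>2) / h) \<le> \<bar>h::real\<bar>"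
        by (intro always_eventually allI) (auto simp: max_def power2_eq_square)
      show "((\<lambda>h::real. \<bar>h\<bar>) \<longlongrightarrow> 0) (at 0)" by (auto intro!: tendsto_eq_intros)
    qed
    then show ?thesis using 3 by (simp add: DERIV_def)
  qed
qed

text \<open>A compactly supported kernel of class C1: truncation at 0 leaves a kink that squaring
  removes, and one derivative is what the change of variables formula asks for. Normalization to
  integral 1 happens where the kernel is used.\<close>

definition bump :: "real \<Rightarrow> 'a::euclidean_space \<Rightarrow> real" where
  "bump e z = (max 0 (e\<^sup>2 - z \<bullet> z))\<^sup>2"

lemma bump_nonneg: "0 \<le> bump e z"
  by (simp add: bump_def)

lemma bump_eq_0: "e \<le> norm z \<Longrightarrow> 0 \<le> e \<Longrightarrow> bump e z = 0"
  by (simp add: bump_def power_mono flip: power2_norm_eq_inner)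

lemma bump_eq_0': "\<not> norm z \<le> e \<Longrightarrow> 0 < e \<Longrightarrow> bump e z = 0"
  by (rule bump_eq_0) auto

lemma continuous_on_bump[continuous_intros]:
  "continuous_on S f \<Longrightarrow> continuous_on S (\<lambda>x. bump e (f x))"
  unfolding bump_def by (intro continuous_intros)

lemma has_derivative_bump:
  "((\<lambda>x. bump e (y - x)) has_derivative (\<lambda>h. 4 * max 0 (e\<^sup>2 - (y - x) \<bullet> (y - x)) * ((y - x) \<bullet> h))) (at x within S)"
proof -
  have 1: "((\<lambda>x. e\<^sup>2 - (y - x) \<bullet> (y - x)) has_derivative (\<lambda>h. 2 * ((y - x) \<bullet> h))) (at x within S)"
    by (auto intro!: derivative_eq_intros simp: inner_commute)
  have 2: "((\<lambda>s::real. (max 0 s)\<^sup>2) has_derivative (\<lambda>h. h * (2 * max 0 (e\<^sup>2 - (y - x) \<bullet> (y - x))))) (at (e\<^sup>2 - (y - x) \<bullet> (y - x)))"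
    using DERIV_max0_square[of "e\<^sup>2 - (y - x) \<bullet> (y - x)"] by (simp add: has_field_derivative_def mult_commute_abs)
  have "((\<lambda>x. (max 0 (e\<^sup>2 - (y - x) \<bullet> (y - x)))\<^sup>2) has_derivative (\<lambda>h. (2 * ((y - x) \<bullet> h)) * (2 * max 0 (e\<^sup>2 - (y - x) \<bullet> (y - x))))) (at x within S)"
    by (rule has_derivative_compose[OF 1 2])
  then show ?thesis unfolding bump_def by (simp add: mult_ac)
qed

lemma bump_integral_pos:
  assumes "0 < e"
  shows "integrable lborel (bump e :: 'a::euclidean_space \<Rightarrow> real)" "0 < (\<integral>z. bump e (z :: 'a) \<partial>lborel)"
proof -
  have "integrable lborel (\<lambda>z::'a. indicator (cball 0 e) z *\<^sub>R bump e z)"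
    by (intro borel_integrable_compact continuous_intros) auto
  moreover have "(\<lambda>z::'a. indicator (cball 0 e) z *\<^sub>R bump e z) = bump e"
    using assms by (auto simp: fun_eq_iff indicator_def simp: bump_eq_0')
  ultimately show int: "integrable lborel (bump e :: 'a \<Rightarrow> real)" by simp
  show "0 < (\<integral>z. bump e (z :: 'a) \<partial>lborel)"
  proof (rule ccontr)
    assume "\<not> ?thesis"
    moreover have "0 \<le> (\<integral>z. bump e (z :: 'a) \<partial>lborel)" by (intro Bochner_Integration.integral_nonneg bump_nonneg)
    ultimately have "(\<integral>z. bump e (z :: 'a) \<partial>lborel) = 0" by linarith
    then have "AE z in lborel. bump e (z :: 'a) = 0"
      using integral_nonneg_eq_0_iff_AE[OF int] by (simp add: bump_nonneg)
    moreover have "bump e z \<noteq> 0" if "z \<in> ball 0 e" for z :: 'a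
    proof -
      have "z \<bullet> z < e\<^sup>2" using that assms by (simp add: power2_norm_eq_inner[symmetric] power_strict_mono)
      then show ?thesis by (simp add: bump_def)
    qed
    ultimately have "AE z in lborel. (z :: 'a) \<notin> ball 0 e" by (auto elim!: eventually_mono)
    then have "emeasure lborel (ball (0::'a) e) = 0"
      by (subst (asm) AE_iff_measurable[of "ball 0 e"]) auto
    then have "negligible (ball (0::'a) e)" 
      by (simp add: negligible_iff_emeasure0 emeasure_completion)
    then show False using open_not_negligible[of "ball (0::'a) e"] assms by auto
  qed
qed

text \<open>The convolution averages translates of q by vectors of length at most e, so it keeps the
  Lipschitz constant and stays within M e of q. After a translation of the variable, x occurs only
  in the differentiable kernel, and the derivative passes under the integral.\<close>

lemma lipschitz_mollify:
  fixes q :: "'a::euclidean_space \<Rightarrow> 'a"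
  assumes lip: "\<And>x y. norm (q x - q y) \<le> M * norm (x - y)" and e: "0 < e"
  obtains g g' where "\<And>x. (g has_derivative g' x) (at x)" "\<And>x y. norm (g x - g y) \<le> M * norm (x - y)"
    "\<And>x. norm (g x - q x) \<le> M * e"
proof -
  have M: "0 \<le> M"
  proof -
    obtain b :: 'a where "b \<in> Basis" using nonempty_Basis by blast
    then show ?thesis using lip[of b 0] order_trans[OF norm_ge_zero] by simp
  qed
  have contq: "continuous_on S q" for S
    by (rule lipschitz_on_continuous_on[of M]) (auto simp: lipschitz_on_def dist_norm lip M)
  define c where "c = (\<integral>z. bump e (z :: 'a) \<partial>lborel)"
  have c: "0 < c" unfolding c_def by (rule bump_integral_pos[OF e])
  define w where "w z = bump e z / c" for z :: 'a
  have w0: "0 \<le> w z" for z using c by (simp add: w_def bump_nonneg)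
  have wi: "integrable lborel w" unfolding w_def by (intro integrable_divide bump_integral_pos(1)[OF e])
  have w1: "(\<integral>z. w z \<partial>lborel) = 1" unfolding w_def using c by (simp add: c_def)
  have int: "integrable lborel (\<lambda>z. w z *\<^sub>R f z)" if "\<And>S. continuous_on S f" for f :: "'a \<Rightarrow> 'b::euclidean_space"
  proof -
    have "integrable lborel (\<lambda>z::'a. indicator (cball 0 e) z *\<^sub>R (w z *\<^sub>R f z))"
      unfolding w_def using c by (intro borel_integrable_compact continuous_intros that) auto
    moreover have "indicator (cball 0 e) z *\<^sub>R (w z *\<^sub>R f z) = w z *\<^sub>R f z" for z
      using e by (cases "norm z \<le> e") (auto simp: w_def bump_eq_0')
    ultimately show ?thesis by (simp only:)
  qed
  have contsh: "continuous_on S (\<lambda>z. q (x + z))" for x S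
    by (rule continuous_on_compose2[OF contq[of UNIV]]) (auto intro!: continuous_intros)
  define g where "g x = (\<integral>z. w z *\<^sub>R q (x + z) \<partial>lborel)" for x
  have est: "norm ((\<integral>z. w z *\<^sub>R f z \<partial>lborel) - (\<integral>z. w z *\<^sub>R h z \<partial>lborel)) \<le> b"
    if f: "\<And>S. continuous_on S f" "\<And>S. continuous_on S h" and b: "\<And>z. norm z \<le> e \<Longrightarrow> norm (f z - h z) \<le> b"
    for f h :: "'a \<Rightarrow> 'a" and b
  proof -
    have "norm ((\<integral>z. w z *\<^sub>R f z \<partial>lborel) - (\<integral>z. w z *\<^sub>R h z \<partial>lborel)) = norm (\<integral>z. w z *\<^sub>R (f z - h z) \<partial>lborel)"
      using int[OF f(1)] int[OF f(2)] by (simp add: scaleR_diff_right)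
    also have "\<dots> \<le> (\<integral>z. norm (w z *\<^sub>R (f z - h z)) \<partial>lborel)" by (rule integral_norm_bound)
    also have "\<dots> \<le> (\<integral>z. w z * b \<partial>lborel)"
    proof (rule integral_mono)
      show "integrable lborel (\<lambda>z. norm (w z *\<^sub>R (f z - h z)))"
        by (intro integrable_norm int continuous_intros f)
      show "integrable lborel (\<lambda>z. w z * b)" using wi by simp
      fix z
      show "norm (w z *\<^sub>R (f z - h z)) \<le> w z * b"
      proof (cases "norm z \<le> e")
        case True then show ?thesis using b w0 by (simp add: mult_left_mono)
      next
        case False then show ?thesis using e by (simp add: w_def bump_eq_0')
      qed
    qed
    also have "\<dots> = b" using w1 by simp
    finally show ?thesis .
  qed
  have "norm (g x - g y) \<le> M * norm (x - y)" for x y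
    unfolding g_def
  proof (rule est)
    show "norm (q (x + z) - q (y + z)) \<le> M * norm (x - y)" for z
      using lip[of "x + z" "y + z"] by simp
  qed (rule contsh)+
  moreover have "norm (g x - q x) \<le> M * e" for x
  proof -
    have "q x = (\<integral>z. w z *\<^sub>R q x \<partial>lborel)" using w1 wi by simp
    moreover have "norm ((\<integral>z. w z *\<^sub>R q (x + z) \<partial>lborel) - (\<integral>z. w z *\<^sub>R q x \<partial>lborel)) \<le> M * e"
    proof (rule est)
      show "norm (q (x + z) - q x) \<le> M * e" if "norm z \<le> e" for z
        using lip[of "x + z" x] mult_left_mono[OF that M] by simp
    qed (use contsh in auto)
    ultimately show ?thesis unfolding g_def by simp
  qed
  moreover have "\<exists>g'. (g has_derivative g') (at x0)" for x0
  proof -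
    \<comment> \<open>For x within 1 of x0 the support of the kernel about x stays in one fixed box;
      the Leibniz rule needs such a compact domain of integration.\<close>
    obtain b :: 'a where b: "cball x0 (1 + e) \<subseteq> cbox (- b) b"
      using bounded_subset_cbox_symmetric[OF bounded_cball] by blast
    let ?f = "\<lambda>x y. (bump e (y - x) / c) *\<^sub>R q y"
    let ?fx = "\<lambda>x y. blinfun_scaleR_left (q y) o\<^sub>L ((4 * max 0 (e\<^sup>2 - (y - x) \<bullet> (y - x)) / c) *\<^sub>R blinfun_inner_left (y - x))"
    have geq: "integral (cbox (- b) b) (?f x) = g x" if x: "x \<in> ball x0 1" for x
    proof -
      have si: "set_integrable lborel (cbox (- b) b) (?f x)"
        unfolding set_integrable_def using c
        by (intro borel_integrable_compact compact_cbox continuous_intros contq) auto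
      have "integral (cbox (- b) b) (?f x) = (\<integral>y. indicator (cbox (- b) b) y *\<^sub>R ?f x y \<partial>lborel)"
        using set_borel_integral_eq_integral(2)[OF si] by (simp add: set_lebesgue_integral_def)
      also have "\<dots> = (\<integral>y. ?f x y \<partial>lborel)"
      proof (intro Bochner_Integration.integral_cong refl)
        fix y
        have "y \<in> cbox (- b) b" if "bump e (y - x) \<noteq> 0"
        proof -
          have "norm (y - x) \<le> e" using that bump_eq_0[of e "y - x"] e by linarith
          then have "dist x0 y \<le> 1 + e" using x dist_triangle[of x0 y x] by (simp add: dist_norm norm_minus_commute)
          then show ?thesis using b by auto
        qed
        then show "indicator (cbox (- b) b) y *\<^sub>R ?f x y = ?f x y" by (auto simp: indicator_def)
      qed
      also have "\<dots> = (\<integral>y. ?f x y \<partial>distr lborel borel ((+) x))" by (simp add: lborel_distr_plus)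
      also have "\<dots> = (\<integral>z. ?f x (x + z) \<partial>lborel)"
      proof (rule integral_distr)
        have "continuous_on UNIV (?f x)" using c by (intro continuous_intros contq) auto
        then show "?f x \<in> borel_measurable borel" by (rule borel_measurable_continuous_onI)
      qed simp
      finally show ?thesis by (simp add: g_def w_def)
    qed
    have aw: "at x0 within ball x0 1 = at x0" by (rule at_within_open) auto
    have "((\<lambda>x. integral (cbox (- b) b) (?f x)) has_derivative integral (cbox (- b) b) (?fx x0)) (at x0 within ball x0 1)"
    proof (rule leibniz_rule)
      fix x y
      have "((\<lambda>x. (bump e (y - x) / c) *\<^sub>R q y) has_derivative
         (\<lambda>h. (4 * max 0 (e\<^sup>2 - (y - x) \<bullet> (y - x)) * ((y - x) \<bullet> h) / c) *\<^sub>R q y)) (at x within ball x0 1)"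
        by (intro has_derivative_scaleR_left bounded_linear.has_derivative[OF bounded_linear_divide has_derivative_bump])
      then show "((\<lambda>x. ?f x y) has_derivative blinfun_apply (?fx x y)) (at x within ball x0 1)"
        by (rule has_derivative_eq_rhs) (auto simp: fun_eq_iff blinfun.scaleR_left inner_commute)
    next
      fix x
      show "?f x integrable_on cbox (- b) b"
        using c by (intro integrable_continuous continuous_intros contq) auto
    next
      let ?U = "ball x0 1 \<times> cbox (- b) b"
      have 1: "continuous_on ?U (\<lambda>z. blinfun_scaleR_left (q (snd z)))"
        by (intro bounded_linear.continuous_on[OF bounded_linear_blinfun_scaleR_left]
            continuous_on_compose2[OF contq[of UNIV] continuous_on_snd[OF continuous_on_id]]) auto
      have 2: "continuous_on ?U (\<lambda>z. blinfun_inner_left (snd z - fst z))"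
        by (intro bounded_linear.continuous_on[OF bounded_linear_blinfun_inner_left] continuous_intros)
      have 3: "continuous_on ?U (\<lambda>z. 4 * max 0 (e\<^sup>2 - (snd z - fst z) \<bullet> (snd z - fst z)) / c)"
        by (intro continuous_intros) (use c in auto)
      show "continuous_on ?U (\<lambda>(x, y). ?fx x y)"
        unfolding split_def
        by (rule bounded_bilinear.continuous_on[OF bounded_bilinear_blinfun_compose 1 continuous_on_scaleR[OF 3 2]])
    qed simp_all
    then have "((\<lambda>x. integral (cbox (- b) b) (?f x)) has_derivative integral (cbox (- b) b) (?fx x0)) (at x0)"
      by (simp only: aw)
    then have "(g has_derivative integral (cbox (- b) b) (?fx x0)) (at x0)"
      by (rule has_derivative_transform_within_open[of _ _ _ _ "ball x0 1"]) (use geq in auto)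
    then show ?thesis by blast
  qed
  ultimately show ?thesis using that by metis
qed

section \<open>Lipschitz perturbations of the identity as homeomorphisms\<close>

locale perturbed_identity =
  fixes q :: "'a::euclidean_space \<Rightarrow> 'a" and M t :: real
  assumes lip: "\<And>x y. norm (q x - q y) \<le> M * norm (x - y)" and M: "0 \<le> M" and t: "\<bar>t\<bar> * M < 1"
begin

definition "T x = x + t *\<^sub>R q x"

definition "W = inv_into UNIV T"

lemma expand: "(1 - \<bar>t\<bar> * M) * norm (x - y) \<le> norm (T x - T y)"
proof -
  have "norm (x - y) = norm ((T x - T y) - t *\<^sub>R (q x - q y))" by (simp add: T_def algebra_simps)
  also have "\<dots> \<le> norm (T x - T y) + \<bar>t\<bar> * norm (q x - q y)"
    using norm_triangle_ineq4[of "T x - T y" "t *\<^sub>R (q x - q y)"] by simp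
  also have "\<bar>t\<bar> * norm (q x - q y) \<le> \<bar>t\<bar> * (M * norm (x - y))" by (intro mult_left_mono lip) auto
  finally show ?thesis by (simp add: algebra_simps)
qed

text \<open>The factor 2 bounds 1 + |t| M and is free of t and M.\<close>

lemma contract: "norm (T x - T y) \<le> 2 * norm (x - y)"
proof -
  have "norm (T x - T y) = norm ((x - y) + t *\<^sub>R (q x - q y))" by (simp add: T_def algebra_simps)
  also have "\<dots> \<le> norm (x - y) + \<bar>t\<bar> * norm (q x - q y)"
    using norm_triangle_ineq[of "x - y" "t *\<^sub>R (q x - q y)"] by simp
  also have "\<bar>t\<bar> * norm (q x - q y) \<le> \<bar>t\<bar> * (M * norm (x - y))" by (intro mult_left_mono lip) auto
  also have "\<dots> \<le> 1 * norm (x - y)" using t by (simp only: mult.assoc[symmetric]) (intro mult_right_mono, auto)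
  finally show ?thesis by simp
qed

lemma inj_T: "inj T"
proof (rule injI)
  fix x y assume "T x = T y"
  then have "(1 - \<bar>t\<bar> * M) * norm (x - y) \<le> 0" using expand[of x y] by simp
  then show "x = y" using t by (simp add: mult_le_0_iff)
qed

text \<open>T x = y is the fixed point equation x = y - t q(x), whose right-hand side is a
  contraction with factor |t| M.\<close>

lemma surj_T: "surj T"
proof -
  have "\<exists>x. T x = y" for y
  proof -
    have "\<exists>!x. y - t *\<^sub>R q x = x"
    proof (rule banach_fix_type[where c = "\<bar>t\<bar> * M"])
      show "\<forall>x z. dist (y - t *\<^sub>R q x) (y - t *\<^sub>R q z) \<le> \<bar>t\<bar> * M * dist x z"
      proof (intro allI)
        fix x z
        have "dist (y - t *\<^sub>R q x) (y - t *\<^sub>R q z) = \<bar>t\<bar> * norm (q z - q x)"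
          by (simp add: dist_norm flip: scaleR_diff_right)
        also have "\<dots> \<le> \<bar>t\<bar> * (M * norm (z - x))" by (intro mult_left_mono lip) auto
        finally show "dist (y - t *\<^sub>R q x) (y - t *\<^sub>R q z) \<le> \<bar>t\<bar> * M * dist x z"
          by (simp add: dist_norm norm_minus_commute mult.assoc)
      qed
    qed (use t M in auto)
    then obtain x where "y - t *\<^sub>R q x = x" by blast
    then have "T x = y" by (metis T_def diff_add_cancel)
    then show ?thesis by blast
  qed
  then show ?thesis unfolding surj_def by metis
qed

lemma T_inv: "T (W y) = y"
  unfolding W_def by (rule surj_f_inv_f[OF surj_T])

lemma inv_T: "W (T x) = x"
  unfolding W_def by (rule inv_f_f[OF inj_T])

lemma inv_lip: "norm (W y - W z) \<le> norm (y - z) / (1 - \<bar>t\<bar> * M)"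
  using expand[of "W y" "W z"] t by (simp add: T_inv pos_le_divide_eq mult.commute)

lemma continuous_on_T: "continuous_on S T"
  by (rule lipschitz_on_continuous_on[of 2]) (auto simp: lipschitz_on_def dist_norm contract)

lemma continuous_on_inv_T: "continuous_on S (W)"
proof (rule lipschitz_on_continuous_on[of "1 / (1 - \<bar>t\<bar> * M)"])
  show "lipschitz_on (1 / (1 - \<bar>t\<bar> * M)) S (W)"
    using t inv_lip by (auto simp: lipschitz_on_def dist_norm)
qed

lemma image_T_eq: "T ` A = W -` A"
  by (auto simp: inv_T image_iff) (metis T_inv)

lemma borel_image_T: "A \<in> sets borel \<Longrightarrow> T ` A \<in> sets borel"
  unfolding image_T_eq
  using measurable_sets[OF borel_measurable_continuous_onI[OF continuous_on_inv_T], of A] by simp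

lemma bounded_image_T: "bounded A \<Longrightarrow> bounded (T ` A)"
  using bounded_subset[OF compact_imp_bounded[OF compact_continuous_image[OF continuous_on_T compact_closure[THEN iffD2]]]]
  by (meson closure_subset image_mono)

lemma negligible_image_T: "negligible A \<Longrightarrow> negligible (T ` A)"
  by (rule negligible_locally_Lipschitz_image[of A T])
    (auto intro!: exI[of _ UNIV] exI[of _ 2] contract)

end

text \<open>A point y lies in the image of S iff its preimage lies in S, and the inverse maps
  converge pointwise. Membership is therefore eventually constant unless the limit preimage is on
  the frontier of S; those y form the Lipschitz image of a null set. All images stay in one ball, so
  dominated convergence applies.\<close>

lemma measure_perturbed_image_tendsto:
  fixes q :: "'a::euclidean_space \<Rightarrow> 'a"
  assumes pq: "perturbed_identity q M t" and pg: "\<And>n. perturbed_identity (g n) M t"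
    and conv: "\<And>n x. norm (g n x - q x) \<le> \<epsilon> n" "\<epsilon> \<longlonglongrightarrow> 0"
    and S: "bounded S" "negligible (frontier S)"
    and meas: "\<And>n. (\<lambda>x. x + t *\<^sub>R g n x) ` S \<in> sets borel" "(\<lambda>x. x + t *\<^sub>R q x) ` S \<in> sets borel"
  shows "(\<lambda>n. measure lebesgue ((\<lambda>x. x + t *\<^sub>R g n x) ` S)) \<longlonglongrightarrow> measure lebesgue ((\<lambda>x. x + t *\<^sub>R q x) ` S)"
proof -
  interpret q: perturbed_identity q M t by fact
  interpret g: perturbed_identity "g n" M t for n by fact
  let ?c = "1 - \<bar>t\<bar> * M"
  have c: "0 < ?c" using q.t by simp
  have Tq: "(\<lambda>x. x + t *\<^sub>R q x) = q.T" by (simp add: fun_eq_iff q.T_def)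
  have Tg: "(\<lambda>x. x + t *\<^sub>R g n x) = g.T n" for n by (simp add: fun_eq_iff g.T_def)
  have inv_conv: "(\<lambda>n. g.W n y) \<longlonglongrightarrow> q.W y" for y
  proof (rule LIM_zero_cancel, rule Lim_null_comparison)
    show "\<forall>\<^sub>F n in sequentially. norm (g.W n y - q.W y) \<le> \<bar>t\<bar> * \<epsilon> n / ?c"
    proof (intro always_eventually allI)
      fix n
      let ?x = "q.W y" and ?z = "g.W n y"
      \<comment> \<open>\<open>?x\<close> and \<open>?z\<close> have the same image y under the two
        maps, so the expansion property of \<open>g.T n\<close> compares them through the difference
        of the maps at \<open>?x\<close> alone.\<close>
      have "?c * norm (?z - ?x) \<le> norm (g.T n ?z - g.T n ?x)" by (rule g.expand)
      also have "g.T n ?z - g.T n ?x = q.T ?x - g.T n ?x" by (simp add: g.T_inv q.T_inv)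
      also have "norm \<dots> = \<bar>t\<bar> * norm (g n ?x - q ?x)"
        by (simp add: q.T_def g.T_def norm_minus_commute flip: scaleR_diff_right)
      also have "\<dots> \<le> \<bar>t\<bar> * \<epsilon> n" by (intro mult_left_mono conv) auto
      finally show "norm (?z - ?x) \<le> \<bar>t\<bar> * \<epsilon> n / ?c" using c by (simp add: pos_le_divide_eq mult.commute)
    qed
    have "(\<lambda>n. \<bar>t\<bar> * \<epsilon> n / ?c) \<longlonglongrightarrow> \<bar>t\<bar> * 0 / ?c" by (intro tendsto_intros conv) (use c in simp)
    then show "(\<lambda>n. \<bar>t\<bar> * \<epsilon> n / ?c) \<longlonglongrightarrow> 0" by simp
  qed
  obtain D where D: "S \<subseteq> cball 0 D" using bounded_subset_cball0E[OF S(1)] by blast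
  obtain E where E: "\<And>n. \<bar>\<epsilon> n\<bar> \<le> E"
    using convergent_imp_Bseq[OF convergentI[OF conv(2)]] unfolding Bseq_def by auto
  obtain B where B: "q.T ` S \<subseteq> cball 0 B" using bounded_subset_cball0E[OF q.bounded_image_T[OF S(1)]] by blast
  let ?Q = "cball (0::'a) (\<bar>B\<bar> + \<bar>t\<bar> * E)"
  have sub: "g.T n ` S \<subseteq> ?Q" for n
  proof
    fix y assume "y \<in> g.T n ` S"
    then obtain x where x: "x \<in> S" "y = g.T n x" by blast
    have "norm y \<le> norm (q.T x) + norm (g.T n x - q.T x)"
      using norm_triangle_ineq[of "q.T x" "g.T n x - q.T x"] x by simp
    also have "norm (q.T x) \<le> \<bar>B\<bar>" using B x by force
    also have "norm (g.T n x - q.T x) = \<bar>t\<bar> * norm (g n x - q x)"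
      by (simp add: q.T_def g.T_def flip: scaleR_diff_right)
    also have "\<dots> \<le> \<bar>t\<bar> * E" using conv(1)[of n x] E[of n] by (intro mult_left_mono) auto
    finally show "y \<in> ?Q" by simp
  qed
  have "(\<lambda>n. \<integral>y. indicator (g.T n ` S) y \<partial>lebesgue) \<longlonglongrightarrow> (\<integral>y. (indicator (q.T ` S) y :: real) \<partial>lebesgue)"
  proof (rule integral_dominated_convergence[where w = "indicator ?Q"])
    show "integrable lebesgue (indicator ?Q :: 'a \<Rightarrow> real)"
      using lmeasurable_cball[of "0::'a" "\<bar>B\<bar> + \<bar>t\<bar> * E"] by (auto simp: fmeasurable_def less_top)
    show "indicator (q.T ` S) \<in> borel_measurable lebesgue" "indicator (g.T n ` S) \<in> borel_measurable lebesgue" for n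
      using meas unfolding Tq Tg by (auto intro!: borel_measurable_indicator)
    show "AE y in lebesgue. norm (indicator (g.T n ` S) y :: real) \<le> indicator ?Q y" for n
      by (intro AE_I2) (use sub[of n] in \<open>auto simp: indicator_def\<close>)
    have "AE y in lebesgue. y \<notin> q.T ` frontier S"
      by (rule AE_I'[of "q.T ` frontier S"])
        (use q.negligible_image_T[OF S(2)] in \<open>auto simp: negligible_iff_null_sets\<close>)
    then show "AE y in lebesgue. (\<lambda>n. indicator (g.T n ` S) y) \<longlonglongrightarrow> (indicator (q.T ` S) y :: real)"
    proof eventually_elim
      case (elim y)
      let ?x = "q.W y"
      have x: "?x \<notin> frontier S" using elim q.T_inv[of y] by (metis imageI)
      have m: "y \<in> q.T ` S \<longleftrightarrow> ?x \<in> S" "\<And>n. y \<in> g.T n ` S \<longleftrightarrow> g.W n y \<in> S"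
        by (auto simp: q.image_T_eq g.image_T_eq)
      have "\<forall>\<^sub>F n in sequentially. g.W n y \<in> S \<longleftrightarrow> ?x \<in> S"
      proof (cases "?x \<in> interior S")
        case True
        then have "\<forall>\<^sub>F n in sequentially. g.W n y \<in> interior S"
          using topological_tendstoD[OF inv_conv] by blast
        then show ?thesis by eventually_elim (use True interior_subset in blast)
      next
        case False
        then have "?x \<in> - closure S" using x by (simp add: frontier_def)
        then have "\<forall>\<^sub>F n in sequentially. g.W n y \<in> - closure S"
          using topological_tendstoD[OF inv_conv] by (metis open_Compl closed_closure)
        then show ?thesis
          by eventually_elim (use \<open>?x \<in> - closure S\<close> closure_subset in blast)
      qed
      then have "\<forall>\<^sub>F n in sequentially. indicator (g.T n ` S) y = (indicator (q.T ` S) y :: real)"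
        by eventually_elim (simp add: indicator_def m)
      then show ?case by (rule tendsto_eventually)
    qed
  qed
  then show ?thesis unfolding Tq Tg by simp
qed

lemma perturbed_identityI:
  assumes "\<And>x y. norm (q x - q y) \<le> M * norm (x - y)" "0 \<le> M" "\<bar>t\<bar> * M < 1"
  shows "perturbed_identity q M t"
  using assms by unfold_locales

text \<open>The mollified maps fall under the differentiable case on compact boxes, and the limit is
  taken in the interpolation identity. The result is passed on to open boxes, which generate the
  Borel sets and are closed under intersection, as the Dynkin argument requires.\<close>

lemma measure_perturbed_box_polynomial:
  fixes q :: "'a::euclidean_space \<Rightarrow> 'a"
  assumes lip: "\<And>x y. norm (q x - q y) \<le> M * norm (x - y)" and M: "0 \<le> M"
  shows "polynomial_on DIM('a) {t. \<bar>t\<bar> * M < 1} (\<lambda>t. measure lebesgue ((\<lambda>x. x + t *\<^sub>R q x) ` box a b))"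
proof -
  let ?I = "{t. \<bar>t\<bar> * M < 1}"
  obtain X where X: "finite X" "card X = Suc DIM('a)" "X \<subseteq> ?I"
    using infinite_obtain_nodes[OF infinite_perturbation_range[OF M]] by blast
  have "\<exists>g. (\<exists>g'. \<forall>x. (g has_derivative g' x) (at x)) \<and> (\<forall>x y. norm (g x - g y) \<le> M * norm (x - y)) \<and>
      (\<forall>x. norm (g x - q x) \<le> M * (1 / real (Suc n)))" for n
    by (rule lipschitz_mollify[OF lip, of "1 / real (Suc n)"]) auto
  then obtain g where g: "\<And>n. \<exists>g'. \<forall>x. (g n has_derivative g' x) (at x)" "\<And>n x y. norm (g n x - g n y) \<le> M * norm (x - y)"
    "\<And>n x. norm (g n x - q x) \<le> M * (1 / real (Suc n))"
    by metis
  have lim: "(\<lambda>n. measure lebesgue ((\<lambda>x. x + t *\<^sub>R g n x) ` cbox a b)) \<longlonglongrightarrow> measure lebesgue ((\<lambda>x. x + t *\<^sub>R q x) ` cbox a b)"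
    if t: "t \<in> ?I" for t
  proof (rule measure_perturbed_image_tendsto)
    show pq: "perturbed_identity q M t" by (rule perturbed_identityI) (use lip M t in auto)
    show pg: "perturbed_identity (g n) M t" for n by (rule perturbed_identityI) (use g M t in auto)
    show "norm (g n x - q x) \<le> M * (1 / real (Suc n))" for n x by (rule g)
    have "(\<lambda>n. M * (1 / real (Suc n))) \<longlonglongrightarrow> M * 0"
      by (intro tendsto_mult tendsto_const lim_1_over_real_power[of 1, simplified, THEN LIMSEQ_Suc] LIMSEQ_Suc[OF lim_1_over_n])
    then show "(\<lambda>n. M * (1 / real (Suc n))) \<longlonglongrightarrow> 0" by simp
    show "negligible (frontier (cbox a b))" by (intro negligible_convex_frontier convex_box)
    show "(\<lambda>x. x + t *\<^sub>R g n x) ` cbox a b \<in> sets borel" for n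
      using perturbed_identity.borel_image_T[OF pg, of "cbox a b" n] perturbed_identity.T_def[OF pg, of n]
      by (simp add: fun_eq_iff[of "perturbed_identity.T _ _"] cong: image_cong)
    show "(\<lambda>x. x + t *\<^sub>R q x) ` cbox a b \<in> sets borel"
      using perturbed_identity.borel_image_T[OF pq, of "cbox a b"] perturbed_identity.T_def[OF pq]
      by (simp cong: image_cong)
  qed (rule bounded_cbox)
  have cb: "measure lebesgue ((\<lambda>x. x + t *\<^sub>R q x) ` cbox a b) =
     (\<Sum>u\<in>X. poly (lagrange_basis X u) t * measure lebesgue ((\<lambda>x. x + u *\<^sub>R q x) ` cbox a b))" if t: "t \<in> ?I" for t
  proof (rule LIMSEQ_unique[OF lim[OF t]])
    have "measure lebesgue ((\<lambda>x. x + t *\<^sub>R g n x) ` cbox a b) =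
      (\<Sum>u\<in>X. poly (lagrange_basis X u) t * measure lebesgue ((\<lambda>x. x + u *\<^sub>R g n x) ` cbox a b))" for n
    proof -
      obtain g' where "\<And>x. (g n has_derivative g' x) (at x)" using g(1) by blast
      from measure_perturbed_image_differentiable[OF this g(2) compact_cbox M]
      show ?thesis unfolding polynomial_on_iff_lagrange[OF X] using t by blast
    qed
    then show "(\<lambda>n. measure lebesgue ((\<lambda>x. x + t *\<^sub>R g n x) ` cbox a b)) \<longlonglongrightarrow>
      (\<Sum>u\<in>X. poly (lagrange_basis X u) t * measure lebesgue ((\<lambda>x. x + u *\<^sub>R q x) ` cbox a b))"
      by (simp only:) (intro tendsto_sum tendsto_mult tendsto_const lim, use X in auto)
  qed
  \<comment> \<open>The boundary of the box is null, and so is its image under a Lipschitz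
    map.\<close>
  have bx: "measure lebesgue ((\<lambda>x. x + t *\<^sub>R q x) ` box a b) = measure lebesgue ((\<lambda>x. x + t *\<^sub>R q x) ` cbox a b)"
    if t: "t \<in> ?I" for t
  proof -
    interpret perturbed_identity q M t by (rule perturbed_identityI) (use lip M t in auto)
    have T: "(\<lambda>x. x + t *\<^sub>R q x) = T" by (simp add: fun_eq_iff T_def)
    have "negligible (cbox a b - box a b)"
      by (rule negligible_subset[OF negligible_frontier_interval[of a b]]) simp
    then have n: "negligible (T ` (cbox a b - box a b))" by (rule negligible_image_T)
    have "T ` cbox a b = T ` box a b \<union> T ` (cbox a b - box a b)" using box_subset_cbox[of a b] by blast
    then show ?thesis unfolding T using n
      by (metis measure_negligible_symdiff negligible_subset measure_Un_null_set borel_image_T box_borel negligible_iff_null_sets sets_completionI_sets sets_lborel)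
  qed
  show ?thesis unfolding polynomial_on_iff_lagrange[OF X]
  proof
    fix t assume t: "t \<in> ?I"
    have "(\<Sum>u\<in>X. poly (lagrange_basis X u) t * measure lebesgue ((\<lambda>x. x + u *\<^sub>R q x) ` box a b)) =
      (\<Sum>u\<in>X. poly (lagrange_basis X u) t * measure lebesgue ((\<lambda>x. x + u *\<^sub>R q x) ` cbox a b))"
      by (intro sum.cong refl) (subst bx, use X in auto)
    then show "measure lebesgue ((\<lambda>x. x + t *\<^sub>R q x) ` box a b) =
      (\<Sum>u\<in>X. poly (lagrange_basis X u) t * measure lebesgue ((\<lambda>x. x + u *\<^sub>R q x) ` box a b))"
      using cb[OF t] bx[OF t] by simp
  qed
qed

text \<open>Passing from boxes to Borel sets is a Dynkin system argument for the (signed) Lagrange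
  interpolation identity.\<close>

lemma measure_perturbed_borel_polynomial:
  fixes q :: "'a::euclidean_space \<Rightarrow> 'a"
  assumes lip: "\<And>x y. norm (q x - q y) \<le> M * norm (x - y)" and M: "0 \<le> M"
    and S: "S \<in> sets borel" "bounded S"
  shows "polynomial_on DIM('a) {t. \<bar>t\<bar> * M < 1} (\<lambda>t. measure lebesgue ((\<lambda>x. x + t *\<^sub>R q x) ` S))"
proof -
  let ?I = "{t. \<bar>t\<bar> * M < 1}"
  let ?T = "\<lambda>t x. x + t *\<^sub>R q x"
  obtain X where X: "finite X" "card X = Suc DIM('a)" "X \<subseteq> ?I"
    using infinite_obtain_nodes[OF infinite_perturbation_range[OF M]] by blast
  \<comment> \<open>Intersecting everything with one bounded box keeps all measures finite, so that
    complements can be handled by subtraction.\<close>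
  obtain c where c: "S \<subseteq> box (- c) c" using bounded_subset_box_symmetric[OF S(2)] by blast
  let ?Q = "box (- c) c"
  have pid: "perturbed_identity q M t" if "t \<in> ?I" for t
    by (rule perturbed_identityI) (use lip M that in auto)
  have T: "?T t = perturbed_identity.T q t" if "t \<in> ?I" for t
    using perturbed_identity.T_def[OF pid[OF that]] by (simp add: fun_eq_iff)
  have borelT: "?T t ` A \<in> sets borel" if "t \<in> ?I" "A \<in> sets borel" for t A
    unfolding T[OF that(1)] by (rule perturbed_identity.borel_image_T[OF pid[OF that(1)] that(2)])
  have inj: "inj (?T t)" if "t \<in> ?I" for t
    using perturbed_identity.inj_T[OF pid[OF that]] T[OF that] by simp
  have fin: "?T t ` (A \<inter> ?Q) \<in> lmeasurable" if "t \<in> ?I" "A \<in> sets borel" for t A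
  proof -
    have "bounded (?T t ` (A \<inter> ?Q))"
      unfolding T[OF that(1)]
      by (rule perturbed_identity.bounded_image_T[OF pid[OF that(1)]]) (simp add: bounded_Int)
    moreover have "?T t ` (A \<inter> ?Q) \<in> sets lebesgue" using borelT[OF that(1), of "A \<inter> ?Q"] that(2) by simp
    ultimately show ?thesis by (rule bounded_set_imp_lmeasurable)
  qed
  define m where "m t A = measure lebesgue (?T t ` (A \<inter> ?Q))" for t A
  define P where "P A \<longleftrightarrow> (\<forall>t\<in>?I. m t A = (\<Sum>u\<in>X. poly (lagrange_basis X u) t * m u A))" for A
  have mQ: "P UNIV"
    using measure_perturbed_box_polynomial[OF lip M, of "- c" c]
    unfolding polynomial_on_iff_lagrange[OF X] P_def m_def by simp
  have "Int_stable (range (\<lambda>(a, b). box a (b :: 'a)))"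
    unfolding Int_stable_def by (auto simp: box_Int_box)
  moreover have "range (\<lambda>(a, b). box a (b :: 'a)) \<subseteq> Pow UNIV" by simp
  moreover have "S \<in> sigma_sets UNIV (range (\<lambda>(a, b). box a (b :: 'a)))"
    using S(1) unfolding borel_eq_box by simp
  ultimately have "P S"
  proof (induction rule: sigma_sets_induct_disjoint)
    fix A assume "A \<in> range (\<lambda>(a, b). box a (b :: 'a))"
    then obtain a b where A: "A = box a b" by auto
    have "\<exists>a' b'. A \<inter> ?Q = box a' b'" unfolding A box_Int_box by blast
    then obtain a' b' where "A \<inter> ?Q = box a' b'" by blast
    then show "P A"
      using measure_perturbed_box_polynomial[OF lip M, of a' b']
      unfolding polynomial_on_iff_lagrange[OF X] P_def m_def by simp
  next
    show "P {}" by (simp add: P_def m_def)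
  next
    fix A assume A: "A \<in> sigma_sets UNIV (range (\<lambda>(a, b). box a (b :: 'a)))" "P A"
    then have Ab: "A \<in> sets borel" unfolding borel_eq_box by simp
    have d: "m t (UNIV - A) = m t UNIV - m t A" if "t \<in> ?I" for t
    proof -
      have "?T t ` ((UNIV - A) \<inter> ?Q) = ?T t ` (UNIV \<inter> ?Q) - ?T t ` (A \<inter> ?Q)"
        using inj[OF that] by (auto simp: inj_def)
      then show ?thesis unfolding m_def
        using measurable_measure_Diff[OF fin[OF that, of UNIV] fmeasurableD[OF fin[OF that Ab]]] by auto
    qed
    show "P (UNIV - A)" unfolding P_def
    proof
      fix t assume t: "t \<in> ?I"
      have "m t (UNIV - A) = (\<Sum>u\<in>X. poly (lagrange_basis X u) t * m u UNIV) - (\<Sum>u\<in>X. poly (lagrange_basis X u) t * m u A)"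
        using d[OF t] mQ A(2) t unfolding P_def by simp
      also have "\<dots> = (\<Sum>u\<in>X. poly (lagrange_basis X u) t * (m u UNIV - m u A))"
        by (simp add: right_diff_distrib sum_subtractf)
      also have "\<dots> = (\<Sum>u\<in>X. poly (lagrange_basis X u) t * m u (UNIV - A))"
        by (intro sum.cong refl) (subst d, use X in auto)
      finally show "m t (UNIV - A) = (\<Sum>u\<in>X. poly (lagrange_basis X u) t * m u (UNIV - A))" .
    qed
  next
    fix A :: "nat \<Rightarrow> 'a set"
    assume d: "disjoint_family A" and r: "range A \<subseteq> sigma_sets UNIV (range (\<lambda>(a, b). box a (b :: 'a)))"
      and PA: "\<And>i. P (A i)"
    have Ab: "A i \<in> sets borel" for i using r unfolding borel_eq_box by auto
    have U: "(\<lambda>i. m t (A i)) sums m t (\<Union>i. A i)" if t: "t \<in> ?I" for t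
    proof -
      have eq: "?T t ` ((\<Union>i. A i) \<inter> ?Q) = (\<Union>i. ?T t ` (A i \<inter> ?Q))" by blast
      have "(\<lambda>i. measure lebesgue (?T t ` (A i \<inter> ?Q))) sums measure lebesgue (\<Union>i. ?T t ` (A i \<inter> ?Q))"
      proof (rule measure_UNION)
        show "range (\<lambda>i. ?T t ` (A i \<inter> ?Q)) \<subseteq> sets lebesgue" using fin[OF t Ab] by auto
        show "disjoint_family (\<lambda>i. ?T t ` (A i \<inter> ?Q))"
          using d inj[OF t] unfolding disjoint_family_on_def inj_def by blast
        have "(\<Union>i. ?T t ` (A i \<inter> ?Q)) \<in> lmeasurable"
          unfolding eq[symmetric] by (rule fin[OF t]) (use Ab in auto)
        then show "emeasure lebesgue (\<Union>i. ?T t ` (A i \<inter> ?Q)) \<noteq> \<infinity>" by (auto simp: fmeasurable_def)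
      qed
      then show ?thesis unfolding m_def eq .
    qed
    show "P (\<Union>i. A i)" unfolding P_def
    proof
      fix t assume t: "t \<in> ?I"
      have "(\<lambda>i. \<Sum>u\<in>X. poly (lagrange_basis X u) t * m u (A i)) sums (\<Sum>u\<in>X. poly (lagrange_basis X u) t * m u (\<Union>i. A i))"
        by (intro sums_sum sums_mult U) (use X in auto)
      moreover have "(\<Sum>u\<in>X. poly (lagrange_basis X u) t * m u (A i)) = m t (A i)" for i
        using PA t unfolding P_def by simp
      ultimately show "m t (\<Union>i. A i) = (\<Sum>u\<in>X. poly (lagrange_basis X u) t * m u (\<Union>i. A i))"
        using U[OF t] sums_unique2 by simp
    qed
  qed
  moreover have "S \<inter> ?Q = S" using c by blast
  ultimately show ?thesis unfolding polynomial_on_iff_lagrange[OF X] P_def m_def by simp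
qed

section \<open>The local Steiner formula\<close>

text \<open>McShane's extension: the infimum over y in A of h(y) + L |x - y|. The Lipschitz bound on
  A keeps it finite and, for x in A, makes y = x a minimizer.\<close>

lemma real_lipschitz_extension:
  fixes h :: "'a::real_normed_vector \<Rightarrow> real"
  assumes A: "A \<noteq> {}" and L: "0 \<le> L" and h: "\<And>x y. x \<in> A \<Longrightarrow> y \<in> A \<Longrightarrow> \<bar>h x - h y\<bar> \<le> L * norm (x - y)"
  obtains H where "\<And>x. x \<in> A \<Longrightarrow> H x = h x" "\<And>x y. \<bar>H x - H y\<bar> \<le> L * norm (x - y)"
proof
  define H where "H x = (INF y\<in>A. h y + L * norm (x - y))" for x
  obtain a where a: "a \<in> A" using A by blast
  have bdd: "bdd_below ((\<lambda>y. h y + L * norm (x - y)) ` A)" for x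
  proof (rule bdd_belowI2)
    fix y assume "y \<in> A"
    then have "h a - h y \<le> L * norm (a - y)" using h[OF a] by (metis abs_le_D1)
    also have "\<dots> \<le> L * (norm (x - a) + norm (x - y))"
      using L norm_triangle_ineq4[of "x - y" "x - a"] by (intro mult_left_mono) auto
    finally show "h a - L * norm (x - a) \<le> h y + L * norm (x - y)" by (simp add: distrib_left)
  qed
  show "H x = h x" if x: "x \<in> A" for x
  proof (rule antisym)
    show "H x \<le> h x" unfolding H_def using cINF_lower[OF bdd x, of x] by simp
    show "h x \<le> H x" unfolding H_def
    proof (rule cINF_greatest[OF A])
      fix y assume "y \<in> A"
      then show "h x \<le> h y + L * norm (x - y)" using h[OF x, of y] by (simp add: abs_le_iff)
    qed
  qed
  have le: "H x \<le> H y + L * norm (x - y)" for x y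
  proof -
    have "H x - L * norm (x - y) \<le> H y" unfolding H_def[of y]
    proof (rule cINF_greatest[OF A])
      fix z assume z: "z \<in> A"
      have "H x \<le> h z + L * norm (x - z)" unfolding H_def by (rule cINF_lower[OF bdd z])
      also have "L * norm (x - z) \<le> L * (norm (x - y) + norm (y - z))"
        using L norm_triangle_ineq[of "x - y" "y - z"] by (intro mult_left_mono) auto
      finally show "H x - L * norm (x - y) \<le> h z + L * norm (y - z)" by (simp add: distrib_left)
    qed
    then show ?thesis by simp
  qed
  show "\<bar>H x - H y\<bar> \<le> L * norm (x - y)" for x y
    using le[of x y] le[of y x] by (simp add: abs_le_iff norm_minus_commute)
qed

text \<open>Coordinates are extended one by one, which costs the factor \<open>DIM('b)\<close>; for
  the perturbation argument some Lipschitz constant is enough.\<close>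

lemma lipschitz_extension:
  fixes f :: "'a::real_normed_vector \<Rightarrow> 'b::euclidean_space"
  assumes A: "A \<noteq> {}" and L: "0 \<le> L" and f: "\<And>x y. x \<in> A \<Longrightarrow> y \<in> A \<Longrightarrow> norm (f x - f y) \<le> L * norm (x - y)"
  obtains q where "\<And>x. x \<in> A \<Longrightarrow> q x = f x" "\<And>x y. norm (q x - q y) \<le> (real DIM('b) * L) * norm (x - y)"
proof -
  have "\<exists>H. (\<forall>x\<in>A. H x = f x \<bullet> b) \<and> (\<forall>x y. \<bar>H x - H y\<bar> \<le> L * norm (x - y))" if b: "b \<in> Basis" for b
  proof -
    have "\<bar>f x \<bullet> b - f y \<bullet> b\<bar> \<le> L * norm (x - y)" if "x \<in> A" "y \<in> A" for x y
      using Basis_le_norm[OF b, of "f x - f y"] f[OF that] by (simp add: inner_diff_left)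
    then show ?thesis using real_lipschitz_extension[OF A L, of "\<lambda>x. f x \<bullet> b"] by metis
  qed
  then obtain H where H: "\<And>b x. b \<in> Basis \<Longrightarrow> x \<in> A \<Longrightarrow> H b x = f x \<bullet> b"
    "\<And>b x y. b \<in> Basis \<Longrightarrow> \<bar>H b x - H b y\<bar> \<le> L * norm (x - y)" by metis
  define q where "q x = (\<Sum>b\<in>Basis. H b x *\<^sub>R b)" for x
  have "q x = f x" if "x \<in> A" for x
    unfolding q_def using H(1) that by (simp add: euclidean_representation)
  moreover have "norm (q x - q y) \<le> (real DIM('b) * L) * norm (x - y)" for x y
  proof -
    have "norm (q x - q y) = norm (\<Sum>b\<in>Basis. (H b x - H b y) *\<^sub>R b)"
      by (simp add: q_def scaleR_diff_left sum_subtractf)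
    also have "\<dots> \<le> (\<Sum>b\<in>(Basis :: 'b set). L * norm (x - y))"
      by (rule order_trans[OF norm_sum sum_mono]) (use H(2) in auto)
    finally show ?thesis by simp
  qed
  ultimately show ?thesis using that by blast
qed

text \<open>Two local polynomials agree on a nonempty open set, hence everywhere. The polynomial
  attached to a point is thus a locally constant function on a connected set.\<close>

lemma polynomial_on_patch:
  assumes I: "open I" "connected I"
    and loc: "\<And>t. t \<in> I \<Longrightarrow> \<exists>U. open U \<and> t \<in> U \<and> polynomial_on n (U \<inter> I) g"
  shows "polynomial_on n I g"
proof (cases "I = {}")
  case True
  then show ?thesis unfolding polynomial_on_def by (auto intro!: exI[of _ 0])
next
  case False
  have "\<exists>P U. degree P \<le> n \<and> open U \<and> t \<in> U \<and> (\<forall>x\<in>U \<inter> I. g x = poly P x)" if "t \<in> I" for t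
    using loc[OF that] unfolding polynomial_on_def by blast
  then obtain f U where f: "\<And>t. t \<in> I \<Longrightarrow> degree (f t) \<le> n" "\<And>t. t \<in> I \<Longrightarrow> open (U t)" "\<And>t. t \<in> I \<Longrightarrow> t \<in> U t"
    "\<And>t x. t \<in> I \<Longrightarrow> x \<in> U t \<Longrightarrow> x \<in> I \<Longrightarrow> g x = poly (f t) x"
    by (metis IntI)
  have eq: "f a = f b" if a: "a \<in> I" and b: "b \<in> I" "b \<in> U a" for a b
  proof (rule ccontr)
    assume "f a \<noteq> f b"
    then have "finite {x. poly (f a - f b) x = 0}" by (intro poly_roots_finite) simp
    moreover have "U a \<inter> U b \<inter> I \<subseteq> {x. poly (f a - f b) x = 0}"
    proof
      fix x assume x: "x \<in> U a \<inter> U b \<inter> I"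
      then have "g x = poly (f a) x" "g x = poly (f b) x" using f(4) a b by blast+
      then show "x \<in> {x. poly (f a - f b) x = 0}" by simp
    qed
    moreover have "open (U a \<inter> U b \<inter> I)" using f a b I by auto
    moreover have "b \<in> U a \<inter> U b \<inter> I" using f b by auto
    ultimately show False
      by (metis empty_iff finite_subset finite_imp_not_open)
  qed
  have const: "f a = f b" if "a \<in> I" "b \<in> I" for a b
  proof (rule connected_local_const[OF I(2) that])
    show "\<forall>a\<in>I. \<forall>\<^sub>F b in at a within I. f a = f b"
    proof
      fix a assume a: "a \<in> I"
      have "\<forall>\<^sub>F b in at a within I. b \<in> U a"
        using f(2,3)[OF a] by (auto simp: eventually_at_topological)
      moreover have "\<forall>\<^sub>F b in at a within I. b \<in> I" by (simp add: eventually_at_filter)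
      ultimately show "\<forall>\<^sub>F b in at a within I. f a = f b" by eventually_elim (use eq a in blast)
    qed
  qed
  obtain a where a: "a \<in> I" using False by blast
  show ?thesis unfolding polynomial_on_def
    using f(1)[OF a] f(3,4) const[OF a] by metis
qed

section \<open>Local parallel sets below the reach\<close>

definition normal_pair :: "'a::euclidean_space set \<Rightarrow> 'a \<Rightarrow> 'a \<times> 'a" where
  "normal_pair K x = (closest_point K x, sgn (x - closest_point K x))"

text \<open>This is the set whose measure stands on the left of
  \<open>local_steiner_formula\<close>.\<close>

definition local_parallel :: "'a::euclidean_space set \<Rightarrow> ('a \<times> 'a) set \<Rightarrow> real \<Rightarrow> 'a set" where
  "local_parallel K B t = {x \<in> parallel_set K t - K. normal_pair K x \<in> B}"

lemma infdist_pos_iff: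
  fixes K :: "'a::euclidean_space set"
  assumes "closed K" "K \<noteq> {}"
  shows "0 < infdist x K \<longleftrightarrow> x \<notin> K"
  using in_closed_iff_infdist_zero[OF assms, of x] infdist_nonneg[of x K] by linarith

lemma normal_pair_ray:
  fixes K :: "'a::euclidean_space set"
  assumes K: "closed K" "K \<noteq> {}" and x: "x \<notin> K" "ereal (infdist x K) < reach K" and s: "0 < s" "ereal s < reach K"
  defines "y \<equiv> closest_point K x + s *\<^sub>R sgn (x - closest_point K x)"
  shows "infdist y K = s" "closest_point K y = closest_point K x" "normal_pair K y = normal_pair K x" "y \<notin> K"
proof -
  have d: "0 < infdist x K" using infdist_pos_iff[OF K] x by simp
  have s0: "0 \<le> s" using s by simp
  note * = infdist_ray_reach[OF K d x(2) s0 s(2)]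
  show 1: "infdist y K = s" and 2: "closest_point K y = closest_point K x" using * by (auto simp: y_def)
  have "norm (sgn (x - closest_point K x)) = 1"
    using d closest_point_infdist(2)[OF K, of x] by (auto simp: norm_sgn)
  moreover have "sgn (s *\<^sub>R u) = u" if "norm u = 1" for u :: 'a
    using that s by (simp add: sgn_div_norm)
  ultimately have "sgn (s *\<^sub>R sgn (x - closest_point K x)) = sgn (x - closest_point K x)" by blast
  then show "normal_pair K y = normal_pair K x"
    unfolding normal_pair_def 2 by (simp add: y_def)
  show "y \<notin> K" using 1 s infdist_pos_iff[OF K] by metis
qed

lemma closest_point_decomp:
  fixes K :: "'a::euclidean_space set"
  assumes K: "closed K" "K \<noteq> {}"
  shows "x = closest_point K x + infdist x K *\<^sub>R sgn (x - closest_point K x)"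
proof (cases "x = closest_point K x")
  case False
  then have "norm (x - closest_point K x) \<noteq> 0" by simp
  moreover have "infdist x K = norm (x - closest_point K x)"
    using closest_point_infdist(2)[OF K, of x] by (simp add: dist_norm)
  ultimately show ?thesis by (simp add: sgn_div_norm)
qed simp

lemma local_parallel_borel:
  fixes K :: "'a::euclidean_space set"
  assumes K: "closed K" "K \<noteq> {}" and t: "ereal t < reach K" and B: "B \<in> sets borel"
  shows "local_parallel K B t \<in> sets borel"
proof -
  let ?A = "parallel_set K t - K"
  have A: "?A \<in> sets borel" using closed_parallel_set[of K t] K by auto
  have "?A \<subseteq> unp K"
  proof
    fix x assume "x \<in> ?A"
    then have "ereal (infdist x K) < reach K"
      using t by (metis Diff_iff parallel_set_def mem_Collect_eq ereal_less_eq(3) le_less_trans)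
    then show "x \<in> unp K" by (rule unp_reach)
  qed
  then have cp: "continuous_on ?A (closest_point K)"
    using continuous_on_closest_point_unp[OF K] continuous_on_subset by blast
  have "continuous_on ?A (\<lambda>x. sgn (x - closest_point K x))"
    by (intro continuous_intros cp) (metis Diff_iff right_minus_eq closest_point_infdist(1)[OF K])
  then have "continuous_on ?A (normal_pair K)"
    unfolding normal_pair_def[abs_def] by (intro continuous_on_Pair cp)
  then have "normal_pair K \<in> borel_measurable (restrict_space borel ?A)"
    by (rule borel_measurable_continuous_on_restrict)
  from measurable_sets[OF this B]
  have "normal_pair K -` B \<inter> ?A \<in> sets (restrict_space borel ?A)" by (simp add: space_restrict_space)
  then have "normal_pair K -` B \<inter> ?A \<in> sets borel" using A by (subst (asm) sets_restrict_space_iff) auto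
  moreover have "local_parallel K B t = normal_pair K -` B \<inter> ?A" by (auto simp: local_parallel_def)
  ultimately show ?thesis by simp
qed

text \<open>Moving x to x + \<mu> (x - p(x)) keeps foot point and direction and multiplies the
  distance by 1 + \<mu>, so it carries the local parallel set of radius t0 onto that of radius (1 +
  \<mu>) t0. The displacement x - p(x) is Lipschitz on a parallel set below the reach and is
  extended to the whole space; \<open>measure_perturbed_borel_polynomial\<close> then gives a
  polynomial in \<mu>.\<close>

lemma local_parallel_polynomial_near:
  fixes K :: "'a::euclidean_space set"
  assumes K: "compact K" "K \<noteq> {}" and B: "B \<in> sets borel" and t0: "0 < t0" "ereal t0 < reach K"
  shows "\<exists>\<eta>>0. polynomial_on DIM('a) {t0 * (1 - \<eta>)<..<t0 * (1 + \<eta>)} (\<lambda>t. measure lebesgue (local_parallel K B t))"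
proof -
  note cl = compact_imp_closed[OF K(1)]
  \<comment> \<open>t1 leaves room to enlarge t0 below the reach; r > t1 makes the projection
    Lipschitz on the parallel set of radius t1.\<close>
  obtain t1 where t1: "t0 < t1" "ereal t1 < reach K"
    using ereal_dense2[OF t0(2)] by auto
  obtain r where r: "t1 < r" "ereal r < reach K"
    using ereal_dense2[OF t1(2)] by auto
  define c where "c = 1 - t1 / r"
  have c: "0 < c" using r t1 t0 by (simp add: c_def)
  define A where "A = parallel_set K t1"
  have lip0: "norm ((x - closest_point K x) - (y - closest_point K y)) \<le> (1 + 1 / c) * norm (x - y)"
    if "x \<in> A" "y \<in> A" for x y
  proof -
    have "c * dist (closest_point K x) (closest_point K y) \<le> dist x y"
      unfolding c_def by (rule closest_point_lipschitz_reach[OF cl K(2) _ _ r]) (use that in \<open>auto simp: A_def parallel_set_def\<close>)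
    then have "norm (closest_point K x - closest_point K y) \<le> 1 / c * norm (x - y)"
      using c by (simp add: dist_norm pos_le_divide_eq mult.commute)
    moreover have "norm ((x - closest_point K x) - (y - closest_point K y)) \<le> norm (x - y) + norm (closest_point K x - closest_point K y)"
      using norm_triangle_ineq4[of "x - y" "closest_point K x - closest_point K y"] by (simp add: algebra_simps)
    ultimately show ?thesis by (simp add: distrib_right)
  qed
  obtain x0 where "x0 \<in> K" using K by blast
  then have "x0 \<in> A" using t1 t0 by (simp add: A_def parallel_set_def)
  then have "A \<noteq> {}" by blast
  then obtain q where q: "\<And>x. x \<in> A \<Longrightarrow> q x = x - closest_point K x"
    "\<And>x y. norm (q x - q y) \<le> (real DIM('a) * (1 + 1 / c)) * norm (x - y)"
    using lipschitz_extension[of A "1 + 1 / c" "\<lambda>x. x - closest_point K x"] lip0 c by (metis add_nonneg_nonneg less_imp_le zero_le_divide_1_iff zero_le_one)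
  define M where "M = real DIM('a) * (1 + 1 / c)"
  have M: "0 \<le> M" using c by (simp add: M_def)
  define S where "S = local_parallel K B t0"
  have S: "S \<in> sets borel" "bounded S"
  proof -
    show "S \<in> sets borel" unfolding S_def by (rule local_parallel_borel[OF cl K(2) t0(2) B])
    have "S \<subseteq> parallel_set K t0" by (auto simp: S_def local_parallel_def)
    moreover obtain D where "K \<subseteq> cball 0 D" using bounded_subset_cball0E[OF compact_imp_bounded[OF K(1)]] by blast
    ultimately have "S \<subseteq> cball 0 (D + t0)" using parallel_set_subset_cball[OF cl K(2), of D t0] by blast
    then show "bounded S" by (rule bounded_subset[OF bounded_cball])
  qed
  have im: "(\<lambda>x. x + \<mu> *\<^sub>R q x) ` S = local_parallel K B ((1 + \<mu>) * t0)"
    if \<mu>: "-1 < \<mu>" "(1 + \<mu>) * t0 \<le> t1" for \<mu>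
  proof (intro equalityI subsetI)
    fix y assume "y \<in> (\<lambda>x. x + \<mu> *\<^sub>R q x) ` S"
    then obtain x where x: "x \<in> S" "y = x + \<mu> *\<^sub>R q x" by blast
    have x': "x \<notin> K" "infdist x K \<le> t0" "normal_pair K x \<in> B"
      using x(1) by (auto simp: S_def local_parallel_def parallel_set_def)
    then have d: "0 < infdist x K" using infdist_pos_iff[OF cl K(2)] by blast
    have xr: "ereal (infdist x K) < reach K" using x'(2) t0 by (meson ereal_less_eq(3) le_less_trans)
    let ?s = "(1 + \<mu>) * infdist x K"
    have "?s \<le> (1 + \<mu>) * t0" using x' \<mu> by (intro mult_left_mono) auto
    then have "?s \<le> t1" using \<mu>(2) by (rule order_trans)
    then have sr: "ereal ?s < reach K" using t1(2) by (meson ereal_less_eq(3) le_less_trans)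
    have s: "0 < ?s" "?s \<le> (1 + \<mu>) * t0" using d \<mu> \<open>?s \<le> (1 + \<mu>) * t0\<close> by auto
    have "x \<in> A" using x'(2) t1 by (simp add: A_def parallel_set_def)
    then have "y = x + \<mu> *\<^sub>R (x - closest_point K x)" using x(2) q(1) by simp
    also have "\<dots> = closest_point K x + (1 + \<mu>) *\<^sub>R (x - closest_point K x)" by (simp add: algebra_simps)
    also have "x - closest_point K x = infdist x K *\<^sub>R sgn (x - closest_point K x)"
      using closest_point_decomp[OF cl K(2), of x] by (metis add_diff_cancel_left')
    finally have y: "y = closest_point K x + ?s *\<^sub>R sgn (x - closest_point K x)" by simp
    note n = normal_pair_ray[OF cl K(2) x'(1) xr s(1) sr]
    show "y \<in> local_parallel K B ((1 + \<mu>) * t0)"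
      unfolding local_parallel_def parallel_set_def y using n s x' by simp
  next
    fix y assume y: "y \<in> local_parallel K B ((1 + \<mu>) * t0)"
    have y': "y \<notin> K" "infdist y K \<le> (1 + \<mu>) * t0" "normal_pair K y \<in> B"
      using y by (auto simp: local_parallel_def parallel_set_def)
    then have d: "0 < infdist y K" using infdist_pos_iff[OF cl K(2)] by blast
    have yr: "ereal (infdist y K) < reach K" using y'(2) \<mu>(2) t1 by (meson ereal_less_eq(3) le_less_trans order_trans)
    let ?s = "infdist y K / (1 + \<mu>)"
    have s: "0 < ?s" "?s \<le> t0" using d y' \<mu> by (auto simp: pos_divide_le_eq mult.commute)
    have sr: "ereal ?s < reach K" using s t0 by (meson ereal_less_eq(3) le_less_trans)
    define x where "x = closest_point K y + ?s *\<^sub>R sgn (y - closest_point K y)"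
    note n = normal_pair_ray[OF cl K(2) y'(1) yr s(1) sr, folded x_def]
    have xS: "x \<in> S" using n s y' by (simp add: S_def local_parallel_def parallel_set_def)
    have "x \<in> A" using n s t1 by (simp add: A_def parallel_set_def)
    then have "x + \<mu> *\<^sub>R q x = x + \<mu> *\<^sub>R (x - closest_point K x)" using q(1) by simp
    also have "\<dots> = closest_point K y + (1 + \<mu>) *\<^sub>R (x - closest_point K y)" using n(2) by (simp add: algebra_simps)
    also have "\<dots> = closest_point K y + infdist y K *\<^sub>R sgn (y - closest_point K y)" using \<mu> by (simp add: x_def)
    also have "\<dots> = y" using closest_point_decomp[OF cl K(2), of y] by simp
    finally have e: "y = x + \<mu> *\<^sub>R q x" by (rule sym)
    show "y \<in> (\<lambda>x. x + \<mu> *\<^sub>R q x) ` S" using xS e by (rule rev_image_eqI[of x])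
  qed
  obtain P where P: "degree P \<le> DIM('a)" "\<And>\<mu>. \<bar>\<mu>\<bar> * M < 1 \<Longrightarrow> measure lebesgue ((\<lambda>x. x + \<mu> *\<^sub>R q x) ` S) = poly P \<mu>"
    using measure_perturbed_borel_polynomial[OF q(2)[folded M_def] M S] unfolding polynomial_on_def by auto
  \<comment> \<open>The three bounds on |\<mu>| ensure, in this order, |\<mu>| M < 1, (1 + \<mu>) t0
    <= t1 and \<mu> > -1.\<close>
  define \<eta> where "\<eta> = min (1 / (M + 1)) (min (t1 / t0 - 1) 1)"
  have \<eta>: "0 < \<eta>" "\<eta> \<le> 1 / (M + 1)" "\<eta> \<le> t1 / t0 - 1" "\<eta> \<le> 1" using M t0 t1 by (auto simp: \<eta>_def)
  \<comment> \<open>The substitution \<mu> = t / t0 - 1 returns from the dilation parameter to the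
    radius.\<close>
  define Q where "Q = pcompose P [: - 1, 1 / t0 :]"
  have "degree Q \<le> DIM('a)"
    unfolding Q_def using P(1) by (simp add: degree_pcompose)
  moreover have "measure lebesgue (local_parallel K B t) = poly Q t" if t: "t \<in> {t0 * (1 - \<eta>)<..<t0 * (1 + \<eta>)}" for t
  proof -
    define \<mu> where "\<mu> = t / t0 - 1"
    have tt: "t = (1 + \<mu>) * t0" using t0 by (simp add: \<mu>_def)
    have "t0 * (1 - \<eta>) < t0 * (1 + \<mu>)" "t0 * (1 + \<mu>) < t0 * (1 + \<eta>)" using t tt by (auto simp: mult.commute)
    then have "- \<eta> < \<mu>" "\<mu> < \<eta>" using t0 by auto
    then have m: "\<bar>\<mu>\<bar> < \<eta>" by simp
    then have "\<bar>\<mu>\<bar> < 1 / (M + 1)" using \<eta>(2) by linarith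
    then have "\<bar>\<mu>\<bar> * (M + 1) < 1" using M by (simp add: less_divide_eq)
    then have "\<bar>\<mu>\<bar> * M < 1" by (simp add: distrib_left)
    then have "poly P \<mu> = measure lebesgue ((\<lambda>x. x + \<mu> *\<^sub>R q x) ` S)" using P(2) by simp
    moreover have "(1 + \<mu>) * t0 \<le> t1"
    proof -
      have "(1 + \<mu>) * t0 \<le> (1 + (t1 / t0 - 1)) * t0" using m \<eta>(3) t0 by (intro mult_right_mono) auto
      then show ?thesis using t0 by simp
    qed
    moreover have "-1 < \<mu>" using m \<eta>(4) by simp
    ultimately have "poly P \<mu> = measure lebesgue (local_parallel K B t)" unfolding tt using im by simp
    moreover have "poly Q t = poly P \<mu>" by (simp add: Q_def poly_pcompose \<mu>_def)
    ultimately show ?thesis by simp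
  qed
  ultimately show ?thesis using \<eta>(1) unfolding polynomial_on_def by blast
qed

lemma poly_altdef_le:
  fixes p :: "real poly"
  assumes "degree p \<le> n"
  shows "poly p x = (\<Sum>i\<le>n. poly.coeff p i * x ^ i)"
  unfolding Polynomial.poly_altdef
  by (rule sum.mono_neutral_left) (use assms in \<open>auto simp: coeff_eq_0\<close>)

lemma sum_lessThan_reverse_Suc: "(\<Sum>k<n. f (n - k)) = (\<Sum>k<n. f (Suc k) :: real)" for n :: nat
proof -
  have "(\<Sum>k<n. f (Suc k)) = (\<Sum>k<n. f (Suc (n - Suc k)))" by (rule sum.nat_diff_reindex[symmetric])
  also have "\<dots> = (\<Sum>k<n. f (n - k))" by (intro sum.cong refl) (simp add: Suc_diff_Suc)
  finally show ?thesis by simp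
qed

lemma sum_atMost_split_0: "(\<Sum>j\<le>n. f j) = f 0 + (\<Sum>k<n. f (n - k) :: real)" for n :: nat
  unfolding sum_lessThan_reverse_Suc by (rule sum.atMost_shift)

lemma sets_normal_bundle_space:
  "B \<in> sets (normal_bundle_space :: ('a::euclidean_space \<times> 'a) measure) \<longleftrightarrow> B \<in> sets borel \<and> B \<subseteq> UNIV \<times> sphere 0 1"
proof -
  have "closed ((UNIV :: 'a set) \<times> sphere (0::'a) 1)" by (intro closed_Times) auto
  then show ?thesis unfolding normal_bundle_space_def by (subst sets_restrict_space_iff) auto
qed

lemma unit_ball_vol_nat_neq_0: "unit_ball_vol (real n) \<noteq> 0"
  using unit_ball_vol_pos[of "real n"] by linarith

section \<open>Support measures of a set of positive reach\<close>

locale positive_reach =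
  fixes K :: "'a::euclidean_space set"
  assumes compact: "compact K" and nonempty: "K \<noteq> {}" and reach: "0 < reach K"
begin

lemma closed: "closed K"
  using compact by (rule compact_imp_closed)

definition "I = {t. 0 < t \<and> ereal t < reach K}"

lemma open_I: "open I" and connected_I: "connected I" and infinite_I: "infinite I"
proof -
  have "I = {0<..} \<inter> ereal -` {..<reach K}" by (auto simp: I_def)
  moreover have "open (ereal -` {..<reach K})" by (rule open_vimage[OF open_lessThan continuous_on_ereal[OF continuous_on_id]])
  ultimately show o: "open I" by (simp only: open_Int open_greaterThan)
  show "connected I" unfolding is_interval_connected_1[symmetric] is_interval_1
  proof (intro ballI allI impI)
    fix a b x assume "a \<in> I" "b \<in> I" "a \<le> x \<and> x \<le> b"
    then have x: "0 < x" "ereal x \<le> ereal b" "ereal b < reach K" by (auto simp: I_def)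
    from le_less_trans[OF x(2,3)] x(1) show "x \<in> I" by (simp add: I_def)
  qed
  obtain t where "ereal 0 < ereal t" "ereal t < reach K" using ereal_dense2[of "ereal 0" "reach K"] reach by (auto simp: zero_ereal_def)
  then have "t \<in> I" by (simp add: I_def)
  then show "infinite I" using o finite_imp_not_open by blast
qed

definition "F B t = measure lebesgue (local_parallel K B t)"

lemma local_parallel_lmeasurable:
  assumes "B \<in> sets borel" "t \<in> I"
  shows "local_parallel K B t \<in> lmeasurable"
proof -
  have b: "local_parallel K B t \<in> sets borel"
    using local_parallel_borel[OF closed nonempty _ assms(1)] assms(2) by (simp add: I_def)
  have "local_parallel K B t \<subseteq> parallel_set K t" by (auto simp: local_parallel_def)
  then show ?thesis
    by (rule fmeasurableI2[OF parallel_set_lmeasurable[OF compact nonempty]]) (use b in simp)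
qed

text \<open>The local polynomials are patched over the interval of radii below the reach. The
  constant term vanishes because the local parallel sets, which leave out K, shrink to the empty set
  as the radius tends to 0; hence the Steiner formula has no term k = d.\<close>

lemma F_polynomial:
  assumes B: "B \<in> sets borel"
  obtains P where "degree P \<le> DIM('a)" "poly P 0 = 0" "\<And>t. t \<in> I \<Longrightarrow> F B t = poly P t"
proof -
  have "polynomial_on DIM('a) I (F B)"
  proof (rule polynomial_on_patch[OF open_I connected_I])
    fix t assume t: "t \<in> I"
    obtain \<eta> where \<eta>: "\<eta> > 0" "polynomial_on DIM('a) {t * (1 - \<eta>)<..<t * (1 + \<eta>)} (F B)"
      using local_parallel_polynomial_near[OF compact nonempty B, of t] t unfolding I_def F_def[abs_def] by auto
    have "t \<in> {t * (1 - \<eta>)<..<t * (1 + \<eta>)}" using \<eta>(1) t by (simp add: I_def algebra_simps)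
    moreover have "polynomial_on DIM('a) ({t * (1 - \<eta>)<..<t * (1 + \<eta>)} \<inter> I) (F B)"
      using \<eta>(2) unfolding polynomial_on_def by blast
    ultimately show "\<exists>U. open U \<and> t \<in> U \<and> polynomial_on DIM('a) (U \<inter> I) (F B)"
      by (intro exI[of _ "{t * (1 - \<eta>)<..<t * (1 + \<eta>)}"]) auto
  qed
  then obtain P where P: "degree P \<le> DIM('a)" "\<And>t. t \<in> I \<Longrightarrow> F B t = poly P t"
    unfolding polynomial_on_def by blast
  obtain t where t: "t \<in> I" using infinite_I by (metis finite.emptyI ex_in_conv)
  have tn: "t / real (Suc m) \<in> I" for m
  proof -
    have "t / real (Suc m) \<le> t" using t by (simp add: I_def divide_le_eq mult_le_cancel_left1)
    then have "ereal (t / real (Suc m)) < reach K" using t unfolding I_def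
      by (metis (mono_tags) ereal_less_eq(3) le_less_trans mem_Collect_eq)
    then show ?thesis using t by (simp add: I_def)
  qed
  have "(\<lambda>m. F B (t / real (Suc m))) \<longlonglongrightarrow> measure lebesgue (\<Inter>m. local_parallel K B (t / real (Suc m)))"
    unfolding F_def
  proof (rule Lim_measure_decseq)
    show "range (\<lambda>m. local_parallel K B (t / real (Suc m))) \<subseteq> sets lebesgue"
      using local_parallel_lmeasurable[OF B tn] by auto
    show "decseq (\<lambda>m. local_parallel K B (t / real (Suc m)))"
    proof (rule decseq_SucI)
      fix m
      have "t / real (Suc (Suc m)) \<le> t / real (Suc m)" using t by (intro divide_left_mono) (auto simp: I_def)
      then show "local_parallel K B (t / real (Suc (Suc m))) \<subseteq> local_parallel K B (t / real (Suc m))"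
        by (auto simp: local_parallel_def parallel_set_def)
    qed
    show "emeasure lebesgue (local_parallel K B (t / real (Suc m))) \<noteq> \<infinity>" for m
      using fmeasurableD2[OF local_parallel_lmeasurable[OF B tn]] by simp
  qed
  also have "(\<Inter>m. local_parallel K B (t / real (Suc m))) = {}"
  proof -
    have False if x: "\<And>m. x \<in> local_parallel K B (t / real (Suc m))" for x
    proof -
      have "0 < infdist x K" using x[of 0] infdist_pos_iff[OF closed nonempty] by (auto simp: local_parallel_def)
      then obtain m where "t < real m * infdist x K" using ex_less_of_nat_mult by blast
      also have "\<dots> \<le> real (Suc m) * infdist x K" using infdist_nonneg[of x K] by (intro mult_right_mono) auto
      finally have "t / real (Suc m) < infdist x K" by (simp add: divide_less_eq mult.commute)
      then show False using x[of m] by (simp add: local_parallel_def parallel_set_def)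
    qed
    then show ?thesis by blast
  qed
  finally have "(\<lambda>m. poly P (t / real (Suc m))) \<longlonglongrightarrow> 0" using P(2)[OF tn] by simp
  moreover have "(\<lambda>m. poly P (t / real (Suc m))) \<longlonglongrightarrow> poly P 0"
  proof (rule isCont_tendsto_compose[of 0 "poly P"])
    show "(\<lambda>m. t / real (Suc m)) \<longlonglongrightarrow> 0" using LIMSEQ_Suc[OF lim_const_over_n[of t]] by simp
  qed simp
  ultimately have "poly P 0 = 0" using LIMSEQ_unique by blast
  then show ?thesis using P that by blast
qed

text \<open>The nodes are fixed once for all Borel sets B. The Steiner coefficients of B are then
  fixed linear combinations of the numbers \<open>F B t\<close>, and as functions of B they inherit
  countable additivity.\<close>

definition "X = (SOME X. finite X \<and> card X = Suc DIM('a) \<and> X \<subseteq> I)"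

lemma X: "finite X" "card X = Suc DIM('a)" "X \<subseteq> I"
proof -
  have "\<exists>X. finite X \<and> card X = Suc DIM('a) \<and> X \<subseteq> I"
    using infinite_obtain_nodes[OF infinite_I] by metis
  then have "finite X \<and> card X = Suc DIM('a) \<and> X \<subseteq> I" unfolding X_def by (rule someI_ex)
  then show "finite X" "card X = Suc DIM('a)" "X \<subseteq> I" by auto
qed

text \<open>The vanishing constant term appears as extrapolation to the radius 0, which lies outside
  \<open>I\<close>.\<close>

lemma F_lagrange:
  assumes "B \<in> sets borel"
  shows "x \<in> I \<Longrightarrow> F B x = (\<Sum>t\<in>X. poly (lagrange_basis X t) x * F B t)"
    and "(\<Sum>t\<in>X. poly (lagrange_basis X t) 0 * F B t) = 0"
proof -
  obtain P where P: "degree P \<le> DIM('a)" "poly P 0 = 0" "\<And>t. t \<in> I \<Longrightarrow> F B t = poly P t"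
    using F_polynomial[OF assms] by blast
  have *: "(\<Sum>t\<in>X. poly (lagrange_basis X t) x * F B t) = poly P x" for x
  proof -
    have "(\<Sum>t\<in>X. poly (lagrange_basis X t) x * F B t) = (\<Sum>t\<in>X. poly (lagrange_basis X t) x * poly P t)"
      using P(3) X(3) by (intro sum.cong) auto
    then show ?thesis using lagrange_interpolation[of X P x] X P(1) by simp
  qed
  show "x \<in> I \<Longrightarrow> F B x = (\<Sum>t\<in>X. poly (lagrange_basis X t) x * F B t)" using * P(3) by simp
  show "(\<Sum>t\<in>X. poly (lagrange_basis X t) 0 * F B t) = 0" using * P(2) by simp
qed

lemma lagrange_expand:
  "(\<Sum>t\<in>X. poly (lagrange_basis X t) x * g t) = (\<Sum>j\<le>DIM('a). (\<Sum>t\<in>X. poly.coeff (lagrange_basis X t) j * g t) * x ^ j)"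
proof -
  have "poly (lagrange_basis X t) x = (\<Sum>j\<le>DIM('a). poly.coeff (lagrange_basis X t) j * x ^ j)" if "t \<in> X" for t
    by (rule poly_altdef_le) (use degree_lagrange_basis[OF X(1) that] X(2) in simp)
  then have "(\<Sum>t\<in>X. poly (lagrange_basis X t) x * g t) = (\<Sum>t\<in>X. (\<Sum>j\<le>DIM('a). poly.coeff (lagrange_basis X t) j * x ^ j * g t))"
    by (simp add: sum_distrib_right)
  also have "\<dots> = (\<Sum>j\<le>DIM('a). \<Sum>t\<in>X. poly.coeff (lagrange_basis X t) j * x ^ j * g t)" by (rule sum.swap)
  finally show ?thesis by (simp add: sum_distrib_right sum_distrib_left mult_ac)
qed

text \<open>The coefficient of degree d - k of the polynomial interpolating \<open>F B\<close>,
  normalized by the volume of the unit ball. The default values 0 follow the conventions of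
  \<open>signed_measure\<close> and \<open>support_measure\<close>, under which the family is
  unique.\<close>

definition "\<Lambda> k B = (if k < DIM('a) \<and> B \<in> sets normal_bundle_space
   then (\<Sum>t\<in>X. poly.coeff (lagrange_basis X t) (DIM('a) - k) * F B t) / unit_ball_vol (real (DIM('a) - k)) else 0)"

lemma F_steiner:
  assumes B: "B \<in> sets normal_bundle_space" and R: "R \<in> I"
  shows "F B R = (\<Sum>k<DIM('a). R ^ (DIM('a) - k) * unit_ball_vol (real (DIM('a) - k)) * \<Lambda> k B)"
proof -
  have Bb: "B \<in> sets borel" using B by (simp add: sets_normal_bundle_space)
  have "F B R = (\<Sum>j\<le>DIM('a). (\<Sum>t\<in>X. poly.coeff (lagrange_basis X t) j * F B t) * R ^ j)"
    using F_lagrange(1)[OF Bb R] lagrange_expand by simp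
  also have "\<dots> = (\<Sum>k<DIM('a). (\<Sum>t\<in>X. poly.coeff (lagrange_basis X t) (DIM('a) - k) * F B t) * R ^ (DIM('a) - k))"
    using F_lagrange(2)[OF Bb] by (subst sum_atMost_split_0) (simp add: poly_0_coeff_0)
  also have "\<dots> = (\<Sum>k<DIM('a). R ^ (DIM('a) - k) * unit_ball_vol (real (DIM('a) - k)) * \<Lambda> k B)"
  proof (intro sum.cong refl)
    fix k assume "k \<in> {..<DIM('a)}"
    moreover have "unit_ball_vol (real (DIM('a) - k)) \<noteq> 0"
      by (rule unit_ball_vol_nat_neq_0)
    ultimately show "(\<Sum>t\<in>X. poly.coeff (lagrange_basis X t) (DIM('a) - k) * F B t) * R ^ (DIM('a) - k) =
        R ^ (DIM('a) - k) * unit_ball_vol (real (DIM('a) - k)) * \<Lambda> k B"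
      using B by (simp add: \<Lambda>_def)
  qed
  finally show ?thesis .
qed

lemma local_steiner: "local_steiner_formula K \<Lambda>"
  unfolding local_steiner_formula_def
proof (intro allI impI, elim conjE)
  fix R :: real and B assume "0 < R" "ereal R < reach K" "B \<in> sets (normal_bundle_space :: ('a \<times> 'a) measure)"
  then show "measure lebesgue {x \<in> parallel_set K R - K. (closest_point K x, sgn (x - closest_point K x)) \<in> B} =
     (\<Sum>k<DIM('a). R ^ (DIM('a) - k) * unit_ball_vol (real (DIM('a) - k)) * \<Lambda> k B)"
    using F_steiner[of B R] by (simp add: I_def F_def local_parallel_def normal_pair_def)
qed

lemma F_sums:
  assumes A: "range A \<subseteq> sets borel" "disjoint_family A" and t: "t \<in> I"
  shows "(\<lambda>i. F (A i) t) sums F (\<Union>i. A i) t"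
proof -
  have Ai: "A i \<in> sets borel" for i using A by auto
  have eq: "local_parallel K (\<Union>i. A i) t = (\<Union>i. local_parallel K (A i) t)" by (auto simp: local_parallel_def)
  show ?thesis unfolding F_def eq
  proof (rule measure_UNION)
    show "range (\<lambda>i. local_parallel K (A i) t) \<subseteq> sets lebesgue" using local_parallel_lmeasurable[OF Ai t] by auto
    show "disjoint_family (\<lambda>i. local_parallel K (A i) t)"
      using A(2) unfolding disjoint_family_on_def local_parallel_def by blast
    show "emeasure lebesgue (\<Union>i. local_parallel K (A i) t) \<noteq> \<infinity>"
      using fmeasurableD2[OF local_parallel_lmeasurable[OF _ t, of "\<Union>i. A i"]] Ai unfolding eq by auto
  qed
qed

lemma signed_measure_\<Lambda>:
  assumes k: "k < DIM('a)"
  shows "signed_measure normal_bundle_space (\<Lambda> k)"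
  unfolding signed_measure_def
proof (intro conjI allI impI)
  have "F {} t = 0" for t by (simp add: F_def local_parallel_def)
  then show "\<Lambda> k {} = 0" by (simp add: \<Lambda>_def)
next
  fix A :: "nat \<Rightarrow> ('a \<times> 'a) set"
  assume "range A \<subseteq> sets normal_bundle_space \<and> disjoint_family A"
  then have A: "range A \<subseteq> sets borel" "disjoint_family A" "\<And>i. A i \<in> sets normal_bundle_space"
    "(\<Union>i. A i) \<in> sets normal_bundle_space"
    by (auto simp: sets_normal_bundle_space subset_eq)
  have "(\<lambda>i. (\<Sum>t\<in>X. poly.coeff (lagrange_basis X t) (DIM('a) - k) * F (A i) t) / unit_ball_vol (real (DIM('a) - k))) sums
     ((\<Sum>t\<in>X. poly.coeff (lagrange_basis X t) (DIM('a) - k) * F (\<Union>i. A i) t) / unit_ball_vol (real (DIM('a) - k)))"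
    by (intro sums_divide sums_sum sums_mult F_sums A) (use X in auto)
  then show "(\<lambda>i. \<Lambda> k (A i)) sums \<Lambda> k (\<Union>i. A i)" using k A by (simp add: \<Lambda>_def)
next
  fix B :: "('a \<times> 'a) set" assume "B \<notin> sets normal_bundle_space"
  then show "\<Lambda> k B = 0" by (simp add: \<Lambda>_def)
qed

text \<open>Two solutions differ by the coefficients of a polynomial in R that vanishes on the
  infinite set \<open>I\<close>. The exponents d - k are distinct, so each coefficient vanishes
  separately; elsewhere the default values agree.\<close>

lemma support_measure_eq: "support_measure K = \<Lambda>"
  unfolding support_measure_def
proof (rule the_equality)
  show "(\<forall>k<DIM('a). signed_measure normal_bundle_space (\<Lambda> k)) \<and> (\<forall>k\<ge>DIM('a). \<Lambda> k = (\<lambda>B. 0)) \<and> local_steiner_formula K \<Lambda>"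
    using signed_measure_\<Lambda> local_steiner by (auto simp: \<Lambda>_def fun_eq_iff)
next
  fix L assume L: "(\<forall>k<DIM('a). signed_measure normal_bundle_space (L k)) \<and> (\<forall>k\<ge>DIM('a). L k = (\<lambda>B. 0)) \<and> local_steiner_formula K L"
  have "L k B = \<Lambda> k B" for k B
  proof (cases "k < DIM('a) \<and> B \<in> sets normal_bundle_space")
    case False
    then show ?thesis using L by (cases "k < DIM('a)") (auto simp: \<Lambda>_def signed_measure_def not_less)
  next
    case True
    define Q where "Q = (\<Sum>k<DIM('a). monom (unit_ball_vol (real (DIM('a) - k)) * (L k B - \<Lambda> k B)) (DIM('a) - k))"
    have "poly Q R = 0" if "R \<in> I" for R
    proof -
      have "(\<Sum>k<DIM('a). R ^ (DIM('a) - k) * unit_ball_vol (real (DIM('a) - k)) * L k B) =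
        (\<Sum>k<DIM('a). R ^ (DIM('a) - k) * unit_ball_vol (real (DIM('a) - k)) * \<Lambda> k B)"
        using L local_steiner that True unfolding local_steiner_formula_def I_def by (metis (no_types, lifting) mem_Collect_eq)
      then show ?thesis
        by (simp add: Q_def poly_sum poly_monom algebra_simps sum_subtractf)
    qed
    then have "I \<subseteq> {x. poly Q x = 0}" by blast
    then have "Q = 0" using infinite_I poly_roots_finite finite_subset by blast
    moreover have "poly.coeff Q (DIM('a) - k) = unit_ball_vol (real (DIM('a) - k)) * (L k B - \<Lambda> k B)"
    proof -
      have "poly.coeff Q (DIM('a) - k) = (\<Sum>i<DIM('a). if i = k then unit_ball_vol (real (DIM('a) - i)) * (L i B - \<Lambda> i B) else 0)"
        unfolding Q_def coeff_sum using True by (intro sum.cong) auto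
      then show ?thesis using True by simp
    qed
    moreover have "unit_ball_vol (real (DIM('a) - k)) \<noteq> 0"
      by (rule unit_ball_vol_nat_neq_0)
    ultimately show ?thesis by simp
  qed
  then show "L = \<Lambda>" by (simp add: fun_eq_iff)
qed

end

section \<open>Integration of the local Steiner formula over the shell\<close>

lemma lebesgue_FTC:
  fixes F f :: "real \<Rightarrow> real"
  assumes "a \<le> b" and F: "\<And>x. (F has_real_derivative f x) (at x)" and f: "continuous_on UNIV f"
  shows "(\<integral>x. indicator {a..b} x * f x \<partial>lebesgue) = F b - F a"
proof -
  have "set_integrable lebesgue {a..b} f"
    by (rule absolutely_integrable_continuous_real) (rule continuous_on_subset[OF f], simp)
  then have "(\<integral>x. indicator {a..b} x * f x \<partial>lebesgue) = integral {a..b} f"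
    using set_lebesgue_integral_eq_integral(2) by (fastforce simp: set_lebesgue_integral_def)
  also have "\<dots> = F b - F a"
    by (rule integral_unique, rule fundamental_theorem_of_calculus[OF assms(1)])
      (use F has_real_derivative_iff_has_vector_derivative has_vector_derivative_at_within in blast)
  finally show ?thesis .
qed

context positive_reach
begin

text \<open>The value on K is irrelevant; it makes the second component a unit vector everywhere.\<close>

definition "ndir x = (closest_point K x, if x \<in> K then (SOME b. b \<in> Basis) else sgn (x - closest_point K x))"

lemma closest_point_measurable: "closest_point K \<in> borel_measurable lebesgue"
  by (rule borel_measurable_closest_point[OF closed nonempty])

lemma norm_snd_ndir: "norm (snd (ndir x)) = 1"
proof (cases "x \<in> K")
  case True
  have "(SOME b. b \<in> (Basis :: 'a set)) \<in> Basis" using nonempty_Basis by (rule some_in_eq[THEN iffD2])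
  then show ?thesis using True by (simp add: ndir_def)
next
  case False
  then have "x \<noteq> closest_point K x" using closest_point_infdist(1)[OF closed nonempty, of x] by auto
  then show ?thesis using False by (simp add: ndir_def norm_sgn)
qed

lemma ndir_measurable: "ndir \<in> measurable lebesgue normal_bundle_space"
  unfolding normal_bundle_space_def
proof (rule measurable_restrict_space2)
  show "ndir \<in> space lebesgue \<rightarrow> UNIV \<times> sphere 0 1"
    using norm_snd_ndir by (auto simp: mem_Times_iff)
  have [measurable]: "K \<in> sets lebesgue" using closed by simp
  note [measurable] = closest_point_measurable borel_measurable_lebesgue_id
  have [measurable]: "(\<lambda>x. x - closest_point K x) \<in> borel_measurable lebesgue"
    by (intro borel_measurable_diff closest_point_measurable borel_measurable_lebesgue_id)
  have "(\<lambda>x. sgn (x - closest_point K x)) \<in> borel_measurable lebesgue"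
    unfolding sgn_div_norm by measurable
  then have "(\<lambda>x. if x \<in> K then (SOME b. b \<in> Basis) else sgn (x - closest_point K x)) \<in> borel_measurable lebesgue"
    by (intro measurable_If) auto
  then show "ndir \<in> borel_measurable lebesgue"
    unfolding ndir_def[abs_def] by (intro borel_measurable_Pair closest_point_measurable)
qed

abbreviation "shell t \<equiv> parallel_set K t - K"

lemma shell_lmeasurable: "shell t \<in> lmeasurable"
  by (intro fmeasurable.Diff parallel_set_lmeasurable compact nonempty lmeasurable_compact)

lemma shell_integrable: "integrable lebesgue (indicator (shell t) :: 'a \<Rightarrow> real)"
  using shell_lmeasurable[of t] by (auto simp: fmeasurable_def less_top)

text \<open>\<open>measure_N\<close> identifies this with the set function sending B to
  \<open>F B t\<close>; as an image of Lebesgue measure it has computable integrals.\<close>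

definition "N t = push (indicator (shell t)) normal_bundle_space ndir"

definition "G f t = (\<integral>x. indicator (shell t) x * f (ndir x) \<partial>lebesgue)"

lemma N_props: "finite_measure (N t)" "sets (N t) = sets normal_bundle_space"
  unfolding N_def
  by (rule finite_measure_push[OF ndir_measurable shell_integrable], simp)
     (rule sets_push[OF ndir_measurable shell_integrable], simp)

lemma N_absolutely_continuous: "t \<le> t' \<Longrightarrow> absolutely_continuous (N t') (N t)"
  unfolding N_def
  by (rule absolutely_continuous_push[OF ndir_measurable shell_integrable _ shell_integrable])
    (auto simp: indicator_def parallel_set_def split: if_splits)

lemma measure_N:
  assumes B: "B \<in> sets normal_bundle_space"
  shows "measure (N t) B = F B t"
proof -
  have "measure (N t) B = (\<integral>x. indicator (shell t) x * indicator B (ndir x) \<partial>lebesgue)"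
    unfolding N_def by (rule measure_push[OF ndir_measurable shell_integrable _ B]) simp
  also have "\<dots> = (\<integral>x. indicator (local_parallel K B t) x \<partial>lebesgue)"
    by (intro Bochner_Integration.integral_cong)
      (auto simp: local_parallel_def normal_pair_def ndir_def indicator_def)
  finally show ?thesis by (simp add: F_def)
qed

context
  fixes f :: "'a \<times> 'a \<Rightarrow> real" and c :: real
  assumes f: "f \<in> borel_measurable normal_bundle_space" and fc: "\<And>x. \<bar>f (ndir x)\<bar> \<le> c"
begin

lemma f_ndir_measurable: "(\<lambda>x. f (ndir x)) \<in> borel_measurable lebesgue"
  by (rule measurable_compose[OF ndir_measurable f])

lemma f_ndir_integrable: "integrable lebesgue (\<lambda>x. indicator (shell t) x * f (ndir x))"
  by (rule set_integrable_bounded[OF shell_lmeasurable f_ndir_measurable fc])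

lemma N_integrable: "integrable (N t) f"
  unfolding N_def by (subst integrable_push[OF ndir_measurable shell_integrable _ f]) (auto intro: f_ndir_integrable)

lemma N_integral: "(\<integral>z. f z \<partial>N t) = G f t"
  unfolding N_def G_def by (rule integral_push[OF ndir_measurable shell_integrable _ f]) simp

lemma signed_integral_F_lincomb:
  assumes Y: "finite Y" and \<mu>: "\<And>B. B \<in> sets normal_bundle_space \<Longrightarrow> \<mu> B = (\<Sum>t\<in>Y. d t * F B t)"
  shows "signed_integral normal_bundle_space \<mu> f = (\<Sum>t\<in>Y. d t * G f t)"
proof -
  \<comment> \<open>The shells are nested, so the largest radius gives a measure that dominates all
    the others; the inserted 0 admits an empty Y, which is how the zero measure is treated.\<close>
  define T where "T = Max (insert 0 Y)"
  have T: "t \<le> T" if "t \<in> Y" for t unfolding T_def using that Y by (intro Max_ge) auto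
  have "signed_integral normal_bundle_space \<mu> f = (\<Sum>t\<in>Y. d t * (\<integral>z. f z \<partial>N t))"
    by (rule signed_integral_lincomb[where N = "N T"])
      (use Y N_props N_absolutely_continuous T \<mu> measure_N f N_integrable in auto)
  then show ?thesis by (simp add: N_integral)
qed

text \<open>The local Steiner formula is integrated by writing the signed measure \<open>\<lambda>B. F B R\<close> as a combination
  of the measures N t in two ways.\<close>

lemma G_steiner:
  assumes R: "R \<in> I"
  shows "G f R = (\<Sum>k<DIM('a). R ^ (DIM('a) - k) *
     (unit_ball_vol (real (DIM('a) - k)) * signed_integral normal_bundle_space (support_measure K k) f))"
proof -
  have bor: "B \<in> sets borel" if "B \<in> sets (normal_bundle_space :: ('a \<times> 'a) measure)" for B
    using that by (simp add: sets_normal_bundle_space)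
  have "signed_integral normal_bundle_space (\<lambda>B. F B R) f = (\<Sum>t\<in>{R}. 1 * G f t)"
    by (rule signed_integral_F_lincomb) auto
  moreover have "signed_integral normal_bundle_space (\<lambda>B. F B R) f = (\<Sum>t\<in>X. poly (lagrange_basis X t) R * G f t)"
    by (rule signed_integral_F_lincomb) (use X F_lagrange(1)[OF bor R] in auto)
  ultimately have "G f R = (\<Sum>t\<in>X. poly (lagrange_basis X t) R * G f t)" by simp
  also have "\<dots> = (\<Sum>j\<le>DIM('a). (\<Sum>t\<in>X. poly.coeff (lagrange_basis X t) j * G f t) * R ^ j)"
    by (rule lagrange_expand)
  also have "\<dots> = (\<Sum>t\<in>X. poly (lagrange_basis X t) 0 * G f t) +
      (\<Sum>k<DIM('a). (\<Sum>t\<in>X. poly.coeff (lagrange_basis X t) (DIM('a) - k) * G f t) * R ^ (DIM('a) - k))"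
    by (subst sum_atMost_split_0) (simp add: poly_0_coeff_0)
  \<comment> \<open>The zero measure is written in two ways: as the empty combination and as the
    extrapolation of \<open>F B\<close> to the radius 0.\<close>
  also have "(\<Sum>t\<in>X. poly (lagrange_basis X t) 0 * G f t) = 0"
  proof -
    have "signed_integral normal_bundle_space (\<lambda>B::('a \<times> 'a) set. 0) f = (\<Sum>t\<in>{}. 1 * G f t)"
      by (rule signed_integral_F_lincomb) auto
    moreover have "signed_integral normal_bundle_space (\<lambda>B::('a \<times> 'a) set. 0) f = (\<Sum>t\<in>X. poly (lagrange_basis X t) 0 * G f t)"
      by (rule signed_integral_F_lincomb) (use X F_lagrange(2)[OF bor] in auto)
    ultimately show ?thesis by simp
  qed
  also have "(\<Sum>k<DIM('a). (\<Sum>t\<in>X. poly.coeff (lagrange_basis X t) (DIM('a) - k) * G f t) * R ^ (DIM('a) - k)) =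
     (\<Sum>k<DIM('a). R ^ (DIM('a) - k) * (unit_ball_vol (real (DIM('a) - k)) * signed_integral normal_bundle_space (support_measure K k) f))"
  proof (intro sum.cong refl)
    fix k assume k: "k \<in> {..<DIM('a)}"
    have "signed_integral normal_bundle_space (support_measure K k) f =
      (\<Sum>t\<in>X. (poly.coeff (lagrange_basis X t) (DIM('a) - k) / unit_ball_vol (real (DIM('a) - k))) * G f t)"
      unfolding support_measure_eq
      by (rule signed_integral_F_lincomb) (use X k in \<open>auto simp: \<Lambda>_def sum_divide_distrib\<close>)
    also have "\<dots> = (\<Sum>t\<in>X. poly.coeff (lagrange_basis X t) (DIM('a) - k) * G f t) / unit_ball_vol (real (DIM('a) - k))"
      by (simp add: sum_divide_distrib)
    finally show "(\<Sum>t\<in>X. poly.coeff (lagrange_basis X t) (DIM('a) - k) * G f t) * R ^ (DIM('a) - k) =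
      R ^ (DIM('a) - k) * (unit_ball_vol (real (DIM('a) - k)) * signed_integral normal_bundle_space (support_measure K k) f)"
      using unit_ball_vol_nat_neq_0[of "DIM('a) - k"] by simp
  qed
  finally show ?thesis by simp
qed

text \<open>Layer cake: \<open>d ^ s\<close> is \<open>R ^ s\<close> minus the integral of \<open>s \<tau> ^ (s - 1)\<close> over \<open>{d..R}\<close>, and Fubini.\<close>

lemma shell_power_integral:
  assumes R: "R \<in> I"
  shows "(\<integral>x. indicator (shell R) x * (infdist x K ^ s * f (ndir x)) \<partial>lebesgue) =
    (\<Sum>k<DIM('a). R ^ (s + (DIM('a) - k)) * (real (DIM('a) - k) / real (s + (DIM('a) - k))) *
     (unit_ball_vol (real (DIM('a) - k)) * signed_integral normal_bundle_space (support_measure K k) f))"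
proof (cases s)
  case 0
  then show ?thesis using G_steiner[OF R] by (simp add: G_def)
next
  \<comment> \<open>The layers s \<tau> ^ (s - 1) need s > 0; for s = 0 the claim was
    \<open>G_steiner\<close> itself.\<close>
  case (Suc s')
  define a where "a k = unit_ball_vol (real (DIM('a) - k)) * signed_integral normal_bundle_space (support_measure K k) f" for k
  have R0: "0 < R" using R by (simp add: I_def)
  have c0: "0 \<le> c" using fc[of undefined] by linarith
  \<comment> \<open>Both factors become finite measures, so that boundedness of the integrand
    suffices for Fubini.\<close>
  define M1 where "M1 = push (indicator (shell R)) lebesgue (\<lambda>x. x)"
  define M2 where "M2 = push (indicator {0..R}) lebesgue (\<lambda>\<tau>::real. \<tau>)"
  have i2: "integrable lebesgue (indicator {0..R} :: real \<Rightarrow> real)"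
    using lmeasurable_cbox[of 0 R] by (auto simp: fmeasurable_def less_top)
  have id1: "(\<lambda>x::'a. x) \<in> measurable lebesgue lebesgue" and id2: "(\<lambda>x::real. x) \<in> measurable lebesgue lebesgue" by simp_all
  note p1 = finite_measure_push[OF id1 shell_integrable] sets_push[OF id1 shell_integrable]
    integral_push[OF id1 shell_integrable]
  note p2 = finite_measure_push[OF id2 i2] sets_push[OF id2 i2] integral_push[OF id2 i2]
  interpret M1: finite_measure M1 unfolding M1_def by (rule p1) simp
  interpret M2: finite_measure M2 unfolding M2_def by (rule p2) simp
  interpret P: pair_sigma_finite M1 M2 ..
  interpret P: finite_measure "M1 \<Otimes>\<^sub>M M2" by (rule finite_measure_pair_measure) unfold_locales
  have s1: "sets M1 = sets lebesgue" unfolding M1_def by (rule p1) simp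
  have s2: "sets M2 = sets lebesgue" unfolding M2_def by (rule p2) simp
  \<comment> \<open>On the shell, integration over \<tau> gives f times R ^ s - d ^ s with d =
    \<open>infdist x K\<close>; integration over x gives s \<tau> ^ (s - 1) times
    \<open>G f \<tau>\<close>, a polynomial in \<tau> by \<open>G_steiner\<close>.\<close>
  define h where "h x \<tau> = f (ndir x) * (if infdist x K \<le> \<tau> \<and> \<tau> \<le> R then real s * \<tau> ^ s' else 0)" for x \<tau>
  have m1[measurable]: "(\<lambda>x. f (ndir x)) \<in> borel_measurable M1"
    using f_ndir_measurable measurable_cong_sets[OF s1 refl] by blast
  have "(\<lambda>x. infdist x K) \<in> borel_measurable lborel"
    by (simp, intro borel_measurable_continuous_onI continuous_intros)
  then have dl: "(\<lambda>x. infdist x K) \<in> borel_measurable lebesgue" by (rule measurable_completion)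
  then have m2[measurable]: "(\<lambda>x. infdist x K) \<in> borel_measurable M1"
    using measurable_cong_sets[OF s1 refl] by blast
  have m3[measurable]: "(\<lambda>\<tau>. \<tau>) \<in> borel_measurable M2"
    using borel_measurable_lebesgue_id measurable_cong_sets[OF s2 refl] by blast
  have hm: "case_prod h \<in> borel_measurable (M1 \<Otimes>\<^sub>M M2)"
    unfolding h_def split_def by measurable
  have hb: "\<bar>h x \<tau>\<bar> \<le> c * (real s * R ^ s')" for x \<tau>
  proof -
    have "\<bar>if infdist x K \<le> \<tau> \<and> \<tau> \<le> R then real s * \<tau> ^ s' else 0\<bar> \<le> real s * R ^ s'"
      using R0 infdist_nonneg[of x K] by (auto simp: abs_mult intro!: mult_left_mono power_mono)
    then show ?thesis unfolding h_def abs_mult by (intro mult_mono fc) (use c0 in auto)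
  qed
  have hi: "integrable (M1 \<Otimes>\<^sub>M M2) (case_prod h)"
    by (rule P.integrable_const_bound[where B = "c * (real s * R ^ s')"]) (use hb hm in auto)
  have fub: "(\<integral>\<tau>. (\<integral>x. h x \<tau> \<partial>M1) \<partial>M2) = (\<integral>x. (\<integral>\<tau>. h x \<tau> \<partial>M2) \<partial>M1)"
    by (rule P.Fubini_integral[OF hi])
  have lebm: "g \<in> borel_measurable M1 \<Longrightarrow> g \<in> borel_measurable lebesgue" for g :: "'a \<Rightarrow> real"
    using measurable_cong_sets[OF s1 refl] by blast
  have lebm2: "g \<in> borel_measurable M2 \<Longrightarrow> g \<in> borel_measurable lebesgue" for g :: "real \<Rightarrow> real"
    using measurable_cong_sets[OF s2 refl] by blast
  have dpow: "((\<lambda>\<tau>::real. \<tau> ^ s) has_real_derivative real s * \<tau> ^ s') (at \<tau>)" for \<tau>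
    using DERIV_pow[of s \<tau>] Suc by simp
  have inner2: "(\<integral>\<tau>. h x \<tau> \<partial>M2) = f (ndir x) * (R ^ s - infdist x K ^ s)" if x: "x \<in> shell R" for x
  proof -
    have d: "0 \<le> infdist x K" "infdist x K \<le> R" using x infdist_nonneg by (auto simp: parallel_set_def)
    have hm2: "(\<lambda>\<tau>. h x \<tau>) \<in> borel_measurable M2" unfolding h_def by measurable
    have "(\<integral>\<tau>. h x \<tau> \<partial>M2) = (\<integral>\<tau>. indicator {0..R} \<tau> * h x \<tau> \<partial>lebesgue)"
      unfolding M2_def by (rule p2(3)) (auto intro: lebm2 hm2)
    also have "\<dots> = (\<integral>\<tau>. f (ndir x) * (indicator {infdist x K..R} \<tau> * (real s * \<tau> ^ s')) \<partial>lebesgue)"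
      using d by (intro Bochner_Integration.integral_cong) (auto simp: h_def indicator_def)
    also have "\<dots> = f (ndir x) * (\<integral>\<tau>. indicator {infdist x K..R} \<tau> * (real s * \<tau> ^ s') \<partial>lebesgue)" by simp
    also have "(\<integral>\<tau>. indicator {infdist x K..R} \<tau> * (real s * \<tau> ^ s') \<partial>lebesgue) = R ^ s - infdist x K ^ s"
      by (rule lebesgue_FTC[OF d(2) dpow]) (intro continuous_intros)
    finally show ?thesis .
  qed
  have hm1: "(\<lambda>x. h x \<tau>) \<in> borel_measurable M1" for \<tau> unfolding h_def by measurable
  have inner1: "(\<integral>x. h x \<tau> \<partial>M1) = real s * \<tau> ^ s' * (\<Sum>k<DIM('a). \<tau> ^ (DIM('a) - k) * a k)"
    if \<tau>: "\<tau> \<in> {0..R}" for \<tau>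
  proof -
    have "(\<integral>x. h x \<tau> \<partial>M1) = (\<integral>x. indicator (shell R) x * h x \<tau> \<partial>lebesgue)"
      unfolding M1_def by (rule p1(3)) (auto intro: lebm hm1)
    also have "\<dots> = (\<integral>x. (real s * \<tau> ^ s') * (indicator (shell \<tau>) x * f (ndir x)) \<partial>lebesgue)"
      using \<tau> by (intro Bochner_Integration.integral_cong) (auto simp: h_def indicator_def parallel_set_def)
    also have "\<dots> = real s * \<tau> ^ s' * G f \<tau>" unfolding G_def by simp
    also have "G f \<tau> = (\<Sum>k<DIM('a). \<tau> ^ (DIM('a) - k) * a k)"
    proof (cases "\<tau> = 0")
      \<comment> \<open>The radius 0 is not in \<open>I\<close>; here both sides vanish, because K
        is closed and the shell is empty.\<close>
      case True
      have "x \<in> K" if "infdist x K \<le> 0" for x using infdist_pos_iff[OF closed nonempty, of x] that by linarith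
      then have "shell 0 = {}" by (auto simp: parallel_set_def)
      then have "G f 0 = 0" unfolding G_def by (subst \<open>shell 0 = {}\<close>) simp
      moreover have "(\<Sum>k<DIM('a). (0::real) ^ (DIM('a) - k) * a k) = 0" by (intro sum.neutral) auto
      ultimately show ?thesis using True by simp
    next
      case False
      then have "ereal \<tau> \<le> ereal R" "ereal R < reach K" "0 < \<tau>" using \<tau> R by (auto simp: I_def)
      then have "\<tau> \<in> I" using le_less_trans[of "ereal \<tau>" "ereal R"] by (simp add: I_def)
      then show ?thesis unfolding a_def by (rule G_steiner)
    qed
    finally show ?thesis .
  qed
  define Fn where "Fn \<tau> = (\<Sum>k<DIM('a). a k * (real s / real (s + (DIM('a) - k))) * \<tau> ^ (s + (DIM('a) - k)))" for \<tau> :: real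
  have dF: "(Fn has_real_derivative real s * \<tau> ^ s' * (\<Sum>k<DIM('a). \<tau> ^ (DIM('a) - k) * a k)) (at \<tau>)" for \<tau>
  proof -
    have "((\<lambda>\<tau>. a k * (real s / real (s + (DIM('a) - k))) * \<tau> ^ (s + (DIM('a) - k))) has_real_derivative
        real s * \<tau> ^ s' * (\<tau> ^ (DIM('a) - k) * a k)) (at \<tau>)" for k
    proof -
      let ?m = "s' + (DIM('a) - k)"
      have sm: "s + (DIM('a) - k) = Suc ?m" using Suc by simp
      have "((\<lambda>\<tau>. \<tau> ^ Suc ?m) has_real_derivative real (Suc ?m) * \<tau> ^ ?m) (at \<tau>)"
        by (auto intro!: derivative_eq_intros simp del: power_Suc)
      from DERIV_cmult[OF this, of "a k * (real s / real (Suc ?m))"]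
      show ?thesis unfolding sm by (simp add: power_add mult_ac del: power_Suc of_nat_Suc)
    qed
    then have "(Fn has_real_derivative (\<Sum>k<DIM('a). real s * \<tau> ^ s' * (\<tau> ^ (DIM('a) - k) * a k))) (at \<tau>)"
      unfolding Fn_def[abs_def] by (rule DERIV_sum)
    then show ?thesis by (simp add: sum_distrib_left)
  qed
  have L: "(\<integral>\<tau>. (\<integral>x. h x \<tau> \<partial>M1) \<partial>M2) = Fn R"
  proof -
    have mm: "(\<lambda>\<tau>. \<integral>x. h x \<tau> \<partial>M1) \<in> borel_measurable M2"
      by (rule M1.borel_measurable_lebesgue_integral) (use measurable_pair_swap[OF hm] in \<open>simp add: split_def\<close>)
    have "(\<integral>\<tau>. (\<integral>x. h x \<tau> \<partial>M1) \<partial>M2) = (\<integral>\<tau>. indicator {0..R} \<tau> * (\<integral>x. h x \<tau> \<partial>M1) \<partial>lebesgue)"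
      unfolding M2_def by (rule p2(3)) (auto intro: lebm2 mm)
    also have "\<dots> = (\<integral>\<tau>. indicator {0..R} \<tau> * (real s * \<tau> ^ s' * (\<Sum>k<DIM('a). \<tau> ^ (DIM('a) - k) * a k)) \<partial>lebesgue)"
      by (intro Bochner_Integration.integral_cong refl) (auto simp: indicator_def inner1)
    also have "\<dots> = Fn R - Fn 0"
      by (rule lebesgue_FTC[OF _ dF]) (use R0 in \<open>auto intro!: continuous_intros\<close>)
    also have "Fn 0 = 0" unfolding Fn_def using Suc by (intro sum.neutral) auto
    finally show ?thesis by simp
  qed
  have Hi: "integrable lebesgue (\<lambda>x. indicator (shell R) x * (infdist x K ^ s * f (ndir x)))"
  proof (rule set_integrable_bounded[OF shell_lmeasurable])
    show "(\<lambda>x. infdist x K ^ s * f (ndir x)) \<in> borel_measurable lebesgue"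
      by (intro borel_measurable_times borel_measurable_power dl f_ndir_measurable)
    fix x assume "x \<in> shell R"
    then have "infdist x K ^ s \<le> R ^ s" using infdist_nonneg[of x K] by (intro power_mono) (auto simp: parallel_set_def)
    then show "\<bar>infdist x K ^ s * f (ndir x)\<bar> \<le> R ^ s * c"
      unfolding abs_mult using infdist_nonneg[of x K] c0 R0 by (intro mult_mono fc) auto
  qed
  have mm: "(\<lambda>x. \<integral>\<tau>. h x \<tau> \<partial>M2) \<in> borel_measurable M1"
    by (rule M2.borel_measurable_lebesgue_integral[OF hm])
  have "(\<integral>x. (\<integral>\<tau>. h x \<tau> \<partial>M2) \<partial>M1) = (\<integral>x. indicator (shell R) x * (\<integral>\<tau>. h x \<tau> \<partial>M2) \<partial>lebesgue)"
    unfolding M1_def by (rule p1(3)) (auto intro: lebm mm)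
  also have "\<dots> = (\<integral>x. R ^ s * (indicator (shell R) x * f (ndir x)) - indicator (shell R) x * (infdist x K ^ s * f (ndir x)) \<partial>lebesgue)"
    by (intro Bochner_Integration.integral_cong refl) (auto simp: indicator_def inner2 algebra_simps)
  also have "\<dots> = R ^ s * G f R - (\<integral>x. indicator (shell R) x * (infdist x K ^ s * f (ndir x)) \<partial>lebesgue)"
    unfolding G_def using f_ndir_integrable[of R] Hi by simp
  finally have "(\<integral>x. indicator (shell R) x * (infdist x K ^ s * f (ndir x)) \<partial>lebesgue) = R ^ s * G f R - Fn R"
    using fub L by simp
  also have "\<dots> = (\<Sum>k<DIM('a). R ^ s * (R ^ (DIM('a) - k) * a k) - a k * (real s / real (s + (DIM('a) - k))) * R ^ (s + (DIM('a) - k)))"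
    unfolding G_steiner[OF R] a_def[symmetric] Fn_def by (simp add: sum_distrib_left sum_subtractf)
  also have "\<dots> = (\<Sum>k<DIM('a). R ^ (s + (DIM('a) - k)) * (real (DIM('a) - k) / real (s + (DIM('a) - k))) * a k)"
  proof (intro sum.cong refl)
    fix k
    let ?m = "DIM('a) - k"
    \<comment> \<open>Subtracting \<open>Fn R\<close> from R ^ s times the Steiner polynomial leaves
      the factor m / (s + m) with m = d - k.\<close>
    have "1 - real s / real (s + ?m) = real ?m / real (s + ?m)" using Suc by (simp add: field_simps del: of_nat_diff)
    moreover have "R ^ s * (R ^ ?m * a k) - a k * (real s / real (s + ?m)) * R ^ (s + ?m) =
        R ^ (s + ?m) * (1 - real s / real (s + ?m)) * a k" by (simp add: power_add algebra_simps)
    ultimately show "R ^ s * (R ^ ?m * a k) - a k * (real s / real (s + ?m)) * R ^ (s + ?m) =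
        R ^ (s + ?m) * (real ?m / real (s + ?m)) * a k" by simp
  qed
  finally show ?thesis unfolding a_def .
qed

end

end

section \<open>Voronoi tensors of sets of positive reach and their approximation rates\<close>

lemma poly_lipschitz_at:
  fixes P :: "real poly"
  obtains C where "0 \<le> C" "\<And>y. 0 \<le> y \<Longrightarrow> y \<le> R \<Longrightarrow> \<bar>poly P R - poly P y\<bar> \<le> C * \<bar>R - y\<bar>"
proof -
  \<comment> \<open>P - P(R) vanishes at R, so a linear factor splits off, and the cofactor, bounded
    on the interval, supplies C.\<close>
  have "[:- R, 1:] dvd P - [:poly P R:]" by (simp add: poly_eq_0_iff_dvd[symmetric])
  then obtain Q where Q: "P - [:poly P R:] = [:- R, 1:] * Q" by (rule dvdE)
  have "continuous_on {0..R} (poly Q)" by (intro continuous_intros)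
  then have "bounded (poly Q ` {0..R})" by (intro compact_imp_bounded compact_continuous_image) auto
  then obtain C where C: "\<forall>y\<in>{0..R}. \<bar>poly Q y\<bar> \<le> C" unfolding bounded_iff by auto
  have "\<bar>poly P R - poly P y\<bar> \<le> \<bar>C\<bar> * \<bar>R - y\<bar>" if "0 \<le> y" "y \<le> R" for y
  proof -
    have "poly (P - [:poly P R:]) y = (y - R) * poly Q y" unfolding Q by (simp add: algebra_simps)
    then have "poly P R - poly P y = poly Q y * (R - y)" by (simp add: algebra_simps)
    then have "\<bar>poly P R - poly P y\<bar> = \<bar>poly Q y\<bar> * \<bar>R - y\<bar>" by (simp only: abs_mult)
    also have "\<dots> \<le> \<bar>C\<bar> * \<bar>R - y\<bar>" using bspec[OF C, of y] that by (intro mult_right_mono) auto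
    finally show ?thesis .
  qed
  then show ?thesis using that[of "\<bar>C\<bar>"] by simp
qed

context positive_reach
begin

text \<open>The parallel set splits into K and the shell. On K the vector x - p vanishes, so only s
  = 0 contributes: the volume tensor, term j = 0. On the shell x - p is distance times direction,
  and \<open>shell_power_integral\<close> gives the terms j = d - k.\<close>

lemma voronoi_steiner:
  assumes R: "R \<in> I" and vs: "unit_args (r + s) vs"
  shows "voronoi_tensor R r s K vs =
    (\<Sum>j\<le>DIM('a). fact r * fact s * (unit_ball_vol (real (s + j)) * R ^ (s + j)) * minkowski_tensor (DIM('a) - j) r s K vs)"
proof -
  define f where "f = (\<lambda>(x::'a, u). tensor_power_prod r s x u vs)"
  have fm: "f \<in> borel_measurable normal_bundle_space"
    unfolding normal_bundle_space_def f_def split_def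
    by (intro measurable_restrict_space1 borel_measurable_continuous_onI continuous_on_tensor_power_prod continuous_intros)
  obtain D where D: "K \<subseteq> cball 0 D" using bounded_subset_cball0E[OF compact_imp_bounded[OF compact]] by blast
  define c where "c = (max D 1) ^ (r + s)"
  have fc: "\<bar>f (ndir x)\<bar> \<le> c" for x
  proof -
    have "\<bar>tensor_power_prod r s (fst (ndir x)) (snd (ndir x)) vs\<bar> \<le> (max D 1) ^ (r + s)"
    proof (rule tensor_power_prod_bound[OF vs])
      have "closest_point K x \<in> cball 0 D" using closest_point_infdist(1)[OF closed nonempty, of x] D by blast
      then show "norm (fst (ndir x)) \<le> max D 1" by (simp add: ndir_def)
      show "norm (snd (ndir x)) \<le> max D 1" using norm_snd_ndir by simp
    qed
    then show ?thesis by (simp add: f_def c_def split_def)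
  qed
  let ?p = "closest_point K"
  define h where "h x = tensor_power_prod r s (?p x) (x - ?p x) vs" for x
  have R0: "0 < R" using R by (simp add: I_def)
  have KR: "K \<subseteq> parallel_set K R" using R0 by (auto simp: parallel_set_def)
  have hs: "h x = infdist x K ^ s * f (ndir x)" if "x \<notin> K" for x
  proof -
    have "x - ?p x = infdist x K *\<^sub>R sgn (x - ?p x)"
      using closest_point_decomp[OF closed nonempty, of x] by (metis add_diff_cancel_left')
    then have "h x = tensor_power_prod r s (?p x) (infdist x K *\<^sub>R sgn (x - ?p x)) vs" unfolding h_def by simp
    then show ?thesis using that by (simp add: tensor_power_prod_scale f_def ndir_def)
  qed
  have hK: "h x = (if s = 0 then tensor_power r x vs else 0)" if "x \<in> K" for x
  proof -
    have "?p x = x" using closest_point_self[OF that] .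
    moreover have "tensor_power_prod r s x 0 vs = (if s = 0 then tensor_power r x vs else 0)"
      using tensor_power_prod_scale[of r s x 0 0 vs]
      by (cases "s = 0") (auto simp: tensor_power_prod_0_right power_0_left)
    ultimately show ?thesis by (simp add: h_def)
  qed
  have hm: "h \<in> borel_measurable lebesgue" unfolding h_def
    by (intro borel_measurable_tensor_power_prod borel_measurable_diff closest_point_measurable borel_measurable_lebesgue_id)
  have hb: "\<bar>h x\<bar> \<le> max D R ^ (r + s)" if "x \<in> parallel_set K R" for x
    unfolding h_def
  proof (rule tensor_power_prod_bound[OF vs])
    have "?p x \<in> cball 0 D" using closest_point_infdist(1)[OF closed nonempty, of x] D by blast
    then show "norm (?p x) \<le> max D R" by simp
    show "norm (x - ?p x) \<le> max D R"
      using closest_point_infdist(2)[OF closed nonempty, of x] that by (simp add: parallel_set_def dist_norm)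
  qed
  have i1: "integrable lebesgue (\<lambda>x. indicator K x * h x)"
    by (rule set_integrable_bounded[OF lmeasurable_compact[OF compact] hm]) (use hb KR in blast)
  have i2: "integrable lebesgue (\<lambda>x. indicator (shell R) x * h x)"
    by (rule set_integrable_bounded[OF shell_lmeasurable hm]) (use hb in blast)
  have "voronoi_tensor R r s K vs = (\<integral>x. indicator (parallel_set K R) x * h x \<partial>lebesgue)"
    by (simp add: voronoi_tensor_def voronoi_measure_def set_lebesgue_integral_def h_def)
  also have "\<dots> = (\<integral>x. indicator K x * h x + indicator (shell R) x * h x \<partial>lebesgue)"
    using KR by (intro Bochner_Integration.integral_cong) (auto simp: indicator_def)
  also have "\<dots> = (\<integral>x. indicator K x * h x \<partial>lebesgue) + (\<integral>x. indicator (shell R) x * h x \<partial>lebesgue)"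
    using i1 i2 by simp
  also have "(\<integral>x. indicator (shell R) x * h x \<partial>lebesgue) = (\<integral>x. indicator (shell R) x * (infdist x K ^ s * f (ndir x)) \<partial>lebesgue)"
    using hs by (intro Bochner_Integration.integral_cong) (auto simp: indicator_def)
  also have "\<dots> = (\<Sum>k<DIM('a). R ^ (s + (DIM('a) - k)) * (real (DIM('a) - k) / real (s + (DIM('a) - k))) *
     (unit_ball_vol (real (DIM('a) - k)) * signed_integral normal_bundle_space (support_measure K k) f))"
    by (rule shell_power_integral[OF fm fc R])
  also have "\<dots> = (\<Sum>k<DIM('a). fact r * fact s * (unit_ball_vol (real (s + (DIM('a) - k))) * R ^ (s + (DIM('a) - k))) * minkowski_tensor k r s K vs)"
  proof (intro sum.cong refl)
    fix k assume k: "k \<in> {..<DIM('a)}"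
    define m where "m = DIM('a) - k"
    have m: "0 < m" using k by (simp add: m_def)
    have nz: "unit_ball_vol (real (s + m)) \<noteq> 0" by (rule unit_ball_vol_nat_neq_0)
    \<comment> \<open>With \<omega>_j = j \<kappa>_j the ratio of sphere areas exchanges \<kappa>_m
      m / (s + m) for \<kappa>_(s+m); this explains the normalization of the Minkowski
      tensors.\<close>
    have sa: "sphere_area m / sphere_area (m + s) * unit_ball_vol (real (s + m)) = real m / real (s + m) * unit_ball_vol (real m)"
      using nz m unfolding sphere_area_def add.commute[of m s] by (simp del: of_nat_add)
    define J where "J = signed_integral normal_bundle_space (support_measure K k) f"
    have "minkowski_tensor k r s K vs = 1 / (fact r * fact s) * (sphere_area m / sphere_area (m + s)) * J"
      using k by (simp add: minkowski_tensor_def J_def f_def m_def)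
    then have "fact r * fact s * (unit_ball_vol (real (s + m)) * R ^ (s + m)) * minkowski_tensor k r s K vs =
        R ^ (s + m) * ((sphere_area m / sphere_area (m + s) * unit_ball_vol (real (s + m))) * J)"
      by (simp del: of_nat_add)
    also have "\<dots> = R ^ (s + m) * (real m / real (s + m)) * (unit_ball_vol (real m) * J)" unfolding sa by (simp only: mult.assoc)
    finally show "R ^ (s + (DIM('a) - k)) * (real (DIM('a) - k) / real (s + (DIM('a) - k))) *
     (unit_ball_vol (real (DIM('a) - k)) * signed_integral normal_bundle_space (support_measure K k) f) =
     fact r * fact s * (unit_ball_vol (real (s + (DIM('a) - k))) * R ^ (s + (DIM('a) - k))) * minkowski_tensor k r s K vs"
      unfolding m_def J_def by (rule sym)
  qed
  also have "(\<integral>x. indicator K x * h x \<partial>lebesgue) =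
     fact r * fact s * (unit_ball_vol (real (s + 0)) * R ^ (s + 0)) * minkowski_tensor (DIM('a) - 0) r s K vs"
  proof (cases "s = 0")
    case True
    have "(\<integral>x. indicator K x * h x \<partial>lebesgue) = (\<integral>x. indicator K x * tensor_power r x vs \<partial>lebesgue)"
      using hK True by (intro Bochner_Integration.integral_cong) (auto simp: indicator_def)
    then show ?thesis using True by (simp add: minkowski_tensor_def set_lebesgue_integral_def)
  next
    case False
    have "(\<integral>x. indicator K x * h x \<partial>lebesgue) = (\<integral>x. 0 \<partial>(lebesgue :: 'a measure))"
      using hK False by (intro Bochner_Integration.integral_cong) (auto simp: indicator_def)
    then show ?thesis using False by (simp add: minkowski_tensor_def)
  qed
  also have "fact r * fact s * (unit_ball_vol (real (s + 0)) * R ^ (s + 0)) * minkowski_tensor (DIM('a) - 0) r s K vs +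
      (\<Sum>k<DIM('a). fact r * fact s * (unit_ball_vol (real (s + (DIM('a) - k))) * R ^ (s + (DIM('a) - k))) * minkowski_tensor k r s K vs) =
     (\<Sum>j\<le>DIM('a). fact r * fact s * (unit_ball_vol (real (s + j)) * R ^ (s + j)) * minkowski_tensor (DIM('a) - j) r s K vs)"
    by (subst sum_atMost_split_0) (auto intro!: arg_cong2[of _ _ _ _ "(+)"] sum.cong)
  finally show ?thesis .
qed

text \<open>The lost layer lies in the shell between the radii R - h and R, whose volume is a
  difference of values of the Steiner polynomial and hence O(h). A projection onto K' is an h-nearly
  closest point of K, so \<open>near_closest_point_reach\<close> bounds its displacement by O(sqrt
  h).\<close>

lemma approximation_rate:
  assumes R: "R \<in> I"
  obtains C h0 where "0 \<le> C" "0 < h0"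
    "\<And>K' h. compact K' \<Longrightarrow> K' \<noteq> {} \<Longrightarrow> K' \<subseteq> K \<Longrightarrow> 0 \<le> h \<Longrightarrow> h \<le> h0 \<Longrightarrow> \<forall>x\<in>K. infdist x K' \<le> h \<Longrightarrow>
       measure lebesgue (parallel_set K R - parallel_set K' R) \<le> C * h \<and> proj_err K K' R \<le> C * sqrt h"
proof -
  obtain P where P: "\<And>t. t \<in> I \<Longrightarrow> F UNIV t = poly P t" using F_polynomial[of UNIV] by auto
  obtain C1 where C1: "0 \<le> C1" "\<And>y. 0 \<le> y \<Longrightarrow> y \<le> R \<Longrightarrow> \<bar>poly P R - poly P y\<bar> \<le> C1 * \<bar>R - y\<bar>"
    using poly_lipschitz_at[of R P] by blast
  have R0: "0 < R" "ereal R < reach K" using R by (auto simp: I_def)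
  obtain r where r: "R < r" "ereal r < reach K" using ereal_dense2[OF R0(2)] by auto
  define c where "c = 1 - R / r"
  have c: "0 < c" using r R0 by (simp add: c_def)
  let ?V = "measure lebesgue (parallel_set K R)"
  define C where "C = ?V * sqrt ((2 * R + 1) / c) + C1"
  \<comment> \<open>h <= R / 2 keeps R - h a positive radius; h <= 1 gives h^2 <= h and h <= sqrt h,
    so that the error terms merge.\<close>
  define h0 where "h0 = min 1 (R / 2)"
  have main: "measure lebesgue (parallel_set K R - parallel_set K' R) \<le> C * h \<and> proj_err K K' R \<le> C * sqrt h"
    if K': "compact K'" "K' \<noteq> {}" "K' \<subseteq> K" and h: "0 \<le> h" "h \<le> h0" and d: "\<forall>x\<in>K. infdist x K' \<le> h" for K' h
  proof -
    have h1: "h \<le> 1" "h \<le> R / 2" "h < R" using h R0 by (auto simp: h0_def)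
    have near: "infdist x K' \<le> infdist x K + h" for x by (rule infdist_le_add_Hausdorff[OF closed nonempty bspec[OF d]])
    have sub: "parallel_set K R - parallel_set K' R \<subseteq> shell R - shell (R - h)"
    proof
      fix x assume x: "x \<in> parallel_set K R - parallel_set K' R"
      then have xR: "R < infdist x K'" "infdist x K \<le> R" by (auto simp: parallel_set_def)
      then have "R - h < infdist x K" using near[of x] by linarith
      moreover from this have "x \<notin> K" using h1(3) by (metis diff_gt_0_iff_gt infdist_zero not_less_iff_gr_or_eq order_less_trans)
      ultimately show "x \<in> shell R - shell (R - h)" using xR by (auto simp: parallel_set_def)
    qed
    have RhI: "R - h \<in> I"
    proof -
      have "ereal (R - h) \<le> ereal R" using h by simp
      then show ?thesis using R0 h1 le_less_trans[of "ereal (R - h)" "ereal R"] by (simp add: I_def)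
    qed
    have Feq: "measure lebesgue (shell t) = F UNIV t" for t
      by (simp add: F_def local_parallel_def set_diff_eq)
    have "measure lebesgue (parallel_set K R - parallel_set K' R) \<le> measure lebesgue (shell R - shell (R - h))"
      by (rule measure_mono_fmeasurable[OF sub]) (auto intro!: fmeasurable.Diff shell_lmeasurable)
    also have "\<dots> = measure lebesgue (shell R) - measure lebesgue (shell (R - h))"
      by (rule measurable_measure_Diff) (use h shell_lmeasurable in \<open>auto simp: parallel_set_def fmeasurableD\<close>)
    also have "\<dots> \<le> C1 * h" unfolding Feq P[OF R] P[OF RhI] using C1(2)[of "R - h"] h h1 by (simp add: abs_le_iff)
    finally have v: "measure lebesgue (parallel_set K R - parallel_set K' R) \<le> C1 * h" .
    have cl': "closed K'" using K' compact_imp_closed by blast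
    define b where "b = sqrt ((2 * R + 1) / c) * sqrt h"
    have pd: "dist (closest_point K x) (closest_point K' x) \<le> b" if x: "x \<in> parallel_set K R" for x
    proof -
      let ?y = "closest_point K' x"
      have y: "?y \<in> K'" "dist x ?y = infdist x K'" using closest_point_infdist[OF cl' K'(2)] by auto
      have "c * (dist ?y (closest_point K x))\<^sup>2 \<le> 2 * R * h + h\<^sup>2"
        unfolding c_def
        by (rule near_closest_point_reach[OF closed nonempty _ r]) (use x y K' near[of x] h in \<open>auto simp: parallel_set_def\<close>)
      also have "\<dots> \<le> (2 * R + 1) * h" using mult_left_le[of h h] h h1 by (simp add: power2_eq_square algebra_simps)
      finally have "(dist ?y (closest_point K x))\<^sup>2 \<le> (2 * R + 1) / c * h" using c by (simp add: pos_le_divide_eq mult.commute)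
      then have "dist ?y (closest_point K x) \<le> sqrt ((2 * R + 1) / c * h)" by (rule real_le_rsqrt)
      also have "\<dots> = b" unfolding b_def by (rule real_sqrt_mult)
      finally show ?thesis by (simp add: dist_commute)
    qed
    have "(LINT x:parallel_set K R|lebesgue. dist (closest_point K x) (closest_point K' x)) \<le> (\<integral>x. indicator (parallel_set K R) x * b \<partial>lebesgue)"
      unfolding set_lebesgue_integral_def
    proof (rule integral_mono)
      have PL: "parallel_set K R \<in> lmeasurable" by (rule parallel_set_lmeasurable[OF compact nonempty])
      have mm: "(\<lambda>x. dist (closest_point K x) (closest_point K' x)) \<in> borel_measurable lebesgue"
        by (intro borel_measurable_dist closest_point_measurable borel_measurable_closest_point cl' K')
      show "integrable lebesgue (\<lambda>x. indicator (parallel_set K R) x *\<^sub>R dist (closest_point K x) (closest_point K' x))"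
        using set_integrable_bounded[OF PL mm, of b] pd by simp
      show "integrable lebesgue (\<lambda>x. indicator (parallel_set K R) x * b)"
        using set_integrable_bounded[OF PL, of "\<lambda>_. b" "\<bar>b\<bar>"] by simp
      show "indicator (parallel_set K R) x *\<^sub>R dist (closest_point K x) (closest_point K' x) \<le> indicator (parallel_set K R) x * b" for x
        using pd by (auto simp: indicator_def)
    qed
    also have "\<dots> = ?V * b" by simp
    finally have "proj_err K K' R \<le> ?V * b + C1 * h" unfolding proj_err_def using v by simp
    moreover have "h \<le> sqrt h" using h h1 by (metis real_sqrt_le_1_iff real_le_rsqrt power2_eq_square mult_left_le)
    then have "C1 * h \<le> C1 * sqrt h" using C1 by (intro mult_left_mono)
    ultimately have "proj_err K K' R \<le> C * sqrt h" by (simp add: C_def b_def algebra_simps)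
    moreover have "C1 * h \<le> C * h" using h c R0 by (intro mult_right_mono) (auto simp: C_def)
    ultimately show ?thesis using v by simp
  qed
  show ?thesis
  proof (rule that[of C h0])
    show "0 \<le> C" using c R0 C1 by (simp add: C_def)
    show "0 < h0" using R0 by (simp add: h0_def)
  qed (rule main)
qed

end

section \<open>Lattice approximation\<close>

text \<open>The coordinate functionals of the basis are bounded, so the integer coordinates of
  lattice points closer than 1 / M differ by less than 1. Discreteness makes the lattice closed and
  its intersection with K compact.\<close>

lemma lattice_discrete:
  fixes L :: "'a::euclidean_space set"
  assumes "is_lattice L"
  obtains e where "0 < e" "\<And>x y. x \<in> L \<Longrightarrow> y \<in> L \<Longrightarrow> dist y x < e \<Longrightarrow> y = x"
proof -
  obtain B where B: "independent B" "span B = UNIV" "L = {(\<Sum>b\<in>B. of_int (c b) *\<^sub>R b) | c :: 'a \<Rightarrow> int. True}"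
    using assms unfolding is_lattice_def by blast
  have fin: "finite B" using B(1) independent_imp_finite by blast
  have "\<exists>g::'a \<Rightarrow> real. linear g \<and> (\<forall>b\<in>B. g b = (if b = b0 then 1 else 0))" for b0
    by (rule linear_independent_extend[OF B(1)])
  then obtain g :: "'a \<Rightarrow> 'a \<Rightarrow> real" where g: "\<And>b0. linear (g b0)" "\<And>b0 b. b \<in> B \<Longrightarrow> g b0 b = (if b = b0 then 1 else 0)"
    by metis
  have "\<exists>C>0. \<forall>x. norm (g b x) \<le> C * norm x" for b
    using linear_bounded_pos[OF g(1)[of b]] by metis
  then obtain C where C: "\<And>b. 0 < C b" "\<And>b x. norm (g b x) \<le> C b * norm x" by metis
  define M where "M = 1 + (\<Sum>b\<in>B. C b)"
  have M: "0 < M" unfolding M_def using C(1) by (intro add_pos_nonneg sum_nonneg) (auto intro: less_imp_le)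
  have CM: "C b \<le> M" if "b \<in> B" for b
  proof -
    have "C b \<le> (\<Sum>b\<in>B. C b)" using that fin C(1) by (intro member_le_sum) (auto intro: less_imp_le)
    then show ?thesis by (simp add: M_def)
  qed
  have coord: "g b0 (\<Sum>b\<in>B. u b *\<^sub>R b) = u b0" if "b0 \<in> B" for b0 u
  proof -
    have "g b0 (\<Sum>b\<in>B. u b *\<^sub>R b) = (\<Sum>b\<in>B. u b * g b0 b)"
      by (simp add: linear_sum[OF g(1)] linear_scale[OF g(1)])
    also have "\<dots> = (\<Sum>b\<in>B. if b = b0 then u b else 0)" using g(2) by (intro sum.cong) auto
    finally show ?thesis using that fin by simp
  qed
  show ?thesis
  proof (rule that[of "1 / M"])
    show "0 < 1 / M" using M by simp
    fix x y assume "x \<in> L" "y \<in> L" and d: "dist y x < 1 / M"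
    then obtain c c' :: "'a \<Rightarrow> int" where c: "x = (\<Sum>b\<in>B. of_int (c b) *\<^sub>R b)" "y = (\<Sum>b\<in>B. of_int (c' b) *\<^sub>R b)"
      unfolding B(3) by blast
    have "c b = c' b" if b: "b \<in> B" for b
    proof -
      have "\<bar>of_int (c' b) - of_int (c b)\<bar> = \<bar>g b (y - x)\<bar>"
        using coord[OF b] by (simp add: c linear_diff[OF g(1)])
      also have "\<dots> \<le> C b * norm (y - x)" using C(2)[of b "y - x"] by simp
      also have "\<dots> \<le> M * norm (y - x)" using CM[OF b] by (intro mult_right_mono) auto
      also have "\<dots> < M * (1 / M)" using d M by (intro mult_strict_left_mono) (auto simp: dist_norm)
      also have "\<dots> = 1" using M by simp
      finally have "\<bar>real_of_int (c' b - c b)\<bar> < 1" by simp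
      then show ?thesis by linarith
    qed
    then show "y = x" unfolding c by (intro sum.cong) auto
  qed
qed

lemma closed_lattice_scaled:
  fixes L :: "'a::euclidean_space set"
  assumes "is_lattice L"
  shows "closed ((*\<^sub>R) a ` L)"
proof -
  obtain e where e: "0 < e" "\<And>x y. x \<in> L \<Longrightarrow> y \<in> L \<Longrightarrow> dist y x < e \<Longrightarrow> y = x"
    using lattice_discrete[OF assms] by blast
  have "closed L" by (rule discrete_imp_closed[OF e(1)]) (use e(2) in blast)
  then show ?thesis by (rule closed_scaling)
qed

text \<open>Rounding all coordinates down moves a point by at most the sum of the lengths of the
  basis vectors; scaling the lattice by a scales this covering radius.\<close>

lemma lattice_covering:
  fixes L :: "'a::euclidean_space set"
  assumes "is_lattice L"
  obtains D where "0 < D" "\<And>a x. 0 < a \<Longrightarrow> \<exists>z\<in>(*\<^sub>R) a ` L. dist x z \<le> a * D"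
proof -
  obtain B where B: "independent B" "span B = UNIV" "L = {(\<Sum>b\<in>B. of_int (c b) *\<^sub>R b) | c :: 'a \<Rightarrow> int. True}"
    using assms unfolding is_lattice_def by blast
  have fin: "finite B" using B(1) independent_imp_finite by blast
  define D where "D = 1 + (\<Sum>b\<in>B. norm b)"
  have cov: "\<exists>z\<in>L. dist x z \<le> D" for x
  proof -
    have "x \<in> span B" using B(2) by simp
    then obtain u where u: "x = (\<Sum>b\<in>B. u b *\<^sub>R b)" unfolding span_finite[OF fin] by blast
    define z where "z = (\<Sum>b\<in>B. of_int \<lfloor>u b\<rfloor> *\<^sub>R b)"
    have "z \<in> L" unfolding B(3) z_def by (intro CollectI exI[of _ "\<lambda>b. \<lfloor>u b\<rfloor>"]) simp
    moreover have "dist x z \<le> D"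
    proof -
      have "dist x z = norm (\<Sum>b\<in>B. frac (u b) *\<^sub>R b)"
        by (simp add: dist_norm u z_def frac_def scaleR_diff_left sum_subtractf)
      also have "\<dots> \<le> (\<Sum>b\<in>B. norm b)"
      proof (rule order_trans[OF norm_sum sum_mono])
        show "norm (frac (u b) *\<^sub>R b) \<le> norm b" for b
          using frac_lt_1[of "u b"] frac_ge_0[of "u b"] mult_right_mono[of "frac (u b)" 1 "norm b"] by simp
      qed
      finally show ?thesis by (simp add: D_def)
    qed
    ultimately show ?thesis by blast
  qed
  show ?thesis
  proof (rule that[of D])
    show "0 < D" unfolding D_def by (intro add_pos_nonneg sum_nonneg) auto
    fix a :: real and x :: 'a assume a: "0 < a"
    obtain z where z: "z \<in> L" "dist (x /\<^sub>R a) z \<le> D" using cov by blast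
    have "dist x (a *\<^sub>R z) = a * dist (x /\<^sub>R a) z"
    proof -
      have "x - a *\<^sub>R z = a *\<^sub>R (x /\<^sub>R a - z)" using a by (simp add: scaleR_diff_right)
      then show ?thesis using a by (simp add: dist_norm)
    qed
    then show "\<exists>z\<in>(*\<^sub>R) a ` L. dist x z \<le> a * D" using z a by (intro bexI[of _ "a *\<^sub>R z"]) auto
  qed
qed

text \<open>Lattice points near x may lie outside K. A ball inside K of the covering radius d
  contains one that lies in K, at the price of the distance from x to the centre of the
  ball.\<close>

lemma infdist_lattice_ball:
  fixes K L :: "'a::euclidean_space set"
  assumes cov: "\<exists>z\<in>L. dist y z \<le> d" and y: "cball y d \<subseteq> K" "dist x y \<le> \<eta>"
  shows "K \<inter> L \<noteq> {}" "infdist x (K \<inter> L) \<le> \<eta> + d"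
proof -
  obtain z where z: "z \<in> L" "dist y z \<le> d" using cov by blast
  then have zK: "z \<in> K \<inter> L" using y by auto
  then show "K \<inter> L \<noteq> {}" by blast
  have "infdist x (K \<inter> L) \<le> dist x z" by (rule infdist_le[OF zK])
  also have "\<dots> \<le> \<eta> + d" using dist_triangle[of x z y] z y by linarith
  finally show "infdist x (K \<inter> L) \<le> \<eta> + d" .
qed

text \<open>Topological regularity puts a ball of uncontrolled radius inside K near every point.
  Passing to a finite net of K bounds the radii below by some m, and once a D is at most m, every
  such ball contains a lattice point.\<close>

lemma lattice_approximation_eventually:
  fixes K L :: "'a::euclidean_space set"
  assumes L: "is_lattice L" and K: "compact K" "K \<noteq> {}" "topologically_regular K" and e: "0 < e"
  shows "\<forall>\<^sub>F a in at_right 0. K \<inter> (*\<^sub>R) a ` L \<noteq> {} \<and> (\<forall>x\<in>K. infdist x (K \<inter> (*\<^sub>R) a ` L) \<le> e)"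
proof -
  obtain D where D: "0 < D" "\<And>a x. 0 < a \<Longrightarrow> \<exists>z\<in>(*\<^sub>R) a ` L. dist x z \<le> a * D"
    using lattice_covering[OF L] by blast
  have "\<exists>y \<rho>. 0 < \<rho> \<and> cball y \<rho> \<subseteq> K \<and> dist x y < e / 4" if "x \<in> K" for x
  proof -
    have "x \<in> closure (interior K)" using K(3) that by (simp add: topologically_regular_def)
    then obtain y where y: "y \<in> interior K" "dist y x < e / 4"
      using e unfolding closure_approachable by (metis divide_pos_pos zero_less_numeral)
    obtain \<rho> where "0 < \<rho>" "cball y \<rho> \<subseteq> interior K" using y(1) open_contains_cball open_interior by metis
    then show ?thesis using y interior_subset[of K] by (metis dist_commute subset_trans)
  qed
  then obtain y \<rho> where y: "\<And>x. x \<in> K \<Longrightarrow> 0 < \<rho> x" "\<And>x. x \<in> K \<Longrightarrow> cball (y x) (\<rho> x) \<subseteq> K" "\<And>x. x \<in> K \<Longrightarrow> dist x (y x) < e / 4"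
    by metis
  have "K \<subseteq> (\<Union>x\<in>K. ball x (e / 4))" using e by auto
  then obtain T where T: "T \<subseteq> K" "finite T" "K \<subseteq> (\<Union>x\<in>T. ball x (e / 4))"
    using compactE_image[OF K(1), of K "\<lambda>x. ball x (e / 4)"] by (metis open_ball)
  have Tne: "T \<noteq> {}" using T(3) K(2) by auto
  \<comment> \<open>The budget e is spent as e / 4 from x to the net point, e / 4 on to the centre
    of the ball, and e / 2 for the lattice point in it.\<close>
  define m where "m = min (e / 2) (Min (\<rho> ` T))"
  have m: "0 < m" "\<And>x. x \<in> T \<Longrightarrow> m \<le> \<rho> x" "m \<le> e / 2"
    using T Tne y(1) e by (auto simp: m_def min_le_iff_disj)
  have "\<forall>\<^sub>F a in at_right 0. a < m / D"
    using m D by (intro eventually_at_right_real[of 0 "m / D", THEN eventually_mono]) auto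
  moreover have "\<forall>\<^sub>F a::real in at_right 0. 0 < a" by (rule eventually_at_right_less)
  ultimately show ?thesis
  proof eventually_elim
    case (elim a)
    have aD: "a * D \<le> m" using elim D by (simp add: less_divide_eq)
    have main: "K \<inter> (*\<^sub>R) a ` L \<noteq> {} \<and> infdist x (K \<inter> (*\<^sub>R) a ` L) \<le> e" if "x \<in> K" for x
    proof -
      have "x \<in> (\<Union>x\<in>T. ball x (e / 4))" using T(3) that by (rule subsetD)
      then obtain t where t: "t \<in> T" "dist t x < e / 4" by auto
      then have tK: "t \<in> K" using T by blast
      have s: "cball (y t) (a * D) \<subseteq> K"
        using y(2)[OF tK] subset_cball[of "a * D" "\<rho> t" "y t"] aD m(2)[OF t(1)] by (meson order_trans)
      have d: "dist x (y t) \<le> e / 2" using y(3)[OF tK] t(2) dist_triangle[of x "y t" t] by (simp add: dist_commute)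
      show ?thesis
        using infdist_lattice_ball[OF D(2)[OF elim(2)] s d] aD m(3) by auto
    qed
    then show ?case using K(2) by blast
  qed
qed

text \<open>The common content of convexity and \<delta>-regularity for the rate: the distance to
  the centre is linear in the radius s, for all small s, so that s may be set to the covering radius
  of the scaled lattice.\<close>

definition interior_balls :: "'a::euclidean_space set \<Rightarrow> bool" where
  "interior_balls K \<longleftrightarrow> (\<exists>C \<rho>. 0 \<le> C \<and> 0 < \<rho> \<and> (\<forall>x\<in>K. \<forall>s. 0 < s \<and> s \<le> \<rho> \<longrightarrow> (\<exists>y. cball y s \<subseteq> K \<and> dist x y \<le> C * s)))"

text \<open>The homothety with centre x and ratio l = s / \<rho> shrinks a fixed ball of K to one of
  radius s. By convexity it stays in K, and its centre has distance l |x - y0| from x.\<close>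

lemma interior_balls_convex:
  fixes K :: "'a::euclidean_space set"
  assumes K: "compact K" "K \<noteq> {}" "topologically_regular K" "convex K"
  shows "interior_balls K"
proof -
  have "interior K \<noteq> {}" using K unfolding topologically_regular_def by (metis closure_empty)
  then obtain y0 \<rho> where y0: "0 < \<rho>" "cball y0 \<rho> \<subseteq> K"
    using open_contains_cball open_interior interior_subset by (metis ex_in_conv subset_trans)
  have y0K: "y0 \<in> K" using y0 by (meson centre_in_cball less_imp_le subsetD)
  show ?thesis unfolding interior_balls_def
  proof (rule exI[of _ "diameter K / \<rho>"], rule exI[of _ \<rho>], intro conjI ballI allI impI)
    show "0 \<le> diameter K / \<rho>" using y0 diameter_ge_0[OF compact_imp_bounded[OF K(1)]] by simp
    fix x s assume x: "x \<in> K" and s: "0 < s \<and> s \<le> \<rho>"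
    define l where "l = s / \<rho>"
    have l: "0 < l" "l \<le> 1" using s y0 by (auto simp: l_def)
    define y where "y = (1 - l) *\<^sub>R x + l *\<^sub>R y0"
    have "cball y s \<subseteq> K"
    proof
      fix z assume z: "z \<in> cball y s"
      define w where "w = y0 + (z - y) /\<^sub>R l"
      have "norm ((z - y) /\<^sub>R l) = dist y z / l"
        using l by (simp add: dist_norm norm_minus_commute divide_inverse mult.commute)
      also have "\<dots> \<le> s / l" using z l by (intro divide_right_mono) auto
      also have "\<dots> = \<rho>" using s y0 by (simp add: l_def)
      finally have "norm ((z - y) /\<^sub>R l) \<le> \<rho>" .
      then have "w \<in> K" using y0 by (auto simp: w_def dist_norm)
      then have "(1 - l) *\<^sub>R x + l *\<^sub>R w \<in> K" using K(4) x l by (simp add: convex_alt)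
      moreover have "(1 - l) *\<^sub>R x + l *\<^sub>R w = z" using l by (simp add: w_def y_def algebra_simps)
      ultimately show "z \<in> K" by simp
    qed
    moreover have "dist x y \<le> diameter K / \<rho> * s"
    proof -
      have "dist x y = l * dist x y0"
      proof -
        have "x - y = l *\<^sub>R (x - y0)" by (simp add: y_def algebra_simps)
        then show ?thesis using l by (simp add: dist_norm)
      qed
      also have "\<dots> \<le> l * diameter K"
        using l diameter_bounded_bound[OF compact_imp_bounded[OF K(1)] x y0K] by (intro mult_left_mono) auto
      finally show ?thesis by (simp add: l_def mult.commute)
    qed
    ultimately show "\<exists>y. cball y s \<subseteq> K \<and> dist x y \<le> diameter K / \<rho> * s" by blast
  qed (use y0 in auto)
qed

text \<open>The closed complement has reach at least \<delta>, so an interior point of K can be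
  moved along its normal ray from the complement to depth s. Since K is the closure of its interior,
  x can be replaced by an interior point at the cost of a further s, whence the constant 2.\<close>

lemma interior_balls_delta_regular:
  fixes K :: "'a::euclidean_space set"
  assumes K: "compact K" "K \<noteq> {}" "delta_regular \<delta> K" "0 < \<delta>"
  shows "interior_balls K"
proof -
  let ?C = "closure (- K)"
  have "K \<noteq> UNIV" using K(1) compact_imp_bounded not_bounded_UNIV by metis
  then have C: "closed ?C" "?C \<noteq> {}" by auto
  have tr: "closure (interior K) = K" and reachC: "ereal \<delta> \<le> reach ?C"
    using K(3) by (auto simp: delta_regular_def topologically_regular_def)
  have int: "interior K = - ?C" by (simp add: interior_closure)
  show ?thesis unfolding interior_balls_def
  proof (rule exI[of _ 2], rule exI[of _ "\<delta> / 2"], intro conjI ballI allI impI)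
    fix x s assume x: "x \<in> K" and s: "0 < s \<and> s \<le> \<delta> / 2"
    have "ereal s < ereal \<delta>" using s K(4) by simp
    then have sr: "ereal s < reach ?C" using reachC by (rule less_le_trans)
    obtain x' where x': "x' \<in> interior K" "dist x' x < s"
      using x s tr closure_approachable[of x "interior K"] by blast
    have d0: "0 < infdist x' ?C" using x'(1) infdist_pos_iff[OF C] int by simp
    have "\<exists>y. s \<le> infdist y ?C \<and> dist x' y \<le> s"
    proof (cases "s \<le> infdist x' ?C")
      case True
      then show ?thesis using s by (intro exI[of _ x']) auto
    next
      case False
      let ?d = "infdist x' ?C" and ?p = "closest_point ?C x'"
      define u where "u = sgn (x' - ?p)"
      have dr: "ereal ?d < reach ?C" using False sr by (meson ereal_less_eq(3) le_less_trans less_imp_le not_le)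
      have "infdist (?p + s *\<^sub>R u) ?C = s"
        unfolding u_def by (rule infdist_ray_reach(1)[OF C d0 dr]) (use s sr in auto)
      moreover have "dist x' (?p + s *\<^sub>R u) \<le> s"
      proof -
        have "x' = ?p + ?d *\<^sub>R u" unfolding u_def by (rule closest_point_decomp[OF C])
        then have "x' - (?p + s *\<^sub>R u) = (?d - s) *\<^sub>R u" by (metis add_diff_cancel_left scaleR_diff_left)
        then have "dist x' (?p + s *\<^sub>R u) = \<bar>?d - s\<bar> * norm u" by (simp add: dist_norm)
        also have "\<dots> \<le> s * 1" using False d0 s by (intro mult_mono) (auto simp: u_def norm_sgn)
        finally show ?thesis by simp
      qed
      ultimately show ?thesis by (intro exI[of _ "?p + s *\<^sub>R u"]) auto
    qed
    then obtain y where y: "s \<le> infdist y ?C" "dist x' y \<le> s" by blast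
    have "ball y s \<subseteq> K"
    proof
      fix z assume z: "z \<in> ball y s"
      have "z \<notin> ?C"
      proof
        assume "z \<in> ?C"
        then have "infdist y ?C \<le> dist y z" by (rule infdist_le)
        then show False using y(1) z by simp
      qed
      then show "z \<in> K" using closure_subset[of "- K"] by blast
    qed
    \<comment> \<open>Depth s yields the open ball; closedness of K adds its boundary.\<close>
    then have "cball y s \<subseteq> K"
      using closure_minimal[OF _ compact_imp_closed[OF K(1)], of "ball y s"] s by (simp add: closure_ball)
    moreover have "dist x y \<le> 2 * s" using x'(2) y(2) dist_triangle[of x y x'] by (simp add: dist_commute)
    ultimately show "\<exists>y. cball y s \<subseteq> K \<and> dist x y \<le> 2 * s" by blast
  qed (use K in auto)
qed

lemma lattice_approximation_rate:
  fixes K L :: "'a::euclidean_space set"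
  assumes L: "is_lattice L" and K: "K \<noteq> {}" "interior_balls K"
  obtains C where "0 < C"
    "\<forall>\<^sub>F a in at_right 0. K \<inter> (*\<^sub>R) a ` L \<noteq> {} \<and> (\<forall>x\<in>K. infdist x (K \<inter> (*\<^sub>R) a ` L) \<le> C * a)"
proof -
  obtain D where D: "0 < D" "\<And>a x. 0 < a \<Longrightarrow> \<exists>z\<in>(*\<^sub>R) a ` L. dist x z \<le> a * D"
    using lattice_covering[OF L] by blast
  obtain C \<rho> where C: "0 \<le> C" "0 < \<rho>" "\<And>x s. x \<in> K \<Longrightarrow> 0 < s \<Longrightarrow> s \<le> \<rho> \<Longrightarrow> \<exists>y. cball y s \<subseteq> K \<and> dist x y \<le> C * s"
    using K(2) unfolding interior_balls_def by metis
  have "\<forall>\<^sub>F a in at_right 0. a < \<rho> / D"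
    using C D by (intro eventually_at_right_real[of 0 "\<rho> / D", THEN eventually_mono]) auto
  moreover have "\<forall>\<^sub>F a::real in at_right 0. 0 < a" by (rule eventually_at_right_less)
  ultimately have "\<forall>\<^sub>F a in at_right 0. K \<inter> (*\<^sub>R) a ` L \<noteq> {} \<and> (\<forall>x\<in>K. infdist x (K \<inter> (*\<^sub>R) a ` L) \<le> ((C + 1) * D) * a)"
  proof eventually_elim
    case (elim a)
    \<comment> \<open>The covering radius a D plays the part of s, provided that it does not exceed
      \<rho>.\<close>
    have aD: "0 < a * D" "a * D \<le> \<rho>" using elim D by (auto simp: less_divide_eq)
    have "K \<inter> (*\<^sub>R) a ` L \<noteq> {} \<and> infdist x (K \<inter> (*\<^sub>R) a ` L) \<le> ((C + 1) * D) * a" if x: "x \<in> K" for x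
    proof -
      obtain y where y: "cball y (a * D) \<subseteq> K" "dist x y \<le> C * (a * D)" using C(3)[OF x aD] by blast
      show ?thesis using infdist_lattice_ball[OF D(2)[OF elim(2)] y] by (simp add: algebra_simps)
    qed
    then show ?case using K(1) by blast
  qed
  moreover have "0 < (C + 1) * D" using C D by simp
  ultimately show ?thesis using that by blast
qed

section \<open>The estimators\<close>

text \<open>The matrix is of Vandermonde type. A kernel vector gives, after division of row i by
  \<rho> i ^ s, a polynomial of degree at most d with the d + 1 distinct roots \<rho> i, hence 0;
  the unit ball volumes are nonzero weights. Row m of the inverse therefore recovers
  \<open>w m\<close>.\<close>

lemma steiner_matrix_inverse:
  fixes \<rho> :: "nat \<Rightarrow> real"
  assumes \<rho>: "0 < \<rho> 0" "\<And>i. i < d \<Longrightarrow> \<rho> i < \<rho> (Suc i)" and m: "m \<le> d"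
  shows "(\<Sum>i\<le>d. the (mat_inverse (steiner_matrix d r s \<rho>)) $$ (m, i) *
     (\<Sum>j\<le>d. fact r * fact s * (unit_ball_vol (real (s + j)) * \<rho> i ^ (s + j)) * w j)) = w m"
proof -
  let ?A = "steiner_matrix d r s \<rho>"
  have A: "?A \<in> carrier_mat (d + 1) (d + 1)" by (simp add: steiner_matrix_def)
  have lt: "\<rho> i < \<rho> j" if "i < j" "j \<le> d" for i j
    using that
  proof (induction j)
    case (Suc j)
    then show ?case using \<rho>(2)[of j] by (cases "i = j") auto
  qed simp
  have pos: "0 < \<rho> i" if "i \<le> d" for i using \<rho>(1) lt[of 0 i] that by (cases "i = 0") auto
  have inj: "inj_on \<rho> {..d}"
    by (rule inj_onI) (metis lt atMost_iff less_irrefl linorder_neqE_nat)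
  have "det ?A \<noteq> 0"
  proof
    assume "det ?A = 0"
    then obtain v where v: "v \<in> carrier_vec (d + 1)" "v \<noteq> 0\<^sub>v (d + 1)" "?A *\<^sub>v v = 0\<^sub>v (d + 1)"
      using det_0_iff_vec_prod_zero_field[OF A] by blast
    define Q where "Q = (\<Sum>j\<le>d. monom (unit_ball_vol (real (s + j)) * vec_index v j) j)"
    have root: "poly Q (\<rho> i) = 0" if i: "i \<le> d" for i
    proof -
      have "0 = vec_index (?A *\<^sub>v v) i" using v(3) i by simp
      also have "\<dots> = (\<Sum>j\<in>{0..<d + 1}. ?A $$ (i, j) * vec_index v j)"
        using A v(1) i by (simp add: scalar_prod_def)
      also have "\<dots> = (\<Sum>j\<le>d. fact r * fact s * (unit_ball_vol (real (s + j)) * \<rho> i ^ (s + j)) * vec_index v j)"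
        using i by (intro sum.cong) (auto simp: steiner_matrix_def)
      also have "\<dots> = fact r * fact s * \<rho> i ^ s * poly Q (\<rho> i)"
        by (simp add: Q_def poly_sum poly_monom sum_distrib_left power_add mult_ac)
      finally show ?thesis using pos[OF i] by simp
    qed
    have "Q = 0"
    proof (rule ccontr)
      assume "Q \<noteq> 0"
      then have "card {x. poly Q x = 0} \<le> degree Q" by (rule card_poly_roots_bound)
      also have "degree Q \<le> d" unfolding Q_def
        by (rule degree_sum_le) (auto intro: order_trans[OF degree_monom_le])
      finally have "card {x. poly Q x = 0} \<le> d" .
      moreover have "card (\<rho> ` {..d}) \<le> card {x. poly Q x = 0}"
        by (rule card_mono) (use root poly_roots_finite[OF \<open>Q \<noteq> 0\<close>] in auto)
      ultimately show False using card_image[OF inj] by simp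
    qed
    have "vec_index v j = 0" if j: "j \<le> d" for j
    proof -
      have "poly.coeff Q j = (\<Sum>i\<le>d. if i = j then unit_ball_vol (real (s + i)) * vec_index v i else 0)"
        unfolding Q_def coeff_sum by (intro sum.cong) auto
      then have "poly.coeff Q j = unit_ball_vol (real (s + j)) * vec_index v j" using j by simp
      then show ?thesis using \<open>Q = 0\<close> unit_ball_vol_nat_neq_0[of "s + j"] by simp
    qed
    then have "v = 0\<^sub>v (d + 1)" using v(1) by (intro eq_vecI) auto
    then show False using v(2) by simp
  qed
  then have "?A \<in> Units (ring_mat TYPE(real) (d + 1) ())" by (rule det_non_zero_imp_unit[OF A])
  then have "mat_inverse ?A \<noteq> None" using mat_inverse(1)[OF A, where b = "()"] by blast
  then obtain B where B: "mat_inverse ?A = Some B" by blast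
  have BA: "B * ?A = 1\<^sub>m (d + 1)" "B \<in> carrier_mat (d + 1) (d + 1)" using mat_inverse(2)[OF A B] by auto
  have idx: "(\<Sum>i\<le>d. B $$ (m, i) * (fact r * fact s * (unit_ball_vol (real (s + j)) * \<rho> i ^ (s + j)))) = (if j = m then 1 else 0)"
    if j: "j \<le> d" for j
  proof -
    have "(\<Sum>i\<le>d. B $$ (m, i) * (fact r * fact s * (unit_ball_vol (real (s + j)) * \<rho> i ^ (s + j)))) =
       (\<Sum>i\<in>{0..<d + 1}. B $$ (m, i) * ?A $$ (i, j))"
      using j by (intro sum.cong) (auto simp: steiner_matrix_def)
    also have "\<dots> = (B * ?A) $$ (m, j)" using A BA(2) m j by (simp add: scalar_prod_def)
    also have "\<dots> = (if j = m then 1 else 0)" unfolding BA(1) using m j by auto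
    finally show ?thesis .
  qed
  have "(\<Sum>i\<le>d. B $$ (m, i) * (\<Sum>j\<le>d. fact r * fact s * (unit_ball_vol (real (s + j)) * \<rho> i ^ (s + j)) * w j)) =
     (\<Sum>i\<le>d. \<Sum>j\<le>d. (B $$ (m, i) * (fact r * fact s * (unit_ball_vol (real (s + j)) * \<rho> i ^ (s + j)))) * w j)"
    by (simp only: sum_distrib_left mult.assoc)
  also have "\<dots> = (\<Sum>j\<le>d. \<Sum>i\<le>d. (B $$ (m, i) * (fact r * fact s * (unit_ball_vol (real (s + j)) * \<rho> i ^ (s + j)))) * w j)"
    by (rule sum.swap)
  also have "\<dots> = (\<Sum>j\<le>d. (if j = m then 1 else 0) * w j)"
    by (intro sum.cong refl) (simp only: sum_distrib_right[symmetric] idx atMost_iff)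
  also have "\<dots> = w m" using m by (simp add: if_distrib[of "\<lambda>x. x * _"] cong: if_cong)
  finally show ?thesis unfolding B by simp
qed

lemma unit_args_00: "unit_args 0 vs \<longleftrightarrow> vs = []"
  by (auto simp: unit_args_def)

theorem corollary5p2:
  fixes L K :: "'a::euclidean_space set" and r s :: nat and R :: real and \<rho> :: "nat \<Rightarrow> real"
  assumes "is_lattice L" and "0 < R"
    and "K \<noteq> {}" and "compact K" and "topologically_regular K"
  shows
    "((\<lambda>a. d_bL (r + s) (voronoi_measure R r s K)
              (voronoi_measure R r s (K \<inter> (*\<^sub>R) a ` L))) \<longlongrightarrow> 0) (at_right 0) \<and>
     ((\<lambda>a. tensor_norm (r + s) (\<lambda>vs. voronoi_tensor R r s (K \<inter> (*\<^sub>R) a ` L) vs -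
              voronoi_tensor R r s K vs)) \<longlongrightarrow> 0) (at_right 0) \<and>
     (0 < reach K \<and> 0 < \<rho> 0 \<and> (\<forall>i<DIM('a). \<rho> i < \<rho> (Suc i)) \<and> ereal (\<rho> DIM('a)) < reach K \<longrightarrow>
        (\<forall>k\<le>DIM('a).
           ((\<lambda>a. tensor_norm (r + s) (\<lambda>vs. minkowski_estimator \<rho> k r s (K \<inter> (*\<^sub>R) a ` L) vs -
                    minkowski_tensor k r s K vs)) \<longlongrightarrow> 0) (at_right 0)) \<and>
        ((\<exists>\<delta>>0. delta_regular \<delta> K) \<or> convex K \<longrightarrow>
           (\<forall>k\<le>DIM('a).
              (\<lambda>a. tensor_norm (r + s) (\<lambda>vs. minkowski_estimator \<rho> k r s (K \<inter> (*\<^sub>R) a ` L) vs -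
                    minkowski_tensor k r s K vs))
              \<in> O[at_right 0](\<lambda>a. if r = 0 \<and> s = 0 then a else sqrt a))))"
proof -
  note L = assms(1) and R = assms(2) and K = assms(4,3,5)
  define Ka where "Ka a = K \<inter> (*\<^sub>R) a ` L" for a
  have Kac: "compact (Ka a)" and Kas: "Ka a \<subseteq> K" for a
    unfolding Ka_def using compact_Int_closed[OF K(1) closed_lattice_scaled[OF L]] by auto
  \<comment> \<open>As \<open>Ka a\<close> is a subset of K, this is the Hausdorff distance of the
    two sets as soon as \<open>Ka a\<close> is nonempty.\<close>
  define h where "h a = (SUP x\<in>K. infdist x (Ka a))" for a
  have bdd: "bdd_above ((\<lambda>x. infdist x (Ka a)) ` K)" for a
    by (intro bounded_imp_bdd_above compact_imp_bounded compact_continuous_image continuous_intros K)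
  have hub: "infdist x (Ka a) \<le> h a" if "x \<in> K" for x a
    unfolding h_def using that bdd by (rule cSUP_upper)
  have h_le: "h a \<le> b" if "\<And>x. x \<in> K \<Longrightarrow> infdist x (Ka a) \<le> b" for a b
    unfolding h_def by (rule cSUP_least[OF K(2) that])
  have h0: "0 \<le> h a" for a
    using hub[of _ a] K(2) infdist_nonneg order_trans by (metis ex_in_conv)
  have ne: "\<forall>\<^sub>F a in at_right 0. Ka a \<noteq> {}"
    using lattice_approximation_eventually[OF L K, of 1] unfolding Ka_def by (auto elim: eventually_mono)
  have hlim: "(h \<longlongrightarrow> 0) (at_right 0)"
  proof (rule tendstoI)
    fix e :: real assume e: "0 < e"
    then have "\<forall>\<^sub>F a in at_right 0. K \<inter> (*\<^sub>R) a ` L \<noteq> {} \<and> (\<forall>x\<in>K. infdist x (K \<inter> (*\<^sub>R) a ` L) \<le> e / 2)"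
      using lattice_approximation_eventually[OF L K, of "e / 2"] by simp
    then show "\<forall>\<^sub>F a in at_right 0. dist (h a) 0 < e"
    proof eventually_elim
      case (elim a)
      then have "h a \<le> e / 2" by (intro h_le) (simp add: Ka_def)
      then show ?case using h0[of a] e by simp
    qed
  qed
  have err: "((\<lambda>a. proj_err K (Ka a) T) \<longlongrightarrow> 0) (at_right 0)" if "0 < T" for T
    by (rule proj_err_tendsto_at_right[OF K(1,2) that _ hlim])
      (use ne in \<open>eventually_elim, use Kac Kas hub in auto\<close>)
  obtain D0 where D0: "K \<subseteq> cball 0 D0" using bounded_subset_cball0E[OF compact_imp_bounded[OF K(1)]] by blast
  \<comment> \<open>The constant of \<open>voronoi_bounds\<close> at radius T: the maximum meets its
    requirements that D be at least 1 and T and that K lie in the ball of radius D.\<close>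
  define c where "c T = (2 * real (r + s) + 1) * max D0 (max 1 T) ^ (r + s)" for T
  have c0: "0 \<le> c T" for T by (simp add: c_def)
  have vb: "0 \<le> d_bL (r + s) (voronoi_measure T r s K) (voronoi_measure T r s (Ka a))"
      "d_bL (r + s) (voronoi_measure T r s K) (voronoi_measure T r s (Ka a)) \<le> c T * proj_err K (Ka a) T"
      "\<And>vs. unit_args (r + s) vs \<Longrightarrow> \<bar>voronoi_tensor T r s (Ka a) vs - voronoi_tensor T r s K vs\<bar> \<le> c T * proj_err K (Ka a) T"
    if "Ka a \<noteq> {}" for a T
  proof -
    have D: "K \<subseteq> cball 0 (max D0 (max 1 T))" using D0 by auto
    note v = voronoi_bounds[OF K(1) Kac that Kas D, of T r s, folded c_def]
    show "0 \<le> d_bL (r + s) (voronoi_measure T r s K) (voronoi_measure T r s (Ka a))"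
      "d_bL (r + s) (voronoi_measure T r s K) (voronoi_measure T r s (Ka a)) \<le> c T * proj_err K (Ka a) T"
      "\<And>vs. unit_args (r + s) vs \<Longrightarrow> \<bar>voronoi_tensor T r s (Ka a) vs - voronoi_tensor T r s K vs\<bar> \<le> c T * proj_err K (Ka a) T"
      using v by auto
  qed
  have errc: "((\<lambda>a. c T * proj_err K (Ka a) T) \<longlongrightarrow> 0) (at_right 0)" if "0 < T" for T
    using tendsto_mult[OF tendsto_const err[OF that]] by simp
  have part1: "((\<lambda>a. d_bL (r + s) (voronoi_measure R r s K) (voronoi_measure R r s (Ka a))) \<longlongrightarrow> 0) (at_right 0)"
  proof (rule tendsto_sandwich[OF _ _ tendsto_const errc[OF R]])
    show "\<forall>\<^sub>F a in at_right 0. 0 \<le> d_bL (r + s) (voronoi_measure R r s K) (voronoi_measure R r s (Ka a))"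
      using ne by eventually_elim (rule vb(1))
    show "\<forall>\<^sub>F a in at_right 0. d_bL (r + s) (voronoi_measure R r s K) (voronoi_measure R r s (Ka a)) \<le> c R * proj_err K (Ka a) R"
      using ne by eventually_elim (rule vb(2))
  qed
  have part2: "((\<lambda>a. tensor_norm (r + s) (\<lambda>vs. voronoi_tensor R r s (Ka a) vs - voronoi_tensor R r s K vs)) \<longlongrightarrow> 0) (at_right 0)"
  proof (rule tendsto_sandwich[OF _ _ tendsto_const errc[OF R]])
    have tn: "0 \<le> tensor_norm (r + s) (\<lambda>vs. voronoi_tensor R r s (Ka a) vs - voronoi_tensor R r s K vs)"
      "tensor_norm (r + s) (\<lambda>vs. voronoi_tensor R r s (Ka a) vs - voronoi_tensor R r s K vs) \<le> c R * proj_err K (Ka a) R"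
      if "Ka a \<noteq> {}" for a
      by (rule tensor_norm_bounds[where b = "c R * proj_err K (Ka a) R"], rule vb(3)[OF that], assumption)+
    show "\<forall>\<^sub>F a in at_right 0. 0 \<le> tensor_norm (r + s) (\<lambda>vs. voronoi_tensor R r s (Ka a) vs - voronoi_tensor R r s K vs)"
      using ne by eventually_elim (rule tn(1))
    show "\<forall>\<^sub>F a in at_right 0. tensor_norm (r + s) (\<lambda>vs. voronoi_tensor R r s (Ka a) vs - voronoi_tensor R r s K vs) \<le> c R * proj_err K (Ka a) R"
      using ne by eventually_elim (rule tn(2))
  qed
  have part3: "(\<forall>k\<le>DIM('a).
           ((\<lambda>a. tensor_norm (r + s) (\<lambda>vs. minkowski_estimator \<rho> k r s (Ka a) vs - minkowski_tensor k r s K vs)) \<longlongrightarrow> 0) (at_right 0)) \<and>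
        ((\<exists>\<delta>>0. delta_regular \<delta> K) \<or> convex K \<longrightarrow>
           (\<forall>k\<le>DIM('a).
              (\<lambda>a. tensor_norm (r + s) (\<lambda>vs. minkowski_estimator \<rho> k r s (Ka a) vs - minkowski_tensor k r s K vs))
              \<in> O[at_right 0](\<lambda>a. if r = 0 \<and> s = 0 then a else sqrt a)))"
    if reach: "0 < reach K" and \<rho>: "0 < \<rho> 0" "\<forall>i<DIM('a). \<rho> i < \<rho> (Suc i)" "ereal (\<rho> DIM('a)) < reach K"
  proof -
    interpret positive_reach K by unfold_locales (use K reach in auto)
    have mono: "\<rho> i \<le> \<rho> j" if "i \<le> j" "j \<le> DIM('a)" for i j
      using that
    proof (induction j)
      case (Suc j)
      then show ?case using \<rho>(2)[rule_format, of j] by (cases "i = Suc j") auto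
    qed simp
    have \<rho>I: "\<rho> i \<in> I" if "i \<le> DIM('a)" for i
    proof -
      have "0 < \<rho> i" using \<rho>(1) mono[of 0 i] that by simp
      moreover have "ereal (\<rho> i) \<le> ereal (\<rho> DIM('a))" using mono[OF that] by simp
      ultimately show ?thesis using le_less_trans[OF _ \<rho>(3)] by (simp add: I_def)
    qed
    have \<rho>pos: "0 < \<rho> i" if "i \<le> DIM('a)" for i using \<rho>I[OF that] by (simp add: I_def)
    define B where "B k i = \<bar>the (mat_inverse (steiner_matrix DIM('a) r s \<rho>)) $$ (DIM('a) - k, i)\<bar>" for k i
    \<comment> \<open>The estimator is exact when fed with the Voronoi tensors of K itself, by
      \<open>voronoi_steiner\<close> and \<open>steiner_matrix_inverse\<close>. By linearity only
      the errors of the Voronoi tensors remain, weighted with one row of the inverse.\<close>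
    have diff: "\<bar>minkowski_estimator \<rho> k r s (Ka a) vs - minkowski_tensor k r s K vs\<bar> \<le> (\<Sum>i\<le>DIM('a). B k i * e i)"
      if k: "k \<le> DIM('a)" and vs: "unit_args (r + s) vs"
        and e: "\<And>i. i \<le> DIM('a) \<Longrightarrow> \<bar>voronoi_tensor (\<rho> i) r s (Ka a) vs - voronoi_tensor (\<rho> i) r s K vs\<bar> \<le> e i" for k vs a e
    proof -
      let ?b = "\<lambda>i. the (mat_inverse (steiner_matrix DIM('a) r s \<rho>)) $$ (DIM('a) - k, i)"
      have "(\<Sum>i\<le>DIM('a). ?b i * voronoi_tensor (\<rho> i) r s K vs) = minkowski_tensor (DIM('a) - (DIM('a) - k)) r s K vs"
      proof -
        have "(\<Sum>i\<le>DIM('a). ?b i * voronoi_tensor (\<rho> i) r s K vs) = (\<Sum>i\<le>DIM('a). ?b i *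
           (\<Sum>j\<le>DIM('a). fact r * fact s * (unit_ball_vol (real (s + j)) * \<rho> i ^ (s + j)) * minkowski_tensor (DIM('a) - j) r s K vs))"
          by (intro sum.cong refl) (simp only: voronoi_steiner[OF \<rho>I vs] atMost_iff)
        also have "\<dots> = minkowski_tensor (DIM('a) - (DIM('a) - k)) r s K vs"
          by (rule steiner_matrix_inverse) (use \<rho> in auto)
        finally show ?thesis .
      qed
      then have "minkowski_estimator \<rho> k r s (Ka a) vs - minkowski_tensor k r s K vs =
          (\<Sum>i\<le>DIM('a). ?b i * (voronoi_tensor (\<rho> i) r s (Ka a) vs - voronoi_tensor (\<rho> i) r s K vs))"
        using k by (simp add: minkowski_estimator_def right_diff_distrib sum_subtractf)
      also have "\<bar>\<dots>\<bar> \<le> (\<Sum>i\<le>DIM('a). B k i * e i)"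
        by (rule order_trans[OF sum_abs sum_mono]) (auto simp: abs_mult B_def intro!: mult_left_mono e)
      finally show ?thesis .
    qed
    have conv: "((\<lambda>a. tensor_norm (r + s) (\<lambda>vs. minkowski_estimator \<rho> k r s (Ka a) vs - minkowski_tensor k r s K vs)) \<longlongrightarrow> 0) (at_right 0)"
      if k: "k \<le> DIM('a)" for k
    proof (rule tendsto_sandwich[OF _ _ tendsto_const])
      let ?E = "\<lambda>a. \<Sum>i\<le>DIM('a). B k i * (c (\<rho> i) * proj_err K (Ka a) (\<rho> i))"
      have b: "\<bar>minkowski_estimator \<rho> k r s (Ka a) vs - minkowski_tensor k r s K vs\<bar> \<le> ?E a"
        if "Ka a \<noteq> {}" "unit_args (r + s) vs" for a vs
        by (rule diff[OF k that(2)]) (rule vb(3)[OF that])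
      show "\<forall>\<^sub>F a in at_right 0. 0 \<le> tensor_norm (r + s) (\<lambda>vs. minkowski_estimator \<rho> k r s (Ka a) vs - minkowski_tensor k r s K vs)"
        using ne by eventually_elim (rule tensor_norm_bounds(1)[OF b])
      show "\<forall>\<^sub>F a in at_right 0. tensor_norm (r + s) (\<lambda>vs. minkowski_estimator \<rho> k r s (Ka a) vs - minkowski_tensor k r s K vs) \<le> ?E a"
        using ne by eventually_elim (rule tensor_norm_bounds(2)[OF b])
      have "(?E \<longlongrightarrow> (\<Sum>i\<le>DIM('a). B k i * 0)) (at_right 0)"
        by (intro tendsto_sum tendsto_mult tendsto_const errc \<rho>pos) simp
      then show "(?E \<longlongrightarrow> 0) (at_right 0)" by simp
    qed
    have rate: "(\<lambda>a. tensor_norm (r + s) (\<lambda>vs. minkowski_estimator \<rho> k r s (Ka a) vs - minkowski_tensor k r s K vs))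
              \<in> O[at_right 0](\<lambda>a. if r = 0 \<and> s = 0 then a else sqrt a)"
      if k: "k \<le> DIM('a)" and reg: "(\<exists>\<delta>>0. delta_regular \<delta> K) \<or> convex K" for k
    proof -
      have "interior_balls K" using reg interior_balls_convex[OF K] interior_balls_delta_regular[OF K(1,2)] by blast
      then obtain C where C: "0 < C"
        "\<forall>\<^sub>F a in at_right 0. K \<inter> (*\<^sub>R) a ` L \<noteq> {} \<and> (\<forall>x\<in>K. infdist x (K \<inter> (*\<^sub>R) a ` L) \<le> C * a)"
        using lattice_approximation_rate[OF L K(2)] by blast
      \<comment> \<open>Packing the quantifiers over K' and h allows the constants for all radii
        \<rho> i to be chosen at once.\<close>
      define Q where "Q i C0 h0 \<longleftrightarrow> (\<forall>K' h. compact K' \<longrightarrow> K' \<noteq> {} \<longrightarrow> K' \<subseteq> K \<longrightarrow> 0 \<le> h \<longrightarrow> h \<le> h0 \<longrightarrow> (\<forall>x\<in>K. infdist x K' \<le> h) \<longrightarrow>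
         measure lebesgue (parallel_set K (\<rho> i) - parallel_set K' (\<rho> i)) \<le> C0 * h \<and> proj_err K K' (\<rho> i) \<le> C0 * sqrt h)" for i C0 h0
      have "\<exists>C0 h0. 0 \<le> C0 \<and> 0 < h0 \<and> Q i C0 h0" if i: "i \<le> DIM('a)" for i
      proof (rule approximation_rate[OF \<rho>I[OF i]])
        fix C0 h0
        assume "0 \<le> C0" "0 < h0" "\<And>K' h. compact K' \<Longrightarrow> K' \<noteq> {} \<Longrightarrow> K' \<subseteq> K \<Longrightarrow> 0 \<le> h \<Longrightarrow> h \<le> h0 \<Longrightarrow> \<forall>x\<in>K. infdist x K' \<le> h \<Longrightarrow>
           measure lebesgue (parallel_set K (\<rho> i) - parallel_set K' (\<rho> i)) \<le> C0 * h \<and> proj_err K K' (\<rho> i) \<le> C0 * sqrt h"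
        then show ?thesis unfolding Q_def by blast
      qed
      then obtain Ci hi where Ci: "\<And>i. i \<le> DIM('a) \<Longrightarrow> 0 \<le> Ci i" "\<And>i. i \<le> DIM('a) \<Longrightarrow> 0 < hi i"
        "\<And>i. i \<le> DIM('a) \<Longrightarrow> Q i (Ci i) (hi i)"
        by metis
      define g where "g a = (if r = 0 \<and> s = 0 then a else sqrt a)" for a :: real
      \<comment> \<open>Rank 0 takes the volume bound Ci (C a), the other ranks take the projection
        bound with Ci sqrt (C a); \<open>g a\<close> carries the power of a.\<close>
      define w where "w i = (if r = 0 \<and> s = 0 then Ci i * C else c (\<rho> i) * (Ci i * sqrt C))" for i
      define H where "H = Min (hi ` {..DIM('a)})"
      have H: "0 < H" "\<And>i. i \<le> DIM('a) \<Longrightarrow> H \<le> hi i" unfolding H_def using Ci(2) by auto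
      have small: "\<forall>\<^sub>F a in at_right 0. a < H / C"
        using H C by (intro eventually_at_right_real[of 0 "H / C", THEN eventually_mono]) auto
      have "\<forall>\<^sub>F a in at_right 0. norm (tensor_norm (r + s) (\<lambda>vs. minkowski_estimator \<rho> k r s (Ka a) vs - minkowski_tensor k r s K vs))
         \<le> (\<Sum>i\<le>DIM('a). B k i * w i) * norm (g a)"
        using C(2) small eventually_at_right_less[of "0::real"]
      proof eventually_elim
        case (elim a)
        have a: "0 < a" "C * a \<le> H" "0 \<le> C * a" using elim C(1) by (auto simp: less_divide_eq mult.commute)
        have Kne: "Ka a \<noteq> {}" and Kd: "\<forall>x\<in>K. infdist x (Ka a) \<le> C * a" using elim(1) unfolding Ka_def by auto
        have g0: "0 \<le> g a" using a by (simp add: g_def)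
        have bi: "\<bar>voronoi_tensor (\<rho> i) r s (Ka a) vs - voronoi_tensor (\<rho> i) r s K vs\<bar> \<le> w i * g a"
          if i: "i \<le> DIM('a)" and vs: "unit_args (r + s) vs" for i vs
        proof -
          have rt: "measure lebesgue (parallel_set K (\<rho> i) - parallel_set (Ka a) (\<rho> i)) \<le> Ci i * (C * a)"
            "proj_err K (Ka a) (\<rho> i) \<le> Ci i * sqrt (C * a)"
            using Ci(3)[OF i] Kac Kne Kas a(3) order_trans[OF a(2) H(2)[OF i]] Kd unfolding Q_def by blast+
          show ?thesis
          proof (cases "r = 0 \<and> s = 0")
            \<comment> \<open>In rank 0 the only argument list is empty, and the error is exactly
              the volume of the lost layer.\<close>
            case True
            then have v: "vs = []" using vs by (simp add: unit_args_00)
            have sub: "parallel_set (Ka a) (\<rho> i) \<subseteq> parallel_set K (\<rho> i)" by (rule parallel_set_mono[OF Kas Kne])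
            have "measure lebesgue (parallel_set K (\<rho> i) - parallel_set (Ka a) (\<rho> i)) =
                measure lebesgue (parallel_set K (\<rho> i)) - measure lebesgue (parallel_set (Ka a) (\<rho> i))"
              by (rule measurable_measure_Diff[OF parallel_set_lmeasurable[OF K(1,2)] _ sub]) simp
            moreover have "0 \<le> measure lebesgue (parallel_set K (\<rho> i) - parallel_set (Ka a) (\<rho> i))" by simp
            ultimately have "\<bar>voronoi_tensor (\<rho> i) 0 0 (Ka a) [] - voronoi_tensor (\<rho> i) 0 0 K []\<bar> =
               measure lebesgue (parallel_set K (\<rho> i) - parallel_set (Ka a) (\<rho> i))"
              unfolding voronoi_tensor_00[OF K(1,2)] voronoi_tensor_00[OF Kac Kne] by linarith
            then show ?thesis using rt(1) True v by (simp add: w_def g_def mult.assoc)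
          next
            case False
            have "\<bar>voronoi_tensor (\<rho> i) r s (Ka a) vs - voronoi_tensor (\<rho> i) r s K vs\<bar> \<le> c (\<rho> i) * proj_err K (Ka a) (\<rho> i)"
              by (rule vb(3)[OF Kne vs])
            also have "\<dots> \<le> c (\<rho> i) * (Ci i * sqrt (C * a))" using rt(2) c0 by (intro mult_left_mono)
            also have "\<dots> = w i * g a" using False unfolding w_def g_def by (simp only: real_sqrt_mult if_False mult.assoc)
            finally show ?thesis .
          qed
        qed
        have "\<bar>minkowski_estimator \<rho> k r s (Ka a) vs - minkowski_tensor k r s K vs\<bar> \<le> (\<Sum>i\<le>DIM('a). B k i * (w i * g a))"
          if vs: "unit_args (r + s) vs" for vs
          by (rule diff[OF k vs]) (rule bi[OF _ vs])
        from tensor_norm_bounds[where p = "r + s" and T = "\<lambda>vs. minkowski_estimator \<rho> k r s (Ka a) vs - minkowski_tensor k r s K vs", OF this]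
        have tn: "0 \<le> tensor_norm (r + s) (\<lambda>vs. minkowski_estimator \<rho> k r s (Ka a) vs - minkowski_tensor k r s K vs)"
          "tensor_norm (r + s) (\<lambda>vs. minkowski_estimator \<rho> k r s (Ka a) vs - minkowski_tensor k r s K vs) \<le> (\<Sum>i\<le>DIM('a). B k i * (w i * g a))"
          by blast+
        have "(\<Sum>i\<le>DIM('a). B k i * (w i * g a)) = (\<Sum>i\<le>DIM('a). B k i * w i) * g a"
          by (simp add: sum_distrib_right mult.assoc)
        then show ?case using tn g0 by simp
      qed
      then have "(\<lambda>a. tensor_norm (r + s) (\<lambda>vs. minkowski_estimator \<rho> k r s (Ka a) vs - minkowski_tensor k r s K vs)) \<in> O[at_right 0](g)"
        by (rule bigoI)
      then show ?thesis unfolding g_def[abs_def] .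
    qed
    show ?thesis using conv rate by blast
  qed
  show ?thesis using part1 part2 part3 unfolding Ka_def by blast
qed

end
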